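(* Let $(\Omega,\mathcal F,(\mathcal F_t)_{t\ge0},\mathbb P)$ be a filtered probability space satisfying the usual conditions, $B$ an $(\mathcal F_t)$-adapted $d$-dimensional Brownian motion started at $0$, and let $\mathbf I=\{1,\dots,m\}$. For each $i\in\mathbf I$ let $\phi_i:\mathbb R\to(-\infty,+\infty]$ be convex and lower semicontinuous with $\phi_i=+\infty$ on $(-\infty,0)$ and $\phi_i$ of class $C^1$ on $(0,\infty)$; let $n_i$ be pairwise distinct unit vectors of $\mathbb R^d$ and $a_i\in\mathbb R$. Set $\Phi(x)=\sum_{i}\phi_i(x\cdot n_i-a_i)$, $D=\{x: x\cdot n_i>a_i\ \forall i\}$, assumed nonempty. Let $(X,L)$ be the solution of the multivalued SDE associated with $\Phi$ (see context) with $\mathcal F_0$-measurable initial condition $X_0\in\overline D$. For $i\in\mathbf I$ let $H_i=\{x: x\cdot n_i=a_i\}$, $K_i=\{x: x\cdot n_i=a_i,\ x\cdot n_j>a_j\ \forall j\ne i\}$, $\sigma_i=\inf\{t>0:X_t\in H_i\}$, $\tau_i=\inf\{t>0:X_t\in K_i\}$, and $p_i(x)=\int_1^x\exp\{2(\phi_i(u)-\phi_i(1))\}\,du$ for $x\ge0$. If $i\in\mathbf I$ satisfies $p_i(0)=-\infty$, equivalently $\int_{0+}\exp\{2\phi_i(u)\}\,du=\infty$, then $\mathbb P(\sigma_i=\infty)=\mathbb P(\tau_i=\infty)=1$.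
   Context: A unit vector $n(x)$ is a unit inward normal to $D$ at $x\in\partial D$ if $n(x)\cdot(x-z)\le0$ for all $z\in\overline D$. The solution of the multivalued SDE associated with $\Phi$ (which exists and is unique) is the pair consisting of a continuous $(\mathcal F_t)$-adapted $\overline D$-valued process $X$ and a continuous $(\mathcal F_t)$-adapted nondecreasing process $L$ such that for all $t\ge0$: $X_t=X_0+B_t-\int_0^t\nabla\Phi(X_s)\,ds+\int_0^t n_s\,dL_s$ and $L_t=\int_0^t\mathbf 1_{\{X_s\in\partial D\}}dL_s$, where $n_s$ is $dL_s$-a.e. a unit inward normal to $D$ at $X_s$; here $\nabla\Phi(x)=\sum_i n_i\phi_i'(x\cdot n_i-a_i)$ on $D$. *)

theory Defs
  imports "HOL-Probability.Probability"
begin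

(* Convexity of an extended-real valued function R -> (-inf, +inf] (ereal arithmetic, 0 * inf = 0) *)
definition convex_ereal :: "(real \<Rightarrow> ereal) \<Rightarrow> bool" where
  "convex_ereal f \<longleftrightarrow> (\<forall>x y u. 0 \<le> u \<and> u \<le> 1 \<longrightarrow>
      f (u * x + (1 - u) * y) \<le> ereal u * f x + ereal (1 - u) * f y)"

definition lsc_ereal :: "(real \<Rightarrow> ereal) \<Rightarrow> bool" where
  "lsc_ereal f \<longleftrightarrow> (\<forall>x. f x \<le> Liminf (at x) f)"

definition C1_pos :: "(real \<Rightarrow> ereal) \<Rightarrow> bool" where
  "C1_pos f \<longleftrightarrow> (\<exists>g g'. (\<forall>x>0. f x = ereal (g x)) \<and>
      (\<forall>x>0. (g has_real_derivative g' x) (at x)) \<and> continuous_on {0<..} g')"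

definition admissible_phi :: "(real \<Rightarrow> ereal) \<Rightarrow> bool" where
  "admissible_phi f \<longleftrightarrow> convex_ereal f \<and> lsc_ereal f \<and> (\<forall>x<0. f x = \<infinity>) \<and> C1_pos f"

definition dphi :: "(real \<Rightarrow> ereal) \<Rightarrow> real \<Rightarrow> real" where
  "dphi f x = deriv (\<lambda>u. real_of_ereal (f u)) x"

definition scale_p :: "(real \<Rightarrow> ereal) \<Rightarrow> real \<Rightarrow> ereal" where
  "scale_p f x = (let h = (\<lambda>u. ennreal (exp (2 * (real_of_ereal (f u) - real_of_ereal (f 1))))) in
     if 1 \<le> x then enn2ereal (\<integral>\<^sup>+ u \<in> {1..x}. h u \<partial>lborel)
     else - enn2ereal (\<integral>\<^sup>+ u \<in> {x<..1}. h u \<partial>lborel))"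

definition domD :: "nat \<Rightarrow> (nat \<Rightarrow> real ^ 'd) \<Rightarrow> (nat \<Rightarrow> real) \<Rightarrow> (real ^ 'd) set" where
  "domD m n a = {x. \<forall>i\<in>{1..m}. x \<bullet> n i > a i}"

definition gradPhi :: "nat \<Rightarrow> (nat \<Rightarrow> real \<Rightarrow> ereal) \<Rightarrow> (nat \<Rightarrow> real ^ 'd) \<Rightarrow> (nat \<Rightarrow> real)
    \<Rightarrow> real ^ 'd \<Rightarrow> real ^ 'd" where
  "gradPhi m phi n a x = (\<Sum>i\<in>{1..m}. dphi (phi i) (x \<bullet> n i - a i) *\<^sub>R n i)"

definition inward_normal :: "('a::real_inner) set \<Rightarrow> 'a \<Rightarrow> 'a \<Rightarrow> bool" where
  "inward_normal D x v \<longleftrightarrow> x \<in> frontier D \<and> norm v = 1 \<and> (\<forall>z\<in>closure D. v \<bullet> (x - z) \<le> 0)"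

definition usual_filtration :: "'w measure \<Rightarrow> (real \<Rightarrow> 'w set set) \<Rightarrow> bool" where
  "usual_filtration M F \<longleftrightarrow>
     complete_measure M \<and>
     (\<forall>t\<ge>0. sigma_algebra (space M) (F t) \<and> F t \<subseteq> sets M) \<and>
     (\<forall>s t. 0 \<le> s \<and> s \<le> t \<longrightarrow> F s \<subseteq> F t) \<and>
     null_sets M \<subseteq> F 0 \<and>
     (\<forall>t\<ge>0. F t = (\<Inter>s\<in>{t<..}. F s))"

definition adapted :: "'w measure \<Rightarrow> (real \<Rightarrow> 'w set set) \<Rightarrow> (real \<Rightarrow> 'w \<Rightarrow> 'b::topological_space) \<Rightarrow> bool" where
  "adapted M F Y \<longleftrightarrow> (\<forall>t\<ge>0. \<forall>A\<in>sets borel. {\<omega>\<in>space M. Y t \<omega> \<in> A} \<in> F t)"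

definition brownian_motion :: "'w measure \<Rightarrow> (real \<Rightarrow> 'w set set) \<Rightarrow> (real \<Rightarrow> 'w \<Rightarrow> real ^ 'd) \<Rightarrow> bool" where
  "brownian_motion M F B \<longleftrightarrow>
     adapted M F B \<and>
     (AE \<omega> in M. B 0 \<omega> = 0 \<and> continuous_on {0..} (\<lambda>t. B t \<omega>)) \<and>
     (\<forall>s t. 0 \<le> s \<and> s < t \<longrightarrow>
        distr M borel (\<lambda>\<omega>. B t \<omega> - B s \<omega>) =
          density lborel (\<lambda>x. \<Prod>j\<in>UNIV. ennreal (normal_density 0 (sqrt (t - s)) (x $ j))) \<and>
        (\<forall>A\<in>F s. \<forall>C\<in>sets borel.
           measure M (A \<inter> {\<omega>\<in>space M. B t \<omega> - B s \<omega> \<in> C}) =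
           measure M A * measure M {\<omega>\<in>space M. B t \<omega> - B s \<omega> \<in> C}))"

(* Stieltjes measure dL on R induced by a path L defined on [0, inf) (no mass on (-inf,0]) *)
definition dL :: "(real \<Rightarrow> real) \<Rightarrow> real measure" where
  "dL l = interval_measure (\<lambda>s. l (max 0 s))"

definition msde_path :: "(real ^ 'd) set \<Rightarrow> (real ^ 'd \<Rightarrow> real ^ 'd)
     \<Rightarrow> (real \<Rightarrow> real ^ 'd) \<Rightarrow> (real \<Rightarrow> real ^ 'd) \<Rightarrow> (real \<Rightarrow> real) \<Rightarrow> bool" where
  "msde_path D G b x l \<longleftrightarrow>
     continuous_on {0..} x \<and> (\<forall>t\<ge>0. x t \<in> closure D) \<and>
     continuous_on {0..} l \<and> mono_on {0..} l \<and>
     (\<exists>nv. (AE s in dL l. 0 \<le> s \<longrightarrow> inward_normal D (x s) (nv s)) \<and>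
        (\<forall>t\<ge>0.
           (AE s in lborel. s \<in> {0..t} \<longrightarrow> x s \<in> D) \<and>
           set_integrable lborel {0..t} (\<lambda>s. G (x s)) \<and>
           set_integrable (dL l) {0..t} nv \<and>
           x t = x 0 + b t - (LINT s:{0..t}|lborel. G (x s)) + (LINT s:{0..t}|dL l. nv s) \<and>
           l t = (LINT s:{0..t}|dL l. indicator (frontier D) (x s))))"

definition msde_solution :: "'w measure \<Rightarrow> (real \<Rightarrow> 'w set set) \<Rightarrow> (real \<Rightarrow> 'w \<Rightarrow> real ^ 'd)
     \<Rightarrow> (real ^ 'd) set \<Rightarrow> (real ^ 'd \<Rightarrow> real ^ 'd)
     \<Rightarrow> (real \<Rightarrow> 'w \<Rightarrow> real ^ 'd) \<Rightarrow> (real \<Rightarrow> 'w \<Rightarrow> real) \<Rightarrow> bool" where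
  "msde_solution M F B D G X L \<longleftrightarrow> adapted M F X \<and> adapted M F L \<and>
     (AE \<omega> in M. msde_path D G (\<lambda>t. B t \<omega>) (\<lambda>t. X t \<omega>) (\<lambda>t. L t \<omega>))"

definition hit_time :: "(real \<Rightarrow> 'w \<Rightarrow> 'b) \<Rightarrow> 'b set \<Rightarrow> 'w \<Rightarrow> ereal" where
  "hit_time X A \<omega> = Inf {ereal t | t. t > 0 \<and> X t \<omega> \<in> A}"

end

theory Submission
  imports Defs
begin

text \<open>
  Points of the wall \<open>H\<^sub>i\<close> are classified by the set \<open>J\<close> of constraints active there. Near a point
  with active set \<open>J\<close> only the drifts and reflections belonging to \<open>J\<close> are singular; with \<open>Y\<close> the
  projection of \<open>X\<close> minus that point to the span of the normals in \<open>J\<close>, the inward normals \<open>v\<close>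
  satisfy \<open>Y \<bullet> v \<ge> 0\<close>, and monotonicity of the \<open>\<phi>\<^sub>j'\<close> bounds the singular drifts from the
  favourable side. Hence \<open>|Y|\<close> dominates a one-dimensional diffusion with drift
  \<open>- \<psi>' - C\<close>, where \<open>\<psi> = \<phi>\<^sub>i\<close> if \<open>J = {i}\<close> and \<open>\<psi> = - ln / 2\<close> (a planar Bessel process) if the span has
  dimension at least two; here distinctness of the normals and nonemptiness of \<open>D\<close> enter. In both
  cases \<open>w(|Y|\<^sup>2)\<close>, where \<open>w(r\<^sup>2)\<close> has \<open>r\<close>-derivative \<open>- exp (2 \<psi>(r) + 2 C r)\<close>, is a local supermartingale
  that explodes at \<open>Y = 0\<close>, so \<open>Y = 0\<close> is not reached from outside. A start on the wall is
  harmless: \<open>X\<^sub>s \<in> D\<close> almost surely for almost every \<open>s\<close>, so the argument can be restarted at a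
  countable dense set of such times.

  Instead of the Ito formula, the supermartingale inequality rests on a Taylor expansion along a time
  grid, stopped at the last grid time before the path leaves a good region; only moments of the
  independent Gaussian increments up to order four enter.
\<close>

section \<open>Moments of Gaussian vectors\<close>

text \<open>The drift blows up at the wall and the reflection term has no density in time; along a
  path both only have finite variation. So \<open>X - B\<close> enters through a nondecreasing clock
  \<open>q\<close> that dominates its increments: an error linear in \<open>X - B\<close> may be a
  small factor times an increment of \<open>q\<close>, and capping \<open>q\<close> makes the sum of
  these errors small. The one contribution of \<open>X - B\<close> that is not small is its product
  with the gradient of w(|Y|^2), and there only the sign is used. This gradient is frozen at the
  left grid point while the sign condition holds at the current point, so small oscillation within
  each step belongs to the good region.

  Writing the Lyapunov function in terms of |Y|^2 makes the increment of its argument an exact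
  quadratic polynomial in the step. As \<phi>_i is only C^1, \<open>w\<close> is only C^2, and the
  oscillation of \<open>w''\<close> does the work of a third derivative.

  Errors vanish in two stages: a tolerance \<open>eps\<close> is fixed, then the mesh tends to 0.
  Their total is then below 1, and a Markov bound (v0 + 1) / lam remains, with \<open>lam\<close>
  the arbitrarily large level of the Lyapunov function close to Y = 0.\<close>

lemma bij_betw_axis_Basis: "bij_betw (\<lambda>j::'d::finite. axis j (1::real)) UNIV Basis"
  unfolding bij_betw_def by (auto simp: Basis_vec_def inj_def axis_eq_axis)

lemma vec_nth_sum_Basis: "(\<Sum>b\<in>Basis. h b *\<^sub>R b :: real^'d::finite) $ j = h (axis j 1)"
proof -
  have "(\<Sum>b\<in>Basis. h b *\<^sub>R b :: real^'d) $ j = (\<Sum>b\<in>Basis. h b *\<^sub>R b) \<bullet> axis j 1"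
    by (simp add: cart_eq_inner_axis)
  also have "\<dots> = h (axis j 1)"
    by (rule inner_sum_left_Basis) (auto simp: Basis_vec_def)
  finally show ?thesis .
qed

text \<open>\<open>lborel\<close> is the image of a product of one-dimensional Lebesgue measures
  indexed by \<open>Basis\<close>, so Fubini for products applies once the coordinate
  \<open>j\<close> is exchanged for the basis vector \<open>axis j 1\<close>.\<close>

lemma lborel_vec_prod:
  fixes f :: "'d::finite \<Rightarrow> real \<Rightarrow> real"
  assumes f: "\<And>j. integrable lborel (f j)"
  shows "integrable lborel (\<lambda>x::real^'d. \<Prod>j\<in>UNIV. f j (x $ j))"
    and "integral\<^sup>L lborel (\<lambda>x::real^'d. \<Prod>j\<in>UNIV. f j (x $ j)) = (\<Prod>j\<in>UNIV. integral\<^sup>L lborel (f j))"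
proof -
  interpret product_sigma_finite "\<lambda>_::real^'d. lborel :: real measure" ..
  define ix where "ix = inv_into UNIV (\<lambda>j::'d. axis j (1::real))"
  have ix: "ix (axis j 1) = j" for j
    unfolding ix_def using bij_betw_axis_Basis by (auto simp: bij_betw_def intro: inv_f_f)
  have [measurable]: "f j \<in> borel_measurable borel" for j
    using borel_measurable_integrable[OF f] by simp
  have m: "(\<lambda>g. \<Sum>b\<in>Basis. g b *\<^sub>R b) \<in> (\<Pi>\<^sub>M b\<in>(Basis::(real^'d) set). lborel) \<rightarrow>\<^sub>M borel"
    by measurable
  have mf: "(\<lambda>x::real^'d. \<Prod>j\<in>UNIV. f j (x $ j)) \<in> borel_measurable borel" by measurable
  have P: "(\<Prod>j\<in>UNIV. f j ((\<Sum>b\<in>Basis. g b *\<^sub>R b :: real^'d) $ j)) = (\<Prod>b\<in>Basis. f (ix b) (g b))" for g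
    unfolding vec_nth_sum_Basis
    using prod.reindex_bij_betw[OF bij_betw_axis_Basis, of "\<lambda>b. f (ix b) (g b)"] by (simp add: ix)
  have P2: "(\<Prod>j\<in>UNIV. integral\<^sup>L lborel (f j)) = (\<Prod>b\<in>Basis. integral\<^sup>L lborel (f (ix b)))"
    using prod.reindex_bij_betw[OF bij_betw_axis_Basis, of "\<lambda>b. integral\<^sup>L lborel (f (ix b))"]
    by (simp add: ix)
  show "integrable lborel (\<lambda>x::real^'d. \<Prod>j\<in>UNIV. f j (x $ j))"
    by (subst lborel_eq, subst integrable_distr_eq[OF m mf])
       (unfold P, intro product_integrable_prod f finite_Basis)
  show "integral\<^sup>L lborel (\<lambda>x::real^'d. \<Prod>j\<in>UNIV. f j (x $ j)) = (\<Prod>j\<in>UNIV. integral\<^sup>L lborel (f j))"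
    by (subst lborel_eq, subst integral_distr[OF m mf])
       (unfold P P2, intro product_integral_prod f finite_Basis)
qed

text \<open>The centred Gaussian law with covariance \<sigma>^2 times the identity, in the very form
  that \<open>brownian_motion\<close> prescribes for increments.\<close>

definition gaussian_vec :: "real \<Rightarrow> (real^'d) measure" where
  "gaussian_vec \<sigma> = density lborel (\<lambda>x. \<Prod>j\<in>UNIV. ennreal (normal_density 0 \<sigma> (x $ j)))"

lemma sets_gaussian_vec [simp, measurable_cong]: "sets (gaussian_vec \<sigma>) = sets borel"
  by (simp add: gaussian_vec_def)

text \<open>The density is a product, so a monomial with exponent function \<open>e\<close>
  factorises into one-dimensional moments. Exponents supported on one or two coordinates give every
  case used later.\<close>

lemma gaussian_vec_moment:
  fixes e :: "'d::finite \<Rightarrow> nat"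
  assumes "0 < \<sigma>"
  shows "integrable (gaussian_vec \<sigma>) (\<lambda>x::real^'d. \<Prod>j\<in>UNIV. (x $ j) ^ e j)"
    and "integral\<^sup>L (gaussian_vec \<sigma>) (\<lambda>x. \<Prod>j\<in>UNIV. (x $ j) ^ e j)
      = (\<Prod>j\<in>UNIV. \<integral>x. normal_density 0 \<sigma> x * x ^ e j \<partial>lborel)"
proof -
  have I: "integrable lborel (\<lambda>x. normal_density 0 \<sigma> x * x ^ e j)" for j
    using integrable_normal_moment[of \<sigma> 0 "e j"] assms by simp
  have eq: "gaussian_vec \<sigma> = density lborel (\<lambda>x::real^'d. ennreal (\<Prod>j\<in>UNIV. normal_density 0 \<sigma> (x $ j)))"
    unfolding gaussian_vec_def by (simp add: prod_ennreal)
  note L = lborel_vec_prod[of "\<lambda>j x. normal_density 0 \<sigma> x * x ^ e j", OF I]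
  show "integrable (gaussian_vec \<sigma>) (\<lambda>x::real^'d. \<Prod>j\<in>UNIV. (x $ j) ^ e j)"
    unfolding eq using L(1)
    by (subst integrable_density) (auto simp: prod.distrib prod_nonneg)
  show "integral\<^sup>L (gaussian_vec \<sigma>) (\<lambda>x. \<Prod>j\<in>UNIV. (x $ j) ^ e j)
      = (\<Prod>j\<in>UNIV. \<integral>x. normal_density 0 \<sigma> x * x ^ e j \<partial>lborel)"
    unfolding eq using L(2)
    by (subst integral_density) (auto simp: prod.distrib prod_nonneg)
qed

lemma gaussian_vec_moment_cases:
  assumes "0 < \<sigma>"
  shows "(\<integral>x. normal_density 0 \<sigma> x * x ^ 0 \<partial>lborel) = 1"
    and "(\<integral>x. normal_density 0 \<sigma> x * x ^ 1 \<partial>lborel) = 0"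
    and "(\<integral>x. normal_density 0 \<sigma> x * x ^ 2 \<partial>lborel) = \<sigma>\<^sup>2"
    and "(\<integral>x. normal_density 0 \<sigma> x * x ^ 4 \<partial>lborel) = 3 * (\<sigma>\<^sup>2)\<^sup>2"
proof -
  show "(\<integral>x. normal_density 0 \<sigma> x * x ^ 0 \<partial>lborel) = 1"
    using integral_normal_moment_even[OF assms, of 0 0] by simp
  show "(\<integral>x. normal_density 0 \<sigma> x * x ^ 1 \<partial>lborel) = 0"
    using integral_normal_moment_odd[OF assms, of 0 0] by simp
  have "(\<integral>x. normal_density 0 \<sigma> x * (x - 0) ^ (2 * 1) \<partial>lborel) = \<sigma>\<^sup>2"
    unfolding integral_normal_moment_even[OF assms] by (simp add: fact_numeral)
  then show "(\<integral>x. normal_density 0 \<sigma> x * x ^ 2 \<partial>lborel) = \<sigma>\<^sup>2" by (simp only: diff_zero mult_1_right)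
  have "(\<integral>x. normal_density 0 \<sigma> x * (x - 0) ^ (2 * 2) \<partial>lborel) = 3 * (\<sigma>\<^sup>2)\<^sup>2"
    unfolding integral_normal_moment_even[OF assms] using assms by (simp add: fact_numeral power_divide)
  then show "(\<integral>x. normal_density 0 \<sigma> x * x ^ 4 \<partial>lborel) = 3 * (\<sigma>\<^sup>2)\<^sup>2" by simp
qed

lemma gaussian_vec_moments:
  fixes i j :: "'d::finite"
  assumes s: "0 < \<sigma>"
  shows "integrable (gaussian_vec \<sigma>) (\<lambda>x. x $ i)" "(\<integral>x. x $ i \<partial>gaussian_vec \<sigma>) = 0"
    and "integrable (gaussian_vec \<sigma>) (\<lambda>x. x $ i * x $ j)"
    and "(\<integral>x. x $ i * x $ j \<partial>gaussian_vec \<sigma>) = (if i = j then \<sigma>\<^sup>2 else 0)"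
    and "integrable (gaussian_vec \<sigma>) (\<lambda>x. (x $ i) ^ 4)"
    and "(\<integral>x. (x $ i) ^ 4 \<partial>gaussian_vec \<sigma>) = 3 * (\<sigma>\<^sup>2)\<^sup>2"
proof -
  note M = gaussian_vec_moment[OF s] and C = gaussian_vec_moment_cases[OF s]
  have C0: "(\<integral>x. normal_density 0 \<sigma> x \<partial>lborel) = 1" using C(1) by simp
  have C1: "(\<integral>x. normal_density 0 \<sigma> x * x \<partial>lborel) = 0" using C(2) by simp
  have single: "(\<Prod>l\<in>UNIV. (x $ l) ^ (if l = i then p else 0)) = (x $ i) ^ p" for p and x :: "real^'d"
    by (simp add: if_distrib[of "\<lambda>e. _ ^ e"] prod.delta cong: if_cong)
  have single': "(\<Prod>l\<in>(UNIV::'d set). \<integral>x. normal_density 0 \<sigma> x * x ^ (if l = i then p else 0) \<partial>lborel)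
      = (\<integral>x. normal_density 0 \<sigma> x * x ^ p \<partial>lborel)" for p
  proof -
    have "(\<Prod>l\<in>(UNIV::'d set). \<integral>x. normal_density 0 \<sigma> x * x ^ (if l = i then p else 0) \<partial>lborel)
      = (\<Prod>l\<in>(UNIV::'d set). if l = i then \<integral>x. normal_density 0 \<sigma> x * x ^ p \<partial>lborel else 1)"
      by (rule prod.cong) (auto simp: C0)
    then show ?thesis by (simp add: prod.delta)
  qed
  show "integrable (gaussian_vec \<sigma>) (\<lambda>x. x $ i)" "(\<integral>x. x $ i \<partial>gaussian_vec \<sigma>) = 0"
    using M[of "\<lambda>l. if l = i then 1 else 0"] by (simp_all only: single single' C(2) power_one_right C1)
  show "integrable (gaussian_vec \<sigma>) (\<lambda>x. (x $ i) ^ 4)" "(\<integral>x. (x $ i) ^ 4 \<partial>gaussian_vec \<sigma>) = 3 * (\<sigma>\<^sup>2)\<^sup>2"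
    using M[of "\<lambda>l. if l = i then 4 else 0"] by (simp_all only: single single' C)
  show "integrable (gaussian_vec \<sigma>) (\<lambda>x. x $ i * x $ j)"
    "(\<integral>x. x $ i * x $ j \<partial>gaussian_vec \<sigma>) = (if i = j then \<sigma>\<^sup>2 else 0)"
  proof -
    have "integrable (gaussian_vec \<sigma>) (\<lambda>x. x $ i * x $ j) \<and>
      (\<integral>x. x $ i * x $ j \<partial>gaussian_vec \<sigma>) = (if i = j then \<sigma>\<^sup>2 else 0)"
    proof (cases "i = j")
      case True
      then show ?thesis
        using M[of "\<lambda>l. if l = i then 2 else 0", unfolded single single' C]
        by (simp add: power2_eq_square)
    next
      case False
      have p: "(\<Prod>l\<in>UNIV. (x $ l) ^ (if l = i \<or> l = j then 1 else 0)) = x $ i * x $ j" for x :: "real^'d"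
      proof -
        have "(\<Prod>l\<in>UNIV. (x $ l) ^ (if l = i \<or> l = j then 1 else 0)) = (\<Prod>l\<in>{i,j}. x $ l)"
          by (intro prod.mono_neutral_cong_right) auto
        then show ?thesis using False by simp
      qed
      have z: "(\<Prod>l\<in>(UNIV::'d set). \<integral>x. normal_density 0 \<sigma> x * x ^ (if l = i \<or> l = j then 1 else 0) \<partial>lborel) = 0"
        by (rule prod_zero) (auto intro!: bexI[of _ i] simp: C1)
      show ?thesis
        using M[of "\<lambda>l. if l = i \<or> l = j then 1 else 0"] False by (simp only: p z) simp
    qed
    then show "integrable (gaussian_vec \<sigma>) (\<lambda>x. x $ i * x $ j)"
    "(\<integral>x. x $ i * x $ j \<partial>gaussian_vec \<sigma>) = (if i = j then \<sigma>\<^sup>2 else 0)" by auto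
  qed
qed

section \<open>Brownian increments\<close>

locale filtered_bm = prob_space M for M :: "'w measure" +
  fixes F :: "real \<Rightarrow> 'w set set" and B :: "real \<Rightarrow> 'w \<Rightarrow> real^'d"
  assumes usual: "usual_filtration M F" and bm: "brownian_motion M F B"
begin

text \<open>\<open>F t\<close> is a bare set system; wrapping it in a measure space gives access to
  the calculus of measurable functions. Only the sets of \<open>Ft t\<close> matter, never its
  measure.\<close>

definition Ft :: "real \<Rightarrow> 'w measure" where "Ft t = sigma (space M) (F t)"

lemmas usual' = usual[unfolded usual_filtration_def]

lemma filtration_algebra: "0 \<le> t \<Longrightarrow> sigma_algebra (space M) (F t)"
  and filtration_sub: "0 \<le> t \<Longrightarrow> F t \<subseteq> sets M"
  using usual'[THEN conjunct2, THEN conjunct1] by blast+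

lemma filtration_mono: "0 \<le> s \<Longrightarrow> s \<le> t \<Longrightarrow> F s \<subseteq> F t"
  using usual'[THEN conjunct2, THEN conjunct2, THEN conjunct1] by blast

lemma filtration_null: "null_sets M \<subseteq> F 0"
  by (rule usual'[THEN conjunct2, THEN conjunct2, THEN conjunct2, THEN conjunct1])

lemma complete: "complete_measure M"
  by (rule usual'[THEN conjunct1])

lemma space_Ft [simp]: "space (Ft t) = space M"
  unfolding Ft_def by (simp add: space_measure_of_conv)

lemma sets_Ft: "0 \<le> t \<Longrightarrow> sets (Ft t) = F t"
  unfolding Ft_def
  by (metis filtration_algebra sigma_algebra.sets_measure_of_eq)

lemma Ft_mono: "0 \<le> s \<Longrightarrow> s \<le> t \<Longrightarrow> sets (Ft s) \<subseteq> sets (Ft t)"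
  using filtration_mono[of s t] by (simp add: sets_Ft)

lemma Ft_sub: "0 \<le> t \<Longrightarrow> sets (Ft t) \<subseteq> sets M"
  using filtration_sub by (simp add: sets_Ft)

lemma measurable_Ft_mono: "0 \<le> s \<Longrightarrow> s \<le> t \<Longrightarrow> f \<in> Ft s \<rightarrow>\<^sub>M N \<Longrightarrow> f \<in> Ft t \<rightarrow>\<^sub>M N"
  using Ft_mono[of s t] by (auto simp: measurable_def)

lemma measurable_Ft_M: "0 \<le> t \<Longrightarrow> f \<in> Ft t \<rightarrow>\<^sub>M N \<Longrightarrow> f \<in> M \<rightarrow>\<^sub>M N"
  using Ft_sub[of t] by (auto simp: measurable_def)

lemma adapted_iff_measurable: "adapted M F Y \<longleftrightarrow> (\<forall>t\<ge>0. Y t \<in> borel_measurable (Ft t))"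
  unfolding adapted_def measurable_def
  by (auto simp: sets_Ft vimage_def Int_def conj_commute)

lemma B_measurable: "0 \<le> t \<Longrightarrow> B t \<in> borel_measurable (Ft t)"
  using bm by (auto simp: brownian_motion_def adapted_iff_measurable)

lemma increment_measurable [measurable]:
  assumes "0 \<le> s" "s \<le> t" shows "(\<lambda>\<omega>. B t \<omega> - B s \<omega>) \<in> borel_measurable M"
  using B_measurable[of s] B_measurable[of t] assms
  by (intro borel_measurable_diff measurable_Ft_M[of t] measurable_Ft_M[of s]) auto

lemma increment_distr:
  "0 \<le> s \<Longrightarrow> s < t \<Longrightarrow> distr M borel (\<lambda>\<omega>. B t \<omega> - B s \<omega>) = gaussian_vec (sqrt (t - s))"
  using bm by (auto simp: brownian_motion_def gaussian_vec_def)

text \<open>Independence is given for events: \<open>F s\<close> against preimages under the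
  increment. These preimages already form a sigma algebra, which contains everything generated by
  \<open>g\<close> of the increment, and what \<open>\<xi>\<close> generates lies in
  \<open>F s\<close>.\<close>

lemma increment_indep:
  fixes \<xi> :: "'w \<Rightarrow> real" and g :: "real^'d \<Rightarrow> real"
  assumes st: "0 \<le> s" "s < t" and \<xi>: "\<xi> \<in> borel_measurable (Ft s)" and g: "g \<in> borel_measurable borel"
  shows "indep_var borel \<xi> borel (\<lambda>\<omega>. g (B t \<omega> - B s \<omega>))"
proof -
  let ?b = "\<lambda>\<omega>. B t \<omega> - B s \<omega>"
  have [measurable]: "?b \<in> borel_measurable M" using st by (intro increment_measurable) auto
  note g[measurable]
  have \<xi>M[measurable]: "\<xi> \<in> borel_measurable M" by (rule measurable_Ft_M[OF st(1) \<xi>])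
  have sub1: "sigma_sets (space M) {\<xi> -` A \<inter> space M | A. A \<in> sets borel} \<subseteq> F s"
  proof (rule sigma_algebra.sigma_sets_subset[OF filtration_algebra[OF st(1)]])
    show "{\<xi> -` A \<inter> space M | A. A \<in> sets borel} \<subseteq> F s"
      using measurable_sets[OF \<xi>] st(1) by (auto simp: sets_Ft)
  qed
  have sub2: "sigma_sets (space M) {(\<lambda>\<omega>. g (?b \<omega>)) -` A \<inter> space M | A. A \<in> sets borel}
    \<subseteq> {?b -` C \<inter> space M | C. C \<in> sets borel}"
  proof (rule sigma_algebra.sigma_sets_subset)
    show "sigma_algebra (space M) {?b -` C \<inter> space M | C. C \<in> sets borel}"
      using sets.sigma_algebra_axioms[of "vimage_algebra (space M) ?b borel"]
      by (simp add: sets_vimage_algebra2)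
    show "{(\<lambda>\<omega>. g (?b \<omega>)) -` A \<inter> space M | A. A \<in> sets borel} \<subseteq> {?b -` C \<inter> space M | C. C \<in> sets borel}"
    proof safe
      fix A :: "real set" assume "A \<in> sets borel"
      then have "g -` A \<in> sets borel" using measurable_sets[OF g, of A] by simp
      then show "\<exists>C. (\<lambda>\<omega>. g (?b \<omega>)) -` A \<inter> space M = ?b -` C \<inter> space M \<and> C \<in> sets borel"
        by (intro exI[of _ "g -` A"]) auto
    qed
  qed
  have ind: "prob (A \<inter> C) = prob A * prob C"
    if AC: "A \<in> F s" "C \<in> {?b -` C \<inter> space M | C. C \<in> sets borel}" for A C
  proof -
    obtain C' where C': "C = {\<omega>\<in>space M. ?b \<omega> \<in> C'}" "C' \<in> sets borel" using AC(2) by auto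
    show ?thesis using bm st AC(1) C' unfolding brownian_motion_def by auto
  qed
  show ?thesis
    unfolding indep_var_eq
  proof (intro conjI indep_setI)
    show "prob (A \<inter> C) = prob A * prob C"
      if "A \<in> sigma_sets (space M) {\<xi> -` A \<inter> space M | A. A \<in> sets borel}"
         "C \<in> sigma_sets (space M) {(\<lambda>\<omega>. g (?b \<omega>)) -` A \<inter> space M | A. A \<in> sets borel}" for A C
      by (rule ind[OF subsetD[OF sub1 that(1)] subsetD[OF sub2 that(2)]])
    show "sigma_sets (space M) {\<xi> -` A \<inter> space M | A. A \<in> sets borel} \<subseteq> events"
      using sub1 filtration_sub[OF st(1)] by auto
    show "sigma_sets (space M) {(\<lambda>\<omega>. g (?b \<omega>)) -` A \<inter> space M | A. A \<in> sets borel} \<subseteq> events"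
      using sub2 by (rule order_trans) auto
  qed auto
qed

text \<open>This does the work of conditioning on \<open>F s\<close>: a bounded coefficient known at
  time \<open>s\<close> factors out of every moment of the increment.\<close>

lemma increment_integral:
  fixes g :: "real^'d \<Rightarrow> real"
  assumes st: "0 \<le> s" "s < t" and \<xi>: "\<xi> \<in> borel_measurable (Ft s)" "\<And>\<omega>. \<omega> \<in> space M \<Longrightarrow> \<bar>\<xi> \<omega>\<bar> \<le> c"
    and g: "integrable (gaussian_vec (sqrt (t - s))) g"
  shows "integrable M (\<lambda>\<omega>. \<xi> \<omega> * g (B t \<omega> - B s \<omega>))"
    and "(\<integral>\<omega>. \<xi> \<omega> * g (B t \<omega> - B s \<omega>) \<partial>M) = expectation \<xi> * integral\<^sup>L (gaussian_vec (sqrt (t - s))) g"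
proof -
  have gm: "g \<in> borel_measurable borel" using borel_measurable_integrable[OF g]
    by (simp add: gaussian_vec_def)
  have bm: "(\<lambda>\<omega>. B t \<omega> - B s \<omega>) \<in> borel_measurable M" using st by (intro increment_measurable) auto
  have i1: "integrable M \<xi>"
    by (rule integrable_const_bound[of _ c]) (auto intro: measurable_Ft_M[OF st(1)] \<xi> AE_I2)
  have i2: "integrable M (\<lambda>\<omega>. g (B t \<omega> - B s \<omega>))"
    using g unfolding increment_distr[OF st, symmetric] by (subst (asm) integrable_distr_eq[OF bm gm])
  have e2: "expectation (\<lambda>\<omega>. g (B t \<omega> - B s \<omega>)) = integral\<^sup>L (gaussian_vec (sqrt (t - s))) g"
    unfolding increment_distr[OF st, symmetric] by (subst integral_distr[OF bm gm]) simp
  note ind = increment_indep[OF st \<xi>(1) gm]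
  show "integrable M (\<lambda>\<omega>. \<xi> \<omega> * g (B t \<omega> - B s \<omega>))"
    by (rule indep_var_integrable[OF ind i1 i2])
  show "(\<integral>\<omega>. \<xi> \<omega> * g (B t \<omega> - B s \<omega>) \<partial>M) = expectation \<xi> * integral\<^sup>L (gaussian_vec (sqrt (t - s))) g"
    using indep_var_lebesgue_integral[OF ind i1 i2] by (simp add: e2)
qed

lemma increment_linear:
  assumes st: "0 \<le> s" "s < t" and \<xi>: "\<xi> \<in> borel_measurable (Ft s)" "\<And>\<omega>. \<omega> \<in> space M \<Longrightarrow> norm (\<xi> \<omega>) \<le> c"
  shows "integrable M (\<lambda>\<omega>. \<xi> \<omega> \<bullet> (B t \<omega> - B s \<omega>))" (is ?A)
    and "expectation (\<lambda>\<omega>. \<xi> \<omega> \<bullet> (B t \<omega> - B s \<omega>)) = 0" (is ?B)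
proof -
  note G = gaussian_vec_moments[where \<sigma>="sqrt (t - s)"]
  have m: "(\<lambda>\<omega>. \<xi> \<omega> $ j) \<in> borel_measurable (Ft s)" for j
    by (rule measurable_compose[OF \<xi>(1)]) simp
  have bd: "\<bar>\<xi> \<omega> $ j\<bar> \<le> c" if "\<omega> \<in> space M" for j \<omega>
    using \<xi>(2)[OF that] component_le_norm_cart[of "\<xi> \<omega>" j] by linarith
  have g: "integrable (gaussian_vec (sqrt (t - s))) (\<lambda>x::real^'d. x $ j)" for j
    using G(1) st by simp
  note I = increment_integral[OF st m bd g]
  have eq: "(\<lambda>\<omega>. \<xi> \<omega> \<bullet> (B t \<omega> - B s \<omega>)) = (\<lambda>\<omega>. \<Sum>j\<in>UNIV. \<xi> \<omega> $ j * (B t \<omega> - B s \<omega>) $ j)"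
    by (simp add: inner_vec_def)
  show ?A unfolding eq by (rule Bochner_Integration.integrable_sum) (rule I(1))
  show ?B unfolding eq
    by (subst Bochner_Integration.integral_sum) (use st in \<open>auto simp: I G(2) simp del: vector_minus_component\<close>)
qed

text \<open>In coordinates the square is a double sum whose coefficients are bounded and known at
  time \<open>s\<close>; the covariance (t - s) times the identity leaves only the diagonal.\<close>

lemma increment_quadratic:
  assumes st: "0 \<le> s" "s < t" and \<xi>: "\<xi> \<in> borel_measurable (Ft s)" "\<And>\<omega>. \<omega> \<in> space M \<Longrightarrow> norm (\<xi> \<omega>) \<le> c"
    and z: "z \<in> borel_measurable (Ft s)" "\<And>\<omega>. \<omega> \<in> space M \<Longrightarrow> \<bar>z \<omega>\<bar> \<le> c'"
  shows "integrable M (\<lambda>\<omega>. z \<omega> * (\<xi> \<omega> \<bullet> (B t \<omega> - B s \<omega>))\<^sup>2)" (is ?A)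
    and "expectation (\<lambda>\<omega>. z \<omega> * (\<xi> \<omega> \<bullet> (B t \<omega> - B s \<omega>))\<^sup>2) = (t - s) * expectation (\<lambda>\<omega>. z \<omega> * (norm (\<xi> \<omega>))\<^sup>2)" (is ?B)
proof -
  note G = gaussian_vec_moments[where \<sigma>="sqrt (t - s)"]
  have m: "(\<lambda>\<omega>. z \<omega> * \<xi> \<omega> $ i * \<xi> \<omega> $ j) \<in> borel_measurable (Ft s)" for i j
    by (intro borel_measurable_times z(1) measurable_compose[OF \<xi>(1)]) simp_all
  have bd: "\<bar>z \<omega> * \<xi> \<omega> $ i * \<xi> \<omega> $ j\<bar> \<le> c' * c * c" if "\<omega> \<in> space M" for i j \<omega>
  proof -
    have a: "\<bar>\<xi> \<omega> $ j\<bar> \<le> c" for j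
      using \<xi>(2)[OF that] component_le_norm_cart[of "\<xi> \<omega>" j] by linarith
    have "0 \<le> c'" "0 \<le> c" using a[of i] z(2)[OF that] by linarith+
    then show ?thesis unfolding abs_mult using a z(2)[OF that] by (intro mult_mono) auto
  qed
  have g: "integrable (gaussian_vec (sqrt (t - s))) (\<lambda>x::real^'d. x $ i * x $ j)" for i j
    using G(3) st by simp
  note I = increment_integral[OF st m bd g]
  have eq: "(\<lambda>\<omega>. z \<omega> * (\<xi> \<omega> \<bullet> (B t \<omega> - B s \<omega>))\<^sup>2) =
     (\<lambda>\<omega>. \<Sum>i\<in>UNIV. \<Sum>j\<in>UNIV. (z \<omega> * \<xi> \<omega> $ i * \<xi> \<omega> $ j) * ((B t \<omega> - B s \<omega>) $ i * (B t \<omega> - B s \<omega>) $ j))"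
    by (simp add: inner_vec_def power2_eq_square sum_product sum_distrib_left mult_ac)
  show ?A unfolding eq by (intro Bochner_Integration.integrable_sum I(1))
  have im: "integrable M (\<lambda>\<omega>. z \<omega> * \<xi> \<omega> $ i * \<xi> \<omega> $ j)" for i j
    by (rule integrable_const_bound[of _ "c' * c * c"]) (auto intro: measurable_Ft_M[OF st(1) m] bd AE_I2)
  have "expectation (\<lambda>\<omega>. z \<omega> * (\<xi> \<omega> \<bullet> (B t \<omega> - B s \<omega>))\<^sup>2)
      = (\<Sum>i\<in>UNIV. \<Sum>j\<in>UNIV. expectation (\<lambda>\<omega>. z \<omega> * \<xi> \<omega> $ i * \<xi> \<omega> $ j) *
          integral\<^sup>L (gaussian_vec (sqrt (t - s))) (\<lambda>x::real^'d. x $ i * x $ j))"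
    unfolding eq by (simp only: Bochner_Integration.integral_sum Bochner_Integration.integrable_sum I)
  also have "\<dots> = (\<Sum>i\<in>UNIV. \<Sum>j\<in>UNIV. expectation (\<lambda>\<omega>. z \<omega> * \<xi> \<omega> $ i * \<xi> \<omega> $ j) * (if i = j then t - s else 0))"
    using st by (simp add: G(4) cong: if_cong)
  also have "\<dots> = (\<Sum>i\<in>UNIV. expectation (\<lambda>\<omega>. z \<omega> * \<xi> \<omega> $ i * \<xi> \<omega> $ i) * (t - s))"
    by (simp add: if_distrib[of "\<lambda>x. _ * x"] cong: if_cong)
  also have "\<dots> = (t - s) * expectation (\<lambda>\<omega>. \<Sum>i\<in>UNIV. z \<omega> * \<xi> \<omega> $ i * \<xi> \<omega> $ i)"
    unfolding Bochner_Integration.integral_sum[OF im] sum_distrib_left by (simp add: mult_ac)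
  also have "(\<lambda>\<omega>. \<Sum>i\<in>UNIV. z \<omega> * \<xi> \<omega> $ i * \<xi> \<omega> $ i) = (\<lambda>\<omega>. z \<omega> * (norm (\<xi> \<omega>))\<^sup>2)"
    by (simp add: power2_norm_eq_inner inner_vec_def sum_distrib_left mult_ac)
  finally show ?B .
qed

lemma increment_square:
  assumes st: "0 \<le> s" "s < t"
  shows "integrable M (\<lambda>\<omega>. (norm (B t \<omega> - B s \<omega>))\<^sup>2)" (is ?A)
    and "expectation (\<lambda>\<omega>. (norm (B t \<omega> - B s \<omega>))\<^sup>2) = real CARD('d) * (t - s)" (is ?B)
proof -
  note I = increment_integral[OF st, of "\<lambda>_. 1" 1 "\<lambda>x. x $ j * x $ j" for j]
  note G = gaussian_vec_moments[where \<sigma>="sqrt (t - s)"]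
  have eq: "(\<lambda>\<omega>. (norm (B t \<omega> - B s \<omega>))\<^sup>2) = (\<lambda>\<omega>. \<Sum>j\<in>UNIV. (B t \<omega> - B s \<omega>) $ j * (B t \<omega> - B s \<omega>) $ j)"
    by (simp add: power2_norm_eq_inner inner_vec_def)
  have i: "integrable M (\<lambda>\<omega>. (B t \<omega> - B s \<omega>) $ j * (B t \<omega> - B s \<omega>) $ j)" for j
    using I(1)[of j] G(3)[of j j] st by (simp del: vector_minus_component)
  show ?A unfolding eq by (intro Bochner_Integration.integrable_sum i)
  have e: "expectation (\<lambda>\<omega>. (B t \<omega> - B s \<omega>) $ j * (B t \<omega> - B s \<omega>) $ j) = t - s" for j
    using I(2)[of j] G(3)[of j j] G(4)[of j j] st prob_space by (simp del: vector_minus_component)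
  show ?B unfolding eq by (subst Bochner_Integration.integral_sum[OF i]) (simp only: e, simp)
qed

text \<open>Only the order (t - s)^2 matters, so the exact value is not computed: Cauchy-Schwarz
  against the constant 1 bounds |x|^4 by the fourth powers of the coordinates.\<close>

lemma increment_fourth:
  assumes st: "0 \<le> s" "s < t"
  shows "integrable M (\<lambda>\<omega>. (norm (B t \<omega> - B s \<omega>)) ^ 4)" (is ?A)
    and "expectation (\<lambda>\<omega>. (norm (B t \<omega> - B s \<omega>)) ^ 4) \<le> 3 * real CARD('d) ^ 2 * (t - s)\<^sup>2" (is ?B)
proof -
  note I = increment_integral[OF st, of "\<lambda>_. 1" 1 "\<lambda>x. (x $ j) ^ 4" for j]
  note G = gaussian_vec_moments[where \<sigma>="sqrt (t - s)"]
  have i: "integrable M (\<lambda>\<omega>. (B t \<omega> - B s \<omega>) $ j ^ 4)" for j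
    using I(1)[of j] G(5)[of j] st by (simp del: vector_minus_component)
  have e: "expectation (\<lambda>\<omega>. (B t \<omega> - B s \<omega>) $ j ^ 4) = 3 * (t - s)\<^sup>2" for j
    using I(2)[of j] G(5)[of j] G(6)[of j] st prob_space by (simp del: vector_minus_component)
  have bd: "norm x ^ 4 \<le> CARD('d) * (\<Sum>j\<in>UNIV. (x $ j) ^ 4)" for x :: "real^'d"
  proof -
    have "norm x ^ 4 = ((norm x)\<^sup>2)\<^sup>2" by simp
    also have "(norm x)\<^sup>2 = (\<Sum>j\<in>UNIV. (x $ j)\<^sup>2)"
      unfolding power2_norm_eq_inner inner_vec_def by (simp add: power2_eq_square)
    also have "(\<Sum>j\<in>UNIV. (x $ j)\<^sup>2)\<^sup>2 \<le> (\<Sum>j\<in>(UNIV::'d set). 1\<^sup>2) * (\<Sum>j\<in>UNIV. ((x $ j)\<^sup>2)\<^sup>2)"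
      using Cauchy_Schwarz_ineq_sum[of "\<lambda>_. 1" "\<lambda>j. (x $ j)\<^sup>2" "UNIV::'d set"] by simp
    finally show ?thesis by simp
  qed
  have i2: "integrable M (\<lambda>\<omega>. CARD('d) * (\<Sum>j\<in>UNIV. (B t \<omega> - B s \<omega>) $ j ^ 4))"
    by (intro Bochner_Integration.integrable_mult_right Bochner_Integration.integrable_sum i)
  have mb: "(\<lambda>\<omega>. B t \<omega> - B s \<omega>) \<in> borel_measurable M" using st by (intro increment_measurable) auto
  show A: ?A
    by (rule Bochner_Integration.integrable_bound[OF i2])
      (use bd mb in \<open>auto intro!: AE_I2 order_trans[OF bd]\<close>)
  have "expectation (\<lambda>\<omega>. (norm (B t \<omega> - B s \<omega>)) ^ 4)
      \<le> expectation (\<lambda>\<omega>. CARD('d) * (\<Sum>j\<in>UNIV. (B t \<omega> - B s \<omega>) $ j ^ 4))"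
    by (rule integral_mono[OF A i2]) (rule bd)
  also have "\<dots> = CARD('d) * (\<Sum>j\<in>(UNIV::'d set). 3 * (t - s)\<^sup>2)"
    by (subst integral_mult_right_zero, subst Bochner_Integration.integral_sum[OF i]) (simp only: e)
  also have "\<dots> = 3 * real CARD('d) ^ 2 * (t - s)\<^sup>2" by (simp add: power2_eq_square)
  finally show ?B .
qed

end

section \<open>One step of a discretised Ito formula\<close>

definition orthonormal :: "'a::real_inner set \<Rightarrow> bool" where
  "orthonormal S \<longleftrightarrow> finite S \<and> pairwise orthogonal S \<and> (\<forall>e\<in>S. norm e = 1)"

definition proj :: "'a::real_inner set \<Rightarrow> 'a \<Rightarrow> 'a" where
  "proj S x = (\<Sum>e\<in>S. (x \<bullet> e) *\<^sub>R e)"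

lemma proj_add: "proj S (x + y) = proj S x + proj S y"
  by (simp add: proj_def inner_add_left scaleR_add_left sum.distrib)

lemma proj_diff: "proj S (x - y) = proj S x - proj S y"
  by (simp add: proj_def inner_diff_left scaleR_diff_left sum_subtractf)

lemma inner_proj: "proj S x \<bullet> y = (\<Sum>e\<in>S. (x \<bullet> e) * (y \<bullet> e))"
  by (simp add: proj_def inner_sum_left inner_commute[of y])

lemma inner_proj_commute: "proj S x \<bullet> y = x \<bullet> proj S y"
  by (simp add: inner_proj inner_commute[of x "proj S y"] mult.commute)

lemma inner_proj_basis:
  assumes "orthonormal S" "e \<in> S"
  shows "proj S x \<bullet> e = x \<bullet> e"
proof -
  have "e \<bullet> e' = (if e' = e then 1 else 0)" if "e' \<in> S" for e'
    using assms that unfolding orthonormal_def pairwise_def orthogonal_def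
    by (auto simp: norm_eq_1)
  then have "proj S x \<bullet> e = (\<Sum>e'\<in>S. (x \<bullet> e') * (if e' = e then 1 else 0))"
    unfolding inner_proj by (intro sum.cong) auto
  also have "\<dots> = x \<bullet> e"
    using assms by (simp add: orthonormal_def if_distrib[of "\<lambda>u. _ * u"] cong: if_cong)
  finally show ?thesis .
qed

lemma proj_idem: "orthonormal S \<Longrightarrow> proj S (proj S x) = proj S x"
  unfolding proj_def[of S "proj S x"] by (simp add: inner_proj_basis proj_def[symmetric])

lemma inner_proj_proj: "orthonormal S \<Longrightarrow> proj S x \<bullet> proj S y = proj S x \<bullet> y"
  by (metis inner_proj_commute proj_idem)

lemma norm_proj_sq: "orthonormal S \<Longrightarrow> (norm (proj S x))\<^sup>2 = (\<Sum>e\<in>S. (x \<bullet> e)\<^sup>2)"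
  by (subst power2_norm_eq_inner, subst inner_proj_proj, assumption)
    (simp add: inner_proj power2_eq_square)

lemma norm_proj_le:
  assumes "orthonormal S" shows "norm (proj S x) \<le> norm x"
proof (rule power2_le_imp_le)
  have "(norm (proj S x))\<^sup>2 = proj S x \<bullet> x"
    using assms by (simp add: power2_norm_eq_inner inner_proj_proj)
  also have "\<dots> \<le> norm (proj S x) * norm x" by (rule norm_cauchy_schwarz)
  finally have "norm (proj S x) * norm (proj S x) \<le> norm (proj S x) * norm x"
    by (simp add: power2_eq_square)
  then have "norm (proj S x) \<le> norm x \<or> norm (proj S x) = 0"
    using mult_le_cancel_left_pos[of "norm (proj S x)"] by (cases "norm (proj S x) = 0") auto
  then show "(norm (proj S x))\<^sup>2 \<le> (norm x)\<^sup>2" by (auto intro: power_mono)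
qed simp

lemma proj_span:
  assumes "x \<in> span S" "orthonormal S" shows "proj S x = x"
  using assms
proof (induction rule: span_induct_alt)
  case base then show ?case by (simp add: proj_def)
next
  case (step c e y)
  have "proj S e = e"
  proof -
    have "(\<Sum>e'\<in>S. (e \<bullet> e') *\<^sub>R e') = (\<Sum>e'\<in>S. if e' = e then e else 0)"
      using step unfolding orthonormal_def pairwise_def orthogonal_def
      by (intro sum.cong) (auto simp: norm_eq_1)
    then show ?thesis using step by (simp add: proj_def orthonormal_def)
  qed
  moreover have "proj S (c *\<^sub>R e) = c *\<^sub>R proj S e" by (simp add: proj_def scaleR_sum_right)
  ultimately show ?case using step by (simp add: proj_add)
qed

text \<open>The second derivative is frozen at the base point and its oscillation bounds the
  remainder, so \<open>w''\<close> need only be continuous, which is all that a C^1 potential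
  provides.\<close>

lemma taylor_le:
  fixes w w' w'' :: "real \<Rightarrow> real"
  assumes w: "\<And>x. x \<in> closed_segment r s \<Longrightarrow> (w has_real_derivative w' x) (at x)"
    and w': "\<And>x. x \<in> closed_segment r s \<Longrightarrow> (w' has_real_derivative w'' x) (at x)"
    and osc: "\<And>x. x \<in> closed_segment r s \<Longrightarrow> \<bar>w'' x - w'' r\<bar> \<le> eps"
  shows "w s - w r \<le> w' r * (s - r) + w'' r / 2 * (s - r)\<^sup>2 + eps / 2 * (s - r)\<^sup>2"
proof (cases "s = r")
  case False
  \<comment> \<open>The tower of derivatives in the indexed form that Taylor's theorem
    expects.\<close>
  define d where "d = (\<lambda>m::nat. if m = 0 then w else if m = 1 then w' else w'')"
  have seg: "x \<in> closed_segment r s \<longleftrightarrow> min r s \<le> x \<and> x \<le> max r s" for x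
    by (auto simp: closed_segment_eq_real_ivl min_def max_def)
  have "\<exists>t. (if s < r then s < t \<and> t < r else r < t \<and> t < s) \<and>
    w s = (\<Sum>m<2. (d m r / fact m) * (s - r)^m) + (d 2 t / fact 2) * (s - r)^2"
  proof (rule Taylor[of 2 d w "min r s" "max r s" r s])
    show "\<forall>m t. m < 2 \<and> min r s \<le> t \<and> t \<le> max r s \<longrightarrow> (d m has_real_derivative d (Suc m) t) (at t)"
      using w w' seg by (auto simp: d_def less_2_cases_iff)
  qed (use False in \<open>auto simp: d_def\<close>)
  then obtain t where t: "if s < r then s < t \<and> t < r else r < t \<and> t < s"
    "w s = (\<Sum>m<2. (d m r / fact m) * (s - r)^m) + (d 2 t / fact 2) * (s - r)^2" by blast
  have "t \<in> closed_segment r s" using t(1) by (auto simp: seg split: if_splits)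
  then have "w'' t / 2 * (s - r)\<^sup>2 \<le> (w'' r + eps) / 2 * (s - r)\<^sup>2"
    using osc[of t] by (intro mult_right_mono) auto
  moreover have "w s = w r + w' r * (s - r) + w'' t / 2 * (s - r)\<^sup>2"
    using t(2) by (simp add: d_def numeral_2_eq_2)
  ultimately show ?thesis by (simp add: field_simps)
qed simp

text \<open>With K = 2 c1 + 1, the three summands come from the three error terms of the next lemma:
  the squared projection, the square of s - r, and the Taylor remainder.\<close>

definition step_const :: "real \<Rightarrow> real \<Rightarrow> real" where
  "step_const c1 c2 = c2 + c2 * (2 * c1 + 1) * (c1 + 1) + (2 * c1 + 1)\<^sup>2"

text \<open>Here \<open>b\<close> is the Brownian part of a step and \<open>\<alpha>\<close> the
  part due to drift and reflection. Apart from the linear term Y \<bullet> \<open>\<alpha>\<close>,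
  whose sign will be exploited, \<open>\<alpha>\<close> occurs only with an extra factor
  \<open>\<eta>\<close> or \<open>norm b\<close>; this is what lets a clock of finite variation
  control it.\<close>

lemma one_step_le:
  fixes b \<alpha> Y :: "'a::real_inner"
  assumes S: "orthonormal S" and Y: "Y = proj S y" and nY: "norm Y \<le> c1"
    and d: "norm (b + \<alpha>) \<le> \<eta>" "\<eta> \<le> 1"
    and c2: "\<bar>w' r\<bar> \<le> c2" "\<bar>w'' r\<bar> \<le> c2" and r: "r = (norm Y)\<^sup>2"
    and s: "s = (norm (proj S (y + (b + \<alpha>))))\<^sup>2"
    and w: "\<And>x. x \<in> closed_segment r s \<Longrightarrow> (w has_real_derivative w' x) (at x)"
    and w': "\<And>x. x \<in> closed_segment r s \<Longrightarrow> (w' has_real_derivative w'' x) (at x)"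
    and osc: "\<And>x. x \<in> closed_segment r s \<Longrightarrow> \<bar>w'' x - w'' r\<bar> \<le> eps"
    and eps: "0 \<le> eps" "eps \<le> 1"
  shows "w s - w r \<le> 2 * w' r * (Y \<bullet> b) + 2 * w' r * (Y \<bullet> \<alpha>) + w' r * (norm (proj S b))\<^sup>2
    + 2 * w'' r * (Y \<bullet> b)\<^sup>2
    + step_const c1 c2 * (norm \<alpha> * (\<eta> + norm b) + (\<eta> + eps) * (norm b)\<^sup>2)"
proof -
  define D where "D = b + \<alpha>"
  define K where "K = 2 * c1 + 1"
  define A where "A = norm \<alpha> * (\<eta> + norm b)"
  have pos: "0 \<le> c1" "0 \<le> c2" "0 \<le> \<eta>" "1 \<le> K"
    using nY c2(1) d(1) norm_ge_zero[of Y] norm_ge_zero[of "b + \<alpha>"] unfolding K_def by linarith+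
  have A0: "0 \<le> A" unfolding A_def using pos by simp
  have nD: "norm D \<le> \<eta>" "norm D \<le> 1" "norm D \<le> norm \<alpha> + norm b"
    using d norm_triangle_ineq[of b \<alpha>] unfolding D_def by linarith+
  have PD: "norm (proj S D) \<le> norm D" "norm (proj S b) \<le> norm b" "norm (proj S \<alpha>) \<le> norm \<alpha>"
    by (simp_all add: norm_proj_le S)
  \<comment> \<open>Exact, without remainder, because the argument of \<open>w\<close> is a squared
    norm.\<close>
  have sr: "s - r = 2 * (Y \<bullet> D) + (norm (proj S D))\<^sup>2"
    unfolding s r Y D_def[symmetric] proj_add
    by (simp add: power2_norm_eq_inner inner_add_left inner_add_right inner_commute inner_proj_proj[OF S]
          inner_proj_commute)
      (metis S inner_proj_commute proj_idem inner_commute)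
  have D2: "(norm D)\<^sup>2 \<le> A + (norm b)\<^sup>2"
  proof -
    have "(norm D)\<^sup>2 \<le> norm D * (norm \<alpha> + norm b)"
      unfolding power2_eq_square using nD by (intro mult_left_mono) auto
    also have "\<dots> \<le> \<eta> * norm \<alpha> + (norm \<alpha> + norm b) * norm b"
      using mult_right_mono[OF nD(1), of "norm \<alpha>"] mult_right_mono[OF nD(3), of "norm b"]
      by (simp add: algebra_simps)
    finally show ?thesis by (simp add: A_def algebra_simps power2_eq_square)
  qed
  \<comment> \<open>Cubic terms: bounding one factor \<open>norm D\<close> by \<open>\<eta>\<close>
    leaves a small multiple of |b|^2, and everything containing \<open>\<alpha>\<close> goes into
    \<open>A\<close>.\<close>
  have D3: "(norm D)\<^sup>2 * (norm D + norm b) \<le> 2 * \<eta> * (norm b)\<^sup>2 + 2 * A"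
  proof -
    have 1: "(norm D)\<^sup>2 \<le> \<eta> * (norm \<alpha> + norm b)"
      unfolding power2_eq_square using nD pos by (intro mult_mono) auto
    have "(norm D)\<^sup>2 * norm D \<le> (\<eta> * (norm \<alpha> + norm b)) * norm D"
      by (rule mult_right_mono[OF 1]) simp
    also have "\<dots> \<le> \<eta> * norm \<alpha> * 1 + \<eta> * norm b * (norm \<alpha> + norm b)"
    proof -
      have "\<eta> * norm \<alpha> * norm D \<le> \<eta> * norm \<alpha> * 1" using nD pos by (intro mult_left_mono) auto
      moreover have "\<eta> * norm b * norm D \<le> \<eta> * norm b * (norm \<alpha> + norm b)"
        using nD pos by (intro mult_left_mono) auto
      ultimately show ?thesis by (simp add: algebra_simps)
    qed
    finally have 2: "(norm D)\<^sup>2 * norm D \<le> \<eta> * norm \<alpha> * 1 + \<eta> * norm b * (norm \<alpha> + norm b)" .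
    have 3: "(norm D)\<^sup>2 * norm b \<le> \<eta> * (norm \<alpha> + norm b) * norm b"
      by (rule mult_right_mono[OF 1]) simp
    have 4: "\<eta> * (norm \<alpha> * norm b) \<le> norm \<alpha> * norm b"
      using mult_right_mono[OF d(2), of "norm \<alpha> * norm b"] by simp
    have 5: "0 \<le> \<eta> * norm \<alpha>" using pos by simp
    show ?thesis using 2 3 4 5 by (simp add: A_def algebra_simps power2_eq_square)
  qed
  have Yi: "\<bar>Y \<bullet> x\<bar> \<le> c1 * norm x" for x
    by (rule order_trans[OF Cauchy_Schwarz_ineq2]) (use nY in \<open>auto intro: mult_right_mono\<close>)
  have PD2: "(norm (proj S D))\<^sup>2 \<le> (norm D)\<^sup>2" using PD(1) by (intro power_mono) auto
  have srK: "\<bar>s - r\<bar> \<le> K * norm D"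
  proof -
    have "(norm D)\<^sup>2 \<le> norm D" using nD by (simp add: power2_eq_square mult_left_le)
    then show ?thesis using Yi[of D] PD2 zero_le_power2[of "norm (proj S D)"]
      unfolding sr K_def distrib_right by linarith
  qed
  \<comment> \<open>The full step is replaced by \<open>b\<close>, here in the squared projection
    and below in the square of s - r. Both differences of squares are factorised; the small factor
    is controlled by \<open>\<alpha>\<close>, in the second case up to a quadratic
    remainder.\<close>
  have t1: "w' r * ((norm (proj S D))\<^sup>2 - (norm (proj S b))\<^sup>2) \<le> c2 * A"
  proof -
    have "\<bar>(norm (proj S D))\<^sup>2 - (norm (proj S b))\<^sup>2\<bar>
        = \<bar>norm (proj S D) - norm (proj S b)\<bar> * (norm (proj S D) + norm (proj S b))"
    proof -
      have "(norm (proj S D))\<^sup>2 - (norm (proj S b))\<^sup>2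
          = (norm (proj S D) - norm (proj S b)) * (norm (proj S D) + norm (proj S b))"
        by (simp only: power2_eq_square square_diff_square_factored mult.commute)
      then show ?thesis by (simp only: abs_mult abs_of_nonneg add_nonneg_nonneg norm_ge_zero)
    qed
    also have "\<dots> \<le> norm \<alpha> * (\<eta> + norm b)"
    proof (rule mult_mono)
      have "\<bar>norm (proj S D) - norm (proj S b)\<bar> \<le> norm (proj S D - proj S b)"
        by (rule norm_triangle_ineq3)
      also have "proj S D - proj S b = proj S \<alpha>" by (simp add: D_def proj_add)
      finally show "\<bar>norm (proj S D) - norm (proj S b)\<bar> \<le> norm \<alpha>" using PD(3) by linarith
    qed (use PD nD in auto)
    finally have "\<bar>w' r * ((norm (proj S D))\<^sup>2 - (norm (proj S b))\<^sup>2)\<bar> \<le> c2 * A"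
      unfolding abs_mult A_def using c2 pos by (intro mult_mono) auto
    then show ?thesis by linarith
  qed
  have t2: "w'' r / 2 * ((s - r)\<^sup>2 - 4 * (Y \<bullet> b)\<^sup>2) \<le> c2 * K * (c1 + 1) * A + c2 * K * \<eta> * (norm b)\<^sup>2"
  proof -
    have f: "(s - r)\<^sup>2 - 4 * (Y \<bullet> b)\<^sup>2 = ((s - r) - 2 * (Y \<bullet> b)) * ((s - r) + 2 * (Y \<bullet> b))"
      by (simp add: power2_eq_square algebra_simps)
    have aux: "\<bar>2 * (z + x) + p - 2 * z\<bar> \<le> 2 * u + q" if "\<bar>x\<bar> \<le> u" "p \<le> q" "0 \<le> p" for x u p q z :: real
      using that by (simp add: abs_le_iff)
    have "\<bar>(s - r) - 2 * (Y \<bullet> b)\<bar> \<le> 2 * c1 * norm \<alpha> + (norm D)\<^sup>2"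
      using aux[OF Yi[of \<alpha>] PD2 zero_le_power2, of "Y \<bullet> b"]
      unfolding sr D_def inner_add_right mult.assoc .
    moreover have "\<bar>(s - r) + 2 * (Y \<bullet> b)\<bar> \<le> K * (norm D + norm b)"
      using Yi[of b] srK norm_ge_zero[of b] unfolding K_def distrib_right distrib_left by linarith
    ultimately have "\<bar>(s - r)\<^sup>2 - 4 * (Y \<bullet> b)\<^sup>2\<bar> \<le> (2 * c1 * norm \<alpha> + (norm D)\<^sup>2) * (K * (norm D + norm b))"
      unfolding f abs_mult using pos by (intro mult_mono) auto
    also have "\<dots> = K * (2 * c1 * (norm \<alpha> * (norm D + norm b)) + (norm D)\<^sup>2 * (norm D + norm b))"
      by (simp add: algebra_simps)
    also have "\<dots> \<le> K * (2 * c1 * A + (2 * \<eta> * (norm b)\<^sup>2 + 2 * A))"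
    proof (intro mult_left_mono add_mono D3)
      show "norm \<alpha> * (norm D + norm b) \<le> A" unfolding A_def using nD by (intro mult_left_mono) auto
    qed (use pos in auto)
    finally have le: "\<bar>(s - r)\<^sup>2 - 4 * (Y \<bullet> b)\<^sup>2\<bar> \<le> K * (2 * c1 * A + (2 * \<eta> * (norm b)\<^sup>2 + 2 * A))" .
    have "w'' r * ((s - r)\<^sup>2 - 4 * (Y \<bullet> b)\<^sup>2) \<le> \<bar>w'' r\<bar> * \<bar>(s - r)\<^sup>2 - 4 * (Y \<bullet> b)\<^sup>2\<bar>"
      by (metis abs_ge_self abs_mult)
    also have "\<dots> \<le> c2 * (K * (2 * c1 * A + (2 * \<eta> * (norm b)\<^sup>2 + 2 * A)))"
      using le c2 pos by (intro mult_mono) auto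
    finally show ?thesis by (simp add: algebra_simps)
  qed
  \<comment> \<open>The crude bound |s - r| \<le> K |D| suffices since \<open>eps\<close> stands in
    front; on the part \<open>A\<close> it is merely bounded by 1, because \<open>A\<close> is small
    by itself.\<close>
  have t3: "eps / 2 * (s - r)\<^sup>2 \<le> K\<^sup>2 * A + K\<^sup>2 * eps * (norm b)\<^sup>2"
  proof -
    have "(s - r)\<^sup>2 \<le> K\<^sup>2 * (norm D)\<^sup>2"
      using srK by (metis abs_ge_zero power2_abs power_mono power_mult_distrib)
    also have "\<dots> \<le> K\<^sup>2 * (A + (norm b)\<^sup>2)" by (intro mult_left_mono D2) auto
    finally have "eps * (s - r)\<^sup>2 \<le> eps * (K\<^sup>2 * (A + (norm b)\<^sup>2))" using eps by (intro mult_left_mono) auto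
    moreover have "eps * (K\<^sup>2 * A) \<le> 1 * (K\<^sup>2 * A)" using eps A0 by (intro mult_right_mono) auto
    moreover have "0 \<le> K\<^sup>2 * A" "0 \<le> eps * (K\<^sup>2 * (norm b)\<^sup>2)" using A0 eps by auto
    ultimately show ?thesis by (simp add: algebra_simps)
  qed
  have "w s - w r \<le> w' r * (s - r) + w'' r / 2 * (s - r)\<^sup>2 + eps / 2 * (s - r)\<^sup>2"
    by (rule taylor_le[OF w w' osc])
  also have "w' r * (s - r) = 2 * w' r * (Y \<bullet> b) + 2 * w' r * (Y \<bullet> \<alpha>) + w' r * (norm (proj S b))\<^sup>2
      + w' r * ((norm (proj S D))\<^sup>2 - (norm (proj S b))\<^sup>2)"
    unfolding sr by (simp add: D_def inner_add_right algebra_simps)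
  also have "w'' r / 2 * (s - r)\<^sup>2 = 2 * w'' r * (Y \<bullet> b)\<^sup>2 + w'' r / 2 * ((s - r)\<^sup>2 - 4 * (Y \<bullet> b)\<^sup>2)"
    by (simp add: algebra_simps)
  finally have "w s - w r \<le> 2 * w' r * (Y \<bullet> b) + 2 * w' r * (Y \<bullet> \<alpha>) + w' r * (norm (proj S b))\<^sup>2
    + 2 * w'' r * (Y \<bullet> b)\<^sup>2 + c2 * A + (c2 * K * (c1 + 1) * A + c2 * K * \<eta> * (norm b)\<^sup>2) +
      (K\<^sup>2 * A + K\<^sup>2 * eps * (norm b)\<^sup>2)"
    using t1 t2 t3 by linarith
  moreover have "c2 * K * \<eta> * (norm b)\<^sup>2 \<le> step_const c1 c2 * (\<eta> * (norm b)\<^sup>2)"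
  proof -
    have "c2 * K \<le> c2 * K * (c1 + 1)" using pos by (simp add: mult_left_le algebra_simps)
    then have "c2 * K \<le> step_const c1 c2" unfolding step_const_def K_def[symmetric] using pos
      by (smt (verit) zero_le_power2)
    then show ?thesis using pos by (metis mult.assoc mult_right_mono mult_nonneg_nonneg zero_le_power2)
  qed
  moreover have "K\<^sup>2 * eps * (norm b)\<^sup>2 \<le> step_const c1 c2 * (eps * (norm b)\<^sup>2)"
  proof -
    have "0 \<le> c2 * K * (c1 + 1)" using pos by simp
    then have "K\<^sup>2 \<le> step_const c1 c2" unfolding step_const_def K_def[symmetric] using pos by linarith
    then show ?thesis using eps by (metis mult.assoc mult_right_mono mult_nonneg_nonneg zero_le_power2)
  qed
  ultimately show ?thesis
    unfolding A_def[symmetric] step_const_def K_def[symmetric] by (simp add: algebra_simps)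
qed

section \<open>A discrete supermartingale inequality\<close>

text \<open>A trade of low powers of an increment for a fixed tolerance plus a fourth power.
  Expected fourth powers sum to the order of the mesh over a whole grid, which beats the large
  factor 1 / eps^3.\<close>

lemma le_fourth_power:
  fixes x eps :: real
  assumes "0 < eps" "eps \<le> 1" "0 \<le> x"
  shows "x \<le> eps + x ^ 4 / eps ^ 3" and "x\<^sup>2 \<le> eps + x ^ 4 / eps ^ 3"
proof -
  show "x \<le> eps + x ^ 4 / eps ^ 3"
  proof (cases "x \<le> eps")
    case True
    then show ?thesis using assms by (simp add: add_increasing2)
  next
    case False
    then have "x * eps ^ 3 \<le> x * x ^ 3" using assms by (intro mult_left_mono power_mono) auto
    then have "x \<le> x ^ 4 / eps ^ 3" using assms by (simp add: field_simps eval_nat_numeral)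
    then show ?thesis using assms by linarith
  qed
  show "x\<^sup>2 \<le> eps + x ^ 4 / eps ^ 3"
  proof (cases "x\<^sup>2 \<le> eps")
    case True
    then show ?thesis using assms by (simp add: add_increasing2)
  next
    case False
    have "eps ^ 3 \<le> eps" using assms power_decreasing[of 1 3 eps] by simp
    then have "eps ^ 3 \<le> x\<^sup>2" using False by linarith
    then have "x\<^sup>2 * eps ^ 3 \<le> x\<^sup>2 * x\<^sup>2" by (intro mult_left_mono) auto
    then have "x\<^sup>2 \<le> x ^ 4 / eps ^ 3" using assms by (simp add: field_simps eval_nat_numeral)
    then show ?thesis using assms by linarith
  qed
qed

context filtered_bm
begin

text \<open>The Brownian part of the second-order expansion minus its conditional mean, with
  \<open>u\<close> and \<open>v\<close> standing for \<open>w'\<close> and \<open>w''\<close> at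
  |Y|^2: the mean of |proj S b|^2 is card S * h, that of (Y \<bullet> b)^2 is |Y|^2 * h.\<close>

definition compensated :: "(real^'d) set \<Rightarrow> real \<Rightarrow> real \<Rightarrow> real \<Rightarrow> real^'d \<Rightarrow> real^'d \<Rightarrow> real" where
  "compensated S h u v Y b = 2 * u * (Y \<bullet> b) + u * ((norm (proj S b))\<^sup>2 - real (card S) * h)
    + 2 * v * ((Y \<bullet> b)\<^sup>2 - (norm Y)\<^sup>2 * h)"

text \<open>The coefficients are bounded only on \<open>E\<close>, so each is first multiplied by
  the indicator of \<open>E\<close>. It is then bounded everywhere and known at time
  \<open>s\<close>, and the linear and quadratic moment formulas apply term by term.\<close>

lemma compensated_mean_zero:
  assumes st: "0 \<le> s" "s < t" and S: "orthonormal S" and E: "E \<in> F s"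
    and Y: "Y \<in> borel_measurable (Ft s)" "\<And>\<omega>. \<omega> \<in> E \<Longrightarrow> norm (Y \<omega>) \<le> c1"
    and u: "u \<in> borel_measurable (Ft s)" "\<And>\<omega>. \<omega> \<in> E \<Longrightarrow> \<bar>u \<omega>\<bar> \<le> c2"
    and v: "v \<in> borel_measurable (Ft s)" "\<And>\<omega>. \<omega> \<in> E \<Longrightarrow> \<bar>v \<omega>\<bar> \<le> c2"
    and c: "0 \<le> c1" "0 \<le> c2"
  defines "X \<equiv> \<lambda>\<omega>. indicator E \<omega> * compensated S (t - s) (u \<omega>) (v \<omega>) (Y \<omega>) (B t \<omega> - B s \<omega>)"
  shows "integrable M X" "expectation X = 0"
proof -
  let ?b = "\<lambda>\<omega>. B t \<omega> - B s \<omega>"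
  let ?I = "\<lambda>\<omega>. indicator E \<omega> :: real"
  have Im: "?I \<in> borel_measurable (Ft s)"
    using E st by (intro borel_measurable_indicator) (simp add: sets_Ft)
  have m1: "(\<lambda>\<omega>. (2 * ?I \<omega> * u \<omega>) *\<^sub>R Y \<omega>) \<in> borel_measurable (Ft s)"
    and m2: "(\<lambda>\<omega>. ?I \<omega> * u \<omega>) \<in> borel_measurable (Ft s)"
    and m3: "(\<lambda>\<omega>. 2 * ?I \<omega> * v \<omega>) \<in> borel_measurable (Ft s)"
    and m4: "(\<lambda>\<omega>. ?I \<omega> *\<^sub>R Y \<omega>) \<in> borel_measurable (Ft s)"
    using Im Y(1) u(1) v(1) by (auto intro!: borel_measurable_times borel_measurable_scaleR)
  have b1: "norm ((2 * ?I \<omega> * u \<omega>) *\<^sub>R Y \<omega>) \<le> 2 * c2 * c1" for \<omega>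
    using Y(2)[of \<omega>] u(2)[of \<omega>] c by (auto simp: indicator_def intro!: mult_mono)
  have b2: "\<bar>?I \<omega> * u \<omega>\<bar> \<le> c2" and b3: "\<bar>2 * ?I \<omega> * v \<omega>\<bar> \<le> 2 * c2" and b4: "norm (?I \<omega> *\<^sub>R Y \<omega>) \<le> c1" for \<omega>
    using Y(2)[of \<omega>] u(2)[of \<omega>] v(2)[of \<omega>] c by (auto simp: indicator_def)
  note L = increment_linear[OF st m1 b1]
  have Qe: "integrable M (\<lambda>\<omega>. (?I \<omega> * u \<omega>) * (e \<bullet> ?b \<omega>)\<^sup>2)"
    "expectation (\<lambda>\<omega>. (?I \<omega> * u \<omega>) * (e \<bullet> ?b \<omega>)\<^sup>2) = (t - s) * expectation (\<lambda>\<omega>. ?I \<omega> * u \<omega>)"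
    if "e \<in> S" for e
    using increment_quadratic[OF st _ _ m2 b2, of "\<lambda>_. e" 1] that S by (auto simp: orthonormal_def)
  note QY = increment_quadratic[OF st m4 b4 m3 b3]
  have i2: "integrable M (\<lambda>\<omega>. ?I \<omega> * u \<omega>)"
    by (rule integrable_const_bound[of _ c2]) (auto intro: measurable_Ft_M[OF st(1) m2] b2 AE_I2)
  have i5: "integrable M (\<lambda>\<omega>. (2 * ?I \<omega> * v \<omega>) * (norm (?I \<omega> *\<^sub>R Y \<omega>))\<^sup>2)"
  proof (rule integrable_const_bound[of _ "2 * c2 * c1\<^sup>2"])
    show "(\<lambda>\<omega>. (2 * ?I \<omega> * v \<omega>) * (norm (?I \<omega> *\<^sub>R Y \<omega>))\<^sup>2) \<in> borel_measurable M"
      by (rule measurable_Ft_M[OF st(1) borel_measurable_times[OF m3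
            borel_measurable_power[OF measurable_compose[OF m4 borel_measurable_norm]]]])
    show "AE \<omega> in M. norm ((2 * ?I \<omega> * v \<omega>) * (norm (?I \<omega> *\<^sub>R Y \<omega>))\<^sup>2) \<le> 2 * c2 * c1\<^sup>2"
    proof (rule AE_I2)
      fix \<omega>
      show "norm ((2 * ?I \<omega> * v \<omega>) * (norm (?I \<omega> *\<^sub>R Y \<omega>))\<^sup>2) \<le> 2 * c2 * c1\<^sup>2"
        unfolding real_norm_def abs_mult[of "2 * ?I \<omega> * v \<omega>"] using b3[of \<omega>] b4[of \<omega>] c
        by (intro mult_mono) (auto intro!: power_mono)
    qed
  qed
  have eq: "X = (\<lambda>\<omega>. ((2 * ?I \<omega> * u \<omega>) *\<^sub>R Y \<omega>) \<bullet> ?b \<omega>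
     + ((\<Sum>e\<in>S. (?I \<omega> * u \<omega>) * (e \<bullet> ?b \<omega>)\<^sup>2) - real (card S) * (t - s) * (?I \<omega> * u \<omega>))
     + ((2 * ?I \<omega> * v \<omega>) * ((?I \<omega> *\<^sub>R Y \<omega>) \<bullet> ?b \<omega>)\<^sup>2
       - (t - s) * ((2 * ?I \<omega> * v \<omega>) * (norm (?I \<omega> *\<^sub>R Y \<omega>))\<^sup>2)))"
  proof
    fix \<omega>
    have "(norm (proj S (?b \<omega>)))\<^sup>2 = (\<Sum>e\<in>S. (e \<bullet> ?b \<omega>)\<^sup>2)"
      by (simp add: norm_proj_sq[OF S] inner_commute)
    then show "X \<omega> = ((2 * ?I \<omega> * u \<omega>) *\<^sub>R Y \<omega>) \<bullet> ?b \<omega>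
     + ((\<Sum>e\<in>S. (?I \<omega> * u \<omega>) * (e \<bullet> ?b \<omega>)\<^sup>2) - real (card S) * (t - s) * (?I \<omega> * u \<omega>))
     + ((2 * ?I \<omega> * v \<omega>) * ((?I \<omega> *\<^sub>R Y \<omega>) \<bullet> ?b \<omega>)\<^sup>2
       - (t - s) * ((2 * ?I \<omega> * v \<omega>) * (norm (?I \<omega> *\<^sub>R Y \<omega>))\<^sup>2))"
      unfolding X_def compensated_def sum_distrib_left[symmetric]
      by (cases "\<omega> \<in> E") (simp_all add: algebra_simps)
  qed
  have iS: "integrable M (\<lambda>\<omega>. \<Sum>e\<in>S. (?I \<omega> * u \<omega>) * (e \<bullet> ?b \<omega>)\<^sup>2)"
    by (intro Bochner_Integration.integrable_sum Qe)
  have i6: "integrable M (\<lambda>\<omega>. real (card S) * (t - s) * (?I \<omega> * u \<omega>))" by (intro integrable_mult_right i2)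
  have i7: "integrable M (\<lambda>\<omega>. (t - s) * ((2 * ?I \<omega> * v \<omega>) * (norm (?I \<omega> *\<^sub>R Y \<omega>))\<^sup>2))"
    by (intro integrable_mult_right i5)
  show "integrable M X" unfolding eq
    by (intro Bochner_Integration.integrable_add Bochner_Integration.integrable_diff L(1) iS i6 i7 QY(1))
  have "expectation X = 0
     + (expectation (\<lambda>\<omega>. \<Sum>e\<in>S. (?I \<omega> * u \<omega>) * (e \<bullet> ?b \<omega>)\<^sup>2) - real (card S) * (t - s) * expectation (\<lambda>\<omega>. ?I \<omega> * u \<omega>))
     + ((t - s) * expectation (\<lambda>\<omega>. (2 * ?I \<omega> * v \<omega>) * (norm (?I \<omega> *\<^sub>R Y \<omega>))\<^sup>2)
       - (t - s) * expectation (\<lambda>\<omega>. (2 * ?I \<omega> * v \<omega>) * (norm (?I \<omega> *\<^sub>R Y \<omega>))\<^sup>2))"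
    unfolding eq
    by (simp only: Bochner_Integration.integral_add Bochner_Integration.integral_diff
        Bochner_Integration.integrable_add Bochner_Integration.integrable_diff L iS i6 i7 QY
        integral_mult_right_zero)
  also have "expectation (\<lambda>\<omega>. \<Sum>e\<in>S. (?I \<omega> * u \<omega>) * (e \<bullet> ?b \<omega>)\<^sup>2)
     = (\<Sum>e\<in>S. (t - s) * expectation (\<lambda>\<omega>. ?I \<omega> * u \<omega>))"
    by (subst Bochner_Integration.integral_sum) (simp_all only: Qe cong: sum.cong)
  finally show "expectation X = 0" by simp
qed

text \<open>Meant for the exit step, where the compensated term is not centred. At most one such
  term occurs per path, so a crude bound in powers of \<open>norm b\<close> is enough.\<close>

lemma compensated_bound:
  assumes S: "orthonormal S" and Y: "norm Y \<le> c1" and u: "\<bar>u\<bar> \<le> c2" and v: "\<bar>v\<bar> \<le> c2" and h: "0 \<le> h"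
  shows "\<bar>compensated S h u v Y b\<bar> \<le> c2 * (2 * c1 + 1 + 2 * c1\<^sup>2 + real (card S)) * (norm b + (norm b)\<^sup>2 + h)"
proof -
  have c: "0 \<le> c1" "0 \<le> c2" using norm_ge_zero[of Y] Y u by linarith+
  have Yb: "\<bar>Y \<bullet> b\<bar> \<le> c1 * norm b"
    by (rule order_trans[OF Cauchy_Schwarz_ineq2]) (use Y in \<open>auto intro: mult_right_mono\<close>)
  have 1: "\<bar>2 * u * (Y \<bullet> b)\<bar> \<le> 2 * c2 * (c1 * norm b)"
    unfolding abs_mult using u c Yb by (intro mult_mono) auto
  have "(norm (proj S b))\<^sup>2 \<le> (norm b)\<^sup>2" by (intro power_mono norm_proj_le S) auto
  then have "\<bar>(norm (proj S b))\<^sup>2 - real (card S) * h\<bar> \<le> (norm b)\<^sup>2 + real (card S) * h"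
    using h by (intro order_trans[OF abs_triangle_ineq4]) auto
  then have 2: "\<bar>u * ((norm (proj S b))\<^sup>2 - real (card S) * h)\<bar> \<le> c2 * ((norm b)\<^sup>2 + real (card S) * h)"
    unfolding abs_mult using u c h by (intro mult_mono) auto
  have "\<bar>(Y \<bullet> b)\<^sup>2\<bar> \<le> c1\<^sup>2 * (norm b)\<^sup>2"
    using power_mono[OF Yb, of 2] by (simp add: power_mult_distrib)
  moreover have "\<bar>(norm Y)\<^sup>2 * h\<bar> \<le> c1\<^sup>2 * h"
    using h Y power_mono[OF Y, of 2] by (simp add: abs_mult mult_right_mono)
  ultimately have "\<bar>(Y \<bullet> b)\<^sup>2 - (norm Y)\<^sup>2 * h\<bar> \<le> c1\<^sup>2 * (norm b)\<^sup>2 + c1\<^sup>2 * h"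
    by (intro order_trans[OF abs_triangle_ineq4]) auto
  then have 3: "\<bar>2 * v * ((Y \<bullet> b)\<^sup>2 - (norm Y)\<^sup>2 * h)\<bar> \<le> 2 * c2 * (c1\<^sup>2 * (norm b)\<^sup>2 + c1\<^sup>2 * h)"
    unfolding abs_mult using v c h by (intro mult_mono) auto
  define n where "n = norm b"
  define k where "k = real (card S)"
  have nn: "0 \<le> n" "0 \<le> k" by (auto simp: n_def k_def)
  have "\<bar>compensated S h u v Y b\<bar> \<le> 2 * c2 * (c1 * n) + c2 * (n\<^sup>2 + k * h) + 2 * c2 * (c1\<^sup>2 * n\<^sup>2 + c1\<^sup>2 * h)"
    using 1 2 3 unfolding compensated_def n_def k_def by linarith
  also have "\<dots> = c2 * (2 * c1 * n + (1 + 2 * c1\<^sup>2) * n\<^sup>2 + (2 * c1\<^sup>2 + k) * h)" by (simp add: algebra_simps)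
  also have "\<dots> \<le> c2 * ((2 * c1 + 1 + 2 * c1\<^sup>2 + k) * n + (2 * c1 + 1 + 2 * c1\<^sup>2 + k) * n\<^sup>2 + (2 * c1 + 1 + 2 * c1\<^sup>2 + k) * h)"
  proof -
    have "2 * c1 \<le> 2 * c1 + 1 + 2 * c1\<^sup>2 + k" "1 + 2 * c1\<^sup>2 \<le> 2 * c1 + 1 + 2 * c1\<^sup>2 + k"
      "2 * c1\<^sup>2 + k \<le> 2 * c1 + 1 + 2 * c1\<^sup>2 + k"
      using c nn by auto
    from mult_right_mono[OF this(1) nn(1)] mult_right_mono[OF this(2), of "n\<^sup>2"] mult_right_mono[OF this(3) h]
    show ?thesis using c by (intro mult_left_mono add_mono) auto
  qed
  finally show ?thesis by (simp add: n_def k_def algebra_simps)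
qed

lemma first_exit:
  fixes E :: "nat \<Rightarrow> 'w set"
  assumes "\<omega> \<in> E 0"
  obtains k where "k \<le> N" "\<omega> \<in> E k" "k < N \<Longrightarrow> \<omega> \<notin> E (Suc k)"
  using assms
proof (induction N arbitrary: thesis)
  case 0 then show ?case by blast
next
  case (Suc N)
  obtain k where k: "k \<le> N" "\<omega> \<in> E k" "k < N \<Longrightarrow> \<omega> \<notin> E (Suc k)" using Suc.IH[OF _ Suc.prems(2)] by blast
  show ?case
  proof (cases "k < N \<or> \<omega> \<notin> E (Suc k)")
    case True then show ?thesis using k Suc.prems(1)[of k] by auto
  next
    case False then show ?thesis using k Suc.prems(1)[of "Suc k"] by auto
  qed
qed

text \<open>A summand counts only if its whole step is survived, so the telescoping sum stops at the
  value just before the exit step.\<close>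

lemma sum_until_exit:
  fixes E :: "nat \<Rightarrow> 'w set" and f :: "nat \<Rightarrow> real"
  assumes E: "\<And>k. E (Suc k) \<subseteq> E k" and k: "k \<le> N" "\<omega> \<in> E k" "k < N \<Longrightarrow> \<omega> \<notin> E (Suc k)"
  shows "(\<Sum>j<N. indicator (E (Suc j)) \<omega> * (f (Suc j) - f j)) = f k - f 0"
proof -
  have anti: "E j \<subseteq> E i" if "i \<le> j" for i j using E that by (rule lift_Suc_antimono_le)
  have "(\<Sum>j<N. indicator (E (Suc j)) \<omega> * (f (Suc j) - f j))
      = (\<Sum>j<k. indicator (E (Suc j)) \<omega> * (f (Suc j) - f j))"
  proof (rule sum.mono_neutral_right)
    show "\<forall>i\<in>{..<N} - {..<k}. indicator (E (Suc i)) \<omega> * (f (Suc i) - f i) = 0"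
    proof
      fix i assume i: "i \<in> {..<N} - {..<k}"
      then have "\<omega> \<notin> E (Suc i)" using k anti[of "Suc k" "Suc i"] by auto
      then show "indicator (E (Suc i)) \<omega> * (f (Suc i) - f i) = 0" by simp
    qed
  qed (use k in auto)
  also have "\<dots> = (\<Sum>j<k. f (Suc j) - f j)"
  proof (rule sum.cong)
    fix j assume "j \<in> {..<k}"
    then have "\<omega> \<in> E (Suc j)" using k(2) anti[of "Suc j" k] by auto
    then show "indicator (E (Suc j)) \<omega> * (f (Suc j) - f j) = f (Suc j) - f j" by simp
  qed simp
  also have "\<dots> = f k - f 0" by (rule sum_lessThan_telescope)
  finally show ?thesis .
qed

text \<open>
  The increments of \<open>V\<close> are only controlled on \<open>E (Suc k)\<close>, whereas the compensated terms are centred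
  on the earlier event \<open>E k\<close>. The difference is a single term at the exit step, which fourth moments
  of the increments make negligible as the mesh tends to 0. Nothing is assumed about measurability
  of \<open>V\<close>, so the exit event is only enclosed in an event \<open>G\<close>.
\<close>

lemma discrete_supermartingale:
  fixes s h eps :: real and N :: nat and E :: "nat \<Rightarrow> 'w set" and V :: "nat \<Rightarrow> 'w \<Rightarrow> real"
  defines "t \<equiv> \<lambda>k. s + real k * h"
  defines "b \<equiv> \<lambda>k \<omega>. B (t (Suc k)) \<omega> - B (t k) \<omega>"
  assumes s: "0 \<le> s" and h: "0 < h" and eps: "0 < eps" "eps \<le> 1" and S: "orthonormal S"
    and E: "\<And>k. k \<le> N \<Longrightarrow> E k \<in> F (t k)" "\<And>k. E (Suc k) \<subseteq> E k"
    and Y: "\<And>k. k < N \<Longrightarrow> Y k \<in> borel_measurable (Ft (t k))" "\<And>k \<omega>. \<omega> \<in> E k \<Longrightarrow> norm (Y k \<omega>) \<le> c1"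
    and u: "\<And>k. k < N \<Longrightarrow> u k \<in> borel_measurable (Ft (t k))" "\<And>k \<omega>. \<omega> \<in> E k \<Longrightarrow> \<bar>u k \<omega>\<bar> \<le> c2"
    and v: "\<And>k. k < N \<Longrightarrow> v k \<in> borel_measurable (Ft (t k))" "\<And>k \<omega>. \<omega> \<in> E k \<Longrightarrow> \<bar>v k \<omega>\<bar> \<le> c2"
    and c: "0 \<le> c1" "0 \<le> c2" "0 \<le> C" "0 \<le> Q" "0 \<le> v0" "0 < lam"
    and step: "\<And>k \<omega>. k < N \<Longrightarrow> \<omega> \<in> E (Suc k) \<Longrightarrow> V (Suc k) \<omega> - V k \<omega>
        \<le> compensated S h (u k \<omega>) (v k \<omega>) (Y k \<omega>) (b k \<omega>)
          + C * (eps * (dq k \<omega> + (norm (b k \<omega>))\<^sup>2) + dq k \<omega> * norm (b k \<omega>))"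
    and dq: "\<And>k \<omega>. k < N \<Longrightarrow> \<omega> \<in> E (Suc k) \<Longrightarrow> 0 \<le> dq k \<omega>"
      "\<And>\<omega>. \<omega> \<in> space M \<Longrightarrow> (\<Sum>k<N. indicator (E (Suc k)) \<omega> * dq k \<omega>) \<le> Q"
    and V: "\<And>k \<omega>. \<omega> \<in> E k \<Longrightarrow> 0 \<le> V k \<omega>" "\<And>\<omega>. \<omega> \<in> E 0 \<Longrightarrow> V 0 \<omega> \<le> v0"
  defines "c \<equiv> c2 * (2 * c1 + 1 + 2 * c1\<^sup>2 + real (card S))"
  defines "q4 \<equiv> 3 * real CARD('d) ^ 2 * (real N * h) * h"
  shows "\<exists>G\<in>events. {\<omega>\<in>E 0. \<exists>k\<le>N. \<omega> \<in> E k \<and> (k < N \<longrightarrow> \<omega> \<notin> E (Suc k)) \<and> lam \<le> V k \<omega>} \<subseteq> G \<and>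
    prob G \<le> (v0 + c * (2 * eps + h + 2 * q4 / eps ^ 3) + C * eps * (Q + real CARD('d) * (real N * h))
       + C * Q * (eps + q4 / eps ^ 3)) / lam"
proof -
  have tk: "0 \<le> t k" "t k < t (Suc k)" "t (Suc k) - t k = h" for k
    using s h by (auto simp: t_def algebra_simps)
  have c0: "0 \<le> c" unfolding c_def using c by (intro mult_nonneg_nonneg) auto
  have Esp: "E k \<subseteq> space M" for k
  proof -
    have "E 0 \<in> sets M" using E(1)[of 0] filtration_sub[OF tk(1)] by auto
    moreover have "E k \<subseteq> E 0" using E(2) by (rule lift_Suc_antimono_le) auto
    ultimately show ?thesis using sets.sets_into_space by blast
  qed
  define I where "I = (\<lambda>k \<omega>. indicator (E k) \<omega> :: real)"
  define m where "m = (\<lambda>k \<omega>. compensated S h (u k \<omega>) (v k \<omega>) (Y k \<omega>) (b k \<omega>))"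
  have mz: "integrable M (\<lambda>\<omega>. I k \<omega> * m k \<omega>)" "expectation (\<lambda>\<omega>. I k \<omega> * m k \<omega>) = 0" if "k < N" for k
    using compensated_mean_zero[OF tk(1) tk(2) S E(1) Y u v c(1,2), of k] that
    unfolding I_def m_def b_def tk(3) by auto
  \<comment> \<open>An integrable majorant of the stopped increment \<open>Z\<close>. Its groups are
    the centred terms, the single exit term, the errors proportional to \<open>eps\<close>, and the
    products of clock and Brownian increments.\<close>
  define W where "W = (\<lambda>\<omega>. (\<Sum>k<N. I k \<omega> * m k \<omega>)
     + (c * (2 * eps + h) + 2 * c / eps ^ 3 * (\<Sum>k<N. norm (b k \<omega>) ^ 4))
     + (C * eps * Q + C * eps * (\<Sum>k<N. (norm (b k \<omega>))\<^sup>2))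
     + (C * Q * eps + C * Q / eps ^ 3 * (\<Sum>k<N. norm (b k \<omega>) ^ 4)))"
  define Z where "Z = (\<lambda>\<omega>. \<Sum>k<N. I (Suc k) \<omega> * (V (Suc k) \<omega> - V k \<omega>))"
  have sq: "integrable M (\<lambda>\<omega>. (norm (b k \<omega>))\<^sup>2)" "expectation (\<lambda>\<omega>. (norm (b k \<omega>))\<^sup>2) = real CARD('d) * h" for k
    using increment_square[OF tk(1) tk(2)] unfolding b_def tk(3) by auto
  have fo: "integrable M (\<lambda>\<omega>. norm (b k \<omega>) ^ 4)"
    "expectation (\<lambda>\<omega>. norm (b k \<omega>) ^ 4) \<le> 3 * real CARD('d) ^ 2 * h\<^sup>2" for k
    using increment_fourth[OF tk(1) tk(2), of k] unfolding b_def tk(3) by auto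
  have fo_sum: "expectation (\<lambda>\<omega>. \<Sum>k<N. norm (b k \<omega>) ^ 4) \<le> q4"
  proof -
    have "expectation (\<lambda>\<omega>. \<Sum>k<N. norm (b k \<omega>) ^ 4) = (\<Sum>k<N. expectation (\<lambda>\<omega>. norm (b k \<omega>) ^ 4))"
      by (rule Bochner_Integration.integral_sum) (rule fo)
    also have "\<dots> \<le> (\<Sum>k<N. 3 * real CARD('d) ^ 2 * h\<^sup>2)" by (intro sum_mono fo)
    finally show ?thesis by (simp add: q4_def power2_eq_square algebra_simps)
  qed
  have i4: "integrable M (\<lambda>\<omega>. \<Sum>k<N. norm (b k \<omega>) ^ 4)" by (intro Bochner_Integration.integrable_sum fo)
  have i2: "integrable M (\<lambda>\<omega>. \<Sum>k<N. (norm (b k \<omega>))\<^sup>2)" by (intro Bochner_Integration.integrable_sum sq)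
  have im: "integrable M (\<lambda>\<omega>. \<Sum>k<N. I k \<omega> * m k \<omega>)" by (intro Bochner_Integration.integrable_sum mz) simp
  have Wi: "integrable M W" unfolding W_def
    by (intro Bochner_Integration.integrable_add integrable_mult_right integrable_const im i2 i4)
  have We: "expectation W \<le> c * (2 * eps + h + 2 * q4 / eps ^ 3)
      + C * eps * (Q + real CARD('d) * (real N * h)) + C * Q * (eps + q4 / eps ^ 3)"
  proof -
    have "expectation (\<lambda>\<omega>. \<Sum>k<N. I k \<omega> * m k \<omega>) = 0"
      by (subst Bochner_Integration.integral_sum) (simp_all add: mz)
    moreover have "expectation (\<lambda>\<omega>. \<Sum>k<N. (norm (b k \<omega>))\<^sup>2) = real N * (real CARD('d) * h)"
      by (subst Bochner_Integration.integral_sum) (simp_all only: sq, simp)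
    ultimately have "expectation W = 0 + (c * (2 * eps + h) + 2 * c / eps ^ 3 * expectation (\<lambda>\<omega>. \<Sum>k<N. norm (b k \<omega>) ^ 4))
     + (C * eps * Q + C * eps * (real N * (real CARD('d) * h)))
     + (C * Q * eps + C * Q / eps ^ 3 * expectation (\<lambda>\<omega>. \<Sum>k<N. norm (b k \<omega>) ^ 4))"
      unfolding W_def
      by (simp add: im i2 i4 prob_space del: sum_mult_indicator)
    moreover have "2 * c / eps ^ 3 * expectation (\<lambda>\<omega>. \<Sum>k<N. norm (b k \<omega>) ^ 4) \<le> 2 * c / eps ^ 3 * q4"
      using fo_sum c0 eps by (intro mult_left_mono) auto
    moreover have "C * Q / eps ^ 3 * expectation (\<lambda>\<omega>. \<Sum>k<N. norm (b k \<omega>) ^ 4) \<le> C * Q / eps ^ 3 * q4"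
      using fo_sum c eps by (intro mult_left_mono) auto
    ultimately show ?thesis by (simp add: algebra_simps)
  qed
  have ZW: "Z \<omega> \<le> W \<omega>" if \<omega>: "\<omega> \<in> space M" for \<omega>
  proof -
    let ?n = "\<lambda>k. norm (b k \<omega>)"
    have Imono: "I (Suc k) \<omega> \<le> I k \<omega>" "0 \<le> I k \<omega>" "I k \<omega> \<le> 1" for k
      using E(2)[of k] by (auto simp: I_def indicator_def)
    have dqI: "0 \<le> I (Suc k) \<omega> * dq k \<omega>" if "k < N" for k
      using dq(1)[OF that, of \<omega>] by (auto simp: I_def indicator_def)
    have dqQ: "I (Suc k) \<omega> * dq k \<omega> \<le> Q" if "k < N" for k
      using member_le_sum[of k "{..<N}" "\<lambda>k. I (Suc k) \<omega> * dq k \<omega>"] dqI that dq(2)[OF \<omega>]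
      by (auto simp: I_def)
    have A: "I (Suc k) \<omega> * (V (Suc k) \<omega> - V k \<omega>) \<le> I k \<omega> * m k \<omega>
        + (c * (2 * eps + h) * (I k \<omega> - I (Suc k) \<omega>) + 2 * c / eps ^ 3 * ?n k ^ 4)
        + (C * eps * (I (Suc k) \<omega> * dq k \<omega>) + C * eps * (?n k)\<^sup>2)
        + (C * eps * (I (Suc k) \<omega> * dq k \<omega>) + C * Q / eps ^ 3 * ?n k ^ 4)" if k: "k < N" for k
    proof -
      note P4 = le_fourth_power[OF eps norm_ge_zero[of "b k \<omega>"]]
      have "I (Suc k) \<omega> * (V (Suc k) \<omega> - V k \<omega>) \<le> I (Suc k) \<omega> * (m k \<omega>
          + C * (eps * (dq k \<omega> + (?n k)\<^sup>2) + dq k \<omega> * ?n k))"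
        using step[OF k, of \<omega>] unfolding m_def by (auto simp: I_def indicator_def)
      also have "\<dots> = I k \<omega> * m k \<omega> - (I k \<omega> - I (Suc k) \<omega>) * m k \<omega>
         + (C * eps * (I (Suc k) \<omega> * dq k \<omega>) + C * eps * (I (Suc k) \<omega> * (?n k)\<^sup>2)) + C * ((I (Suc k) \<omega> * dq k \<omega>) * ?n k)"
        by (simp add: algebra_simps)
      finally have 1: "I (Suc k) \<omega> * (V (Suc k) \<omega> - V k \<omega>) \<le> \<dots>" .
      \<comment> \<open>The passage from \<open>E (Suc k)\<close> to \<open>E k\<close>: the
        difference of the indicators is nonzero only at the exit step, and there the crude bound and
        the trade for fourth powers are used.\<close>
      have 2: "- ((I k \<omega> - I (Suc k) \<omega>) * m k \<omega>) \<le> c * (2 * eps + h) * (I k \<omega> - I (Suc k) \<omega>) + 2 * c / eps ^ 3 * ?n k ^ 4"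
      proof (cases "\<omega> \<in> E k \<and> \<omega> \<notin> E (Suc k)")
        case True
        have "\<bar>m k \<omega>\<bar> \<le> c * (?n k + (?n k)\<^sup>2 + h)"
          unfolding m_def c_def using True Y(2) u(2) v(2) h by (intro compensated_bound S) auto
        also have "\<dots> \<le> c * ((eps + ?n k ^ 4 / eps ^ 3) + (eps + ?n k ^ 4 / eps ^ 3) + h)"
          by (intro mult_left_mono add_mono P4 c0) auto
        also have "\<dots> = c * (2 * eps + h) + 2 * c / eps ^ 3 * ?n k ^ 4" by (simp add: algebra_simps)
        finally show ?thesis using True by (simp add: I_def)
      next
        case False
        then have "I k \<omega> = I (Suc k) \<omega>" using E(2)[of k] by (auto simp: I_def indicator_def)
        then show ?thesis using c0 eps by simp
      qed
      have 3: "C * eps * (I (Suc k) \<omega> * (?n k)\<^sup>2) \<le> C * eps * (?n k)\<^sup>2"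
        using Imono[of "Suc k"] c eps by (intro mult_left_mono mult_left_le_one_le) auto
      have "(I (Suc k) \<omega> * dq k \<omega>) * ?n k \<le> (I (Suc k) \<omega> * dq k \<omega>) * (eps + ?n k ^ 4 / eps ^ 3)"
        by (intro mult_left_mono P4 dqI[OF k])
      also have "\<dots> \<le> eps * (I (Suc k) \<omega> * dq k \<omega>) + Q * (?n k ^ 4 / eps ^ 3)"
        using mult_right_mono[OF dqQ[OF k], of "?n k ^ 4 / eps ^ 3"] eps by (simp add: algebra_simps)
      finally have "C * ((I (Suc k) \<omega> * dq k \<omega>) * ?n k) \<le> C * (eps * (I (Suc k) \<omega> * dq k \<omega>) + Q * (?n k ^ 4 / eps ^ 3))"
        using c by (intro mult_left_mono) auto
      then have 4: "C * ((I (Suc k) \<omega> * dq k \<omega>) * ?n k) \<le> C * eps * (I (Suc k) \<omega> * dq k \<omega>) + C * Q / eps ^ 3 * ?n k ^ 4"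
        by (simp add: algebra_simps)
      show ?thesis using 1 2 3 4 by linarith
    qed
    \<comment> \<open>The events are nested, so there is at most one exit and the cost of order eps
      + h is paid once rather than \<open>N\<close> times.\<close>
    have tel: "(\<Sum>k<N. I k \<omega> - I (Suc k) \<omega>) \<le> 1"
      using sum_lessThan_telescope'[of "\<lambda>k. I k \<omega>" N] Imono[of 0] Imono[of N] by simp
    have "Z \<omega> \<le> (\<Sum>k<N. I k \<omega> * m k \<omega>
        + (c * (2 * eps + h) * (I k \<omega> - I (Suc k) \<omega>) + 2 * c / eps ^ 3 * ?n k ^ 4)
        + (C * eps * (I (Suc k) \<omega> * dq k \<omega>) + C * eps * (?n k)\<^sup>2)
        + (C * eps * (I (Suc k) \<omega> * dq k \<omega>) + C * Q / eps ^ 3 * ?n k ^ 4))"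
      unfolding Z_def by (intro sum_mono A) simp
    also have "\<dots> = (\<Sum>k<N. I k \<omega> * m k \<omega>)
        + (c * (2 * eps + h) * (\<Sum>k<N. I k \<omega> - I (Suc k) \<omega>) + 2 * c / eps ^ 3 * (\<Sum>k<N. ?n k ^ 4))
        + (C * eps * (\<Sum>k<N. I (Suc k) \<omega> * dq k \<omega>) + C * eps * (\<Sum>k<N. (?n k)\<^sup>2))
        + (C * eps * (\<Sum>k<N. I (Suc k) \<omega> * dq k \<omega>) + C * Q / eps ^ 3 * (\<Sum>k<N. ?n k ^ 4))"
      unfolding sum_distrib_left sum.distrib ..
    also have "\<dots> \<le> W \<omega>"
    proof -
      have "c * (2 * eps + h) * (\<Sum>k<N. I k \<omega> - I (Suc k) \<omega>) \<le> c * (2 * eps + h) * 1"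
        using tel c0 eps h by (intro mult_left_mono) auto
      moreover have "C * eps * (\<Sum>k<N. I (Suc k) \<omega> * dq k \<omega>) \<le> C * eps * Q"
        using dq(2)[OF \<omega>] c eps unfolding I_def by (intro mult_left_mono) auto
      moreover have "C * Q * eps = C * eps * Q" by simp
      ultimately show ?thesis unfolding W_def by linarith
    qed
    finally show ?thesis .
  qed
  have Zk: "Z \<omega> = V k \<omega> - V 0 \<omega>" if "k \<le> N" "\<omega> \<in> E k" "k < N \<Longrightarrow> \<omega> \<notin> E (Suc k)" for \<omega> k
    unfolding Z_def I_def by (rule sum_until_exit[OF E(2) that])
  \<comment> \<open>Needed for Markov's inequality. On \<open>E 0\<close> the sum \<open>Z\<close>
    equals V k - V 0 for the exit index, hence is at least -v0; off \<open>E 0\<close> it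
    vanishes.\<close>
  have nonneg: "0 \<le> v0 + W \<omega>" if \<omega>: "\<omega> \<in> space M" for \<omega>
  proof (cases "\<omega> \<in> E 0")
    case True
    then obtain k where k: "k \<le> N" "\<omega> \<in> E k" "k < N \<Longrightarrow> \<omega> \<notin> E (Suc k)"
      using first_exit[of \<omega> E N] by blast
    show ?thesis using ZW[OF \<omega>] Zk[OF k] V(1)[OF k(2)] V(2)[OF True] by linarith
  next
    case False
    have "E (Suc k) \<subseteq> E 0" for k using lift_Suc_antimono_le[of E 0 "Suc k"] E(2) by blast
    then have "Z \<omega> = 0" using False unfolding Z_def I_def
      by (intro sum.neutral) (auto simp: indicator_def)
    then show ?thesis using ZW[OF \<omega>] c by linarith
  qed
  let ?G = "{\<omega>\<in>space M. lam \<le> v0 + W \<omega>}"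
  have iv: "integrable M (\<lambda>\<omega>. v0 + W \<omega>)" using Wi by simp
  have Gm: "?G \<in> events" using borel_measurable_integrable[OF iv] by measurable
  have "prob ?G \<le> expectation (\<lambda>\<omega>. v0 + W \<omega>) / lam"
    by (rule integral_Markov_inequality_measure[OF iv, of "{}"]) (use nonneg c in \<open>auto intro: AE_I2\<close>)
  also have "expectation (\<lambda>\<omega>. v0 + W \<omega>) = v0 + expectation W"
    using Wi prob_space by simp
  also have "(v0 + expectation W) / lam \<le> (v0 + c * (2 * eps + h + 2 * q4 / eps ^ 3)
      + C * eps * (Q + real CARD('d) * (real N * h)) + C * Q * (eps + q4 / eps ^ 3)) / lam"
    using We c by (intro divide_right_mono) auto
  finally have P: "prob ?G \<le> \<dots>" .
  have "{\<omega>\<in>E 0. \<exists>k\<le>N. \<omega> \<in> E k \<and> (k < N \<longrightarrow> \<omega> \<notin> E (Suc k)) \<and> lam \<le> V k \<omega>} \<subseteq> ?G"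
  proof
    fix \<omega> assume "\<omega> \<in> {\<omega>\<in>E 0. \<exists>k\<le>N. \<omega> \<in> E k \<and> (k < N \<longrightarrow> \<omega> \<notin> E (Suc k)) \<and> lam \<le> V k \<omega>}"
    then obtain k where k: "\<omega> \<in> E 0" "k \<le> N" "\<omega> \<in> E k" "k < N \<Longrightarrow> \<omega> \<notin> E (Suc k)" "lam \<le> V k \<omega>"
      by blast
    have \<omega>: "\<omega> \<in> space M" using Esp k by blast
    show "\<omega> \<in> ?G" using ZW[OF \<omega>] Zk[OF k(2-4)] k V(2)[OF k(1)] \<omega> by force
  qed
  then show ?thesis using Gm P by blast
qed


text \<open>A continuous path stays in a closed set as soon as it does so at a countable dense set
  of times, which turns the uncountable condition into a countable intersection.\<close>

lemma path_set_measurable: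
  fixes Z :: "real \<Rightarrow> 'w \<Rightarrow> 'b::metric_space"
  assumes t: "0 \<le> t" and \<Omega>: "\<Omega>0 \<in> F t" and C: "closed C"
    and Z: "\<And>u. u \<in> {s..t} \<Longrightarrow> Z u \<in> borel_measurable (Ft t)"
    and cont: "\<And>\<omega>. \<omega> \<in> \<Omega>0 \<Longrightarrow> continuous_on {s..t} (\<lambda>u. Z u \<omega>)"
  shows "{\<omega>\<in>\<Omega>0. \<forall>u\<in>{s..t}. Z u \<omega> \<in> C} \<in> F t"
proof -
  obtain T where T: "countable T" "T \<subseteq> {s..t}" "{s..t} \<subseteq> closure T"
    using separable[of "{s..t}"] by blast
  have "{\<omega>\<in>\<Omega>0. \<forall>u\<in>{s..t}. Z u \<omega> \<in> C} = {\<omega>\<in>\<Omega>0. \<forall>u\<in>T. Z u \<omega> \<in> C}"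
  proof (intro Collect_cong conj_cong refl iffI ballI)
    fix \<omega> u assume \<omega>: "\<omega> \<in> \<Omega>0" and a: "\<forall>u\<in>T. Z u \<omega> \<in> C" and u: "u \<in> {s..t}"
    have "closed {u \<in> {s..t}. Z u \<omega> \<in> C}"
      using continuous_closed_preimage[OF cont[OF \<omega>] _ C] by (simp add: vimage_def Int_def)
    moreover have "T \<subseteq> {u \<in> {s..t}. Z u \<omega> \<in> C}" using a T by auto
    ultimately have "closure T \<subseteq> {u \<in> {s..t}. Z u \<omega> \<in> C}" by (rule closure_minimal[rotated])
    then show "Z u \<omega> \<in> C" using u T by auto
  qed (use T in auto)
  also have "\<dots> = \<Omega>0 \<inter> {\<omega>\<in>space (Ft t). \<forall>u\<in>T. Z u \<omega> \<in> C}"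
    using sets.sets_into_space[of \<Omega>0 "Ft t"] \<Omega> t by (auto simp: sets_Ft)
  also have "\<dots> \<in> sets (Ft t)"
  proof (rule sets.Int, goal_cases)
    case 2
    have "{\<omega> \<in> space (Ft t). Z u \<omega> \<in> C} \<in> sets (Ft t)" if "u \<in> T" for u
      using measurable_sets[OF Z borel_closed[OF C], of u] that T(2)
      by (auto simp: vimage_def Int_def conj_commute)
    then show ?case using T(1) by (rule sets.sets_Collect_countable_All')
  next
    case 1
    show "\<Omega>0 \<in> sets (Ft t)" using \<Omega> t by (simp add: sets_Ft)
  qed
  finally show ?thesis using t by (simp add: sets_Ft)
qed

text \<open>Hitting sets are not known to be measurable, so they are handled through measurable
  covers; intersecting covers of probability at most 1 / (n + 1) yields a null set around
  \<open>A\<close>.\<close>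

lemma AE_not_in_if_small_cover:
  assumes "\<And>e. 0 < e \<Longrightarrow> \<exists>G\<in>events. A \<subseteq> G \<and> prob G \<le> e"
  shows "AE \<omega> in M. \<omega> \<notin> A"
proof -
  have "\<exists>G\<in>events. A \<subseteq> G \<and> prob G \<le> 1 / real (Suc n)" for n by (rule assms) simp
  then obtain G where G: "\<And>n. G n \<in> events" "\<And>n. A \<subseteq> G n" "\<And>n. prob (G n) \<le> 1 / real (Suc n)"
    by metis
  have I: "(\<Inter>n. G n) \<in> events" using G by auto
  have "prob (\<Inter>n. G n) \<le> 1 / real (Suc n)" for n
    using finite_measure_mono[of "\<Inter>n. G n" "G n"] G by (meson INT_lower UNIV_I order_trans)
  then have "prob (\<Inter>n. G n) \<le> 0"
    using LIMSEQ_le_const[OF LIMSEQ_inverse_real_of_nat] by (auto simp: inverse_eq_divide)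
  then have "prob (\<Inter>n. G n) = 0" using measure_nonneg[of M "\<Inter>n. G n"] by linarith
  then have "(\<Inter>n. G n) \<in> null_sets M" using I by (simp add: null_sets_def emeasure_eq_measure)
  then show ?thesis by (rule AE_I') (use G(2) in auto)
qed

end

section \<open>Non-attainability from a Lyapunov function\<close>

lemma antitone_of_nonpos_deriv:
  fixes w w' :: "real \<Rightarrow> real"
  assumes "\<And>r. 0 < r \<Longrightarrow> (w has_real_derivative w' r) (at r)" "\<And>r. 0 < r \<Longrightarrow> w' r \<le> 0"
    and "0 < x" "x \<le> y"
  shows "w y \<le> w x"
proof (rule DERIV_nonpos_imp_nonincreasing[OF assms(4)])
  fix z assume "x \<le> z"
  then show "\<exists>y. (w has_real_derivative y) (at z) \<and> y \<le> 0"
    using assms(1-3) by (intro exI[of _ "w' z"]) auto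
qed

lemma uniform_modulus:
  fixes f :: "'a::metric_space \<Rightarrow> 'b::real_normed_vector"
  assumes "compact K" "continuous_on K f" "0 < eps"
  obtains \<eta> where "0 < \<eta>" "\<And>x y. x \<in> K \<Longrightarrow> y \<in> K \<Longrightarrow> dist x y \<le> \<eta> \<Longrightarrow> norm (f x - f y) \<le> eps"
proof -
  obtain d where d: "d > 0" "\<forall>x\<in>K. \<forall>y\<in>K. dist y x < d \<longrightarrow> dist (f y) (f x) < eps"
    using compact_uniformly_continuous[OF assms(2,1)] assms(3) unfolding uniformly_continuous_on_def by blast
  show ?thesis
  proof (rule that[of "d / 2"])
    fix x y assume "x \<in> K" "y \<in> K" "dist x y \<le> d / 2"
    then show "norm (f x - f y) \<le> eps" using d by (fastforce simp: dist_norm[symmetric])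
  qed (use d in auto)
qed

lemma norm_bound_on_compact:
  fixes f :: "'a::topological_space \<Rightarrow> 'b::real_normed_vector"
  assumes "compact K" "continuous_on K f"
  obtains c where "0 \<le> c" "\<And>x. x \<in> K \<Longrightarrow> norm (f x) \<le> c"
proof -
  have "bounded (f ` K)" by (intro compact_imp_bounded compact_continuous_image assms)
  then obtain c where "\<And>x. x \<in> K \<Longrightarrow> norm (f x) \<le> c" unfolding bounded_iff by auto
  then show ?thesis using that[of "max 0 c"] by (simp add: le_max_iff_disj)
qed

text \<open>For the function x \<mapsto> w(|Y x|^2), \<open>F1\<close> is the gradient and
  \<open>F0\<close> half the Laplacian. The assumption on \<open>F1\<close> and \<open>F0\<close>
  along a path is the supermartingale condition integrated over a step, with both frozen at its left
  end: \<open>e\<close> bounds their oscillation and the clock \<open>q\<close> measures the price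
  of freezing them.\<close>

locale lyapunov_setup = filtered_bm M F B
  for M :: "'w measure" and F and B :: "real \<Rightarrow> 'w \<Rightarrow> real^'d" +
  fixes X :: "real \<Rightarrow> 'w \<Rightarrow> real^'d" and q :: "real \<Rightarrow> 'w \<Rightarrow> real" and \<Omega>0 :: "'w set"
    and U S :: "(real^'d) set" and o0 :: "real^'d" and w w' w'' :: "real \<Rightarrow> real"
    and Y :: "real^'d \<Rightarrow> real^'d" and F1 :: "real^'d \<Rightarrow> real^'d" and F0 :: "real^'d \<Rightarrow> real"
  assumes Y_def: "Y = (\<lambda>x. proj S (x - o0))"
    and F1_def: "F1 = (\<lambda>x. (2 * w' ((norm (Y x))\<^sup>2)) *\<^sub>R Y x)"
    and F0_def: "F0 = (\<lambda>x. real (card S) * w' ((norm (Y x))\<^sup>2) + 2 * (norm (Y x))\<^sup>2 * w'' ((norm (Y x))\<^sup>2))"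
    and \<Omega>0: "\<Omega>0 \<in> F 0"
    and X: "\<And>t. 0 \<le> t \<Longrightarrow> X t \<in> borel_measurable (Ft t)"
    and q: "\<And>t. 0 \<le> t \<Longrightarrow> q t \<in> borel_measurable (Ft t)"
    and X_cont: "\<And>\<omega>. \<omega> \<in> \<Omega>0 \<Longrightarrow> continuous_on {0..} (\<lambda>t. X t \<omega>)"
    and q_incr: "\<And>\<omega> t t'. \<omega> \<in> \<Omega>0 \<Longrightarrow> 0 \<le> t \<Longrightarrow> t \<le> t' \<Longrightarrow>
        norm (X t' \<omega> - X t \<omega> - (B t' \<omega> - B t \<omega>)) \<le> q t' \<omega> - q t \<omega>"
    and U: "closed U" "bounded U" and S: "orthonormal S"
    and w: "\<And>r. 0 < r \<Longrightarrow> (w has_real_derivative w' r) (at r)"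
    and w': "\<And>r. 0 < r \<Longrightarrow> (w' has_real_derivative w'' r) (at r)"
    and w'': "continuous_on {0<..} w''" and w'_nonpos: "\<And>r. 0 < r \<Longrightarrow> w' r \<le> 0"
    and w_lim: "filterlim w at_top (at_right 0)"
    and drift: "\<And>\<omega> t t' e. \<omega> \<in> \<Omega>0 \<Longrightarrow> 0 \<le> t \<Longrightarrow> t \<le> t' \<Longrightarrow> 0 \<le> e \<Longrightarrow>
        (\<And>u. u \<in> {t..t'} \<Longrightarrow> X u \<omega> \<in> U \<and> Y (X u \<omega>) \<noteq> 0 \<and> norm (F1 (X t \<omega>) - F1 (X u \<omega>)) \<le> e
           \<and> \<bar>F0 (X t \<omega>) - F0 (X u \<omega>)\<bar> \<le> e) \<Longrightarrow>
        F1 (X t \<omega>) \<bullet> (X t' \<omega> - X t \<omega> - (B t' \<omega> - B t \<omega>)) + F0 (X t \<omega>) * (t' - t) \<le> e * (q t' \<omega> - q t \<omega>)"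
begin

lemma continuous_Y: "continuous_on A Y"
  unfolding Y_def proj_def by (intro continuous_intros)

lemma norm_Y_diff: "norm (Y x - Y y) \<le> norm (x - y)"
  using norm_proj_le[OF S, of "x - y"] by (simp add: Y_def proj_diff)

text \<open>A path that starts with |Y| \<ge> r0 and reaches Y = 0 must first visit the region where
  the shifted Lyapunov function is at least \<open>lam\<close>, while it starts from at most
  \<open>v0\<close>. The 1 in the bound pays for all discretisation errors.\<close>

lemma one_scale_cover:
  assumes s: "0 \<le> s" and T: "0 < T" and \<delta>: "0 < \<delta>" "\<delta> \<le> r0"
    and Q: "0 \<le> Q" and c1: "0 < c1" "\<And>x. x \<in> U \<Longrightarrow> norm (Y x) \<le> c1" and v0: "0 \<le> v0" "w (r0\<^sup>2) - w (c1\<^sup>2) \<le> v0"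
    and lam: "0 < lam" "\<And>r. 0 < r \<Longrightarrow> r \<le> 4 * \<delta>\<^sup>2 \<Longrightarrow> lam \<le> w r - w (c1\<^sup>2)"
  defines "A \<equiv> {\<omega>\<in>\<Omega>0. r0 \<le> norm (Y (X s \<omega>)) \<and>
      (\<exists>t\<in>{s<..s + T}. (\<forall>u\<in>{s..t}. X u \<omega> \<in> U) \<and> Y (X t \<omega>) = 0 \<and> q t \<omega> - q s \<omega> \<le> Q)}"
  shows "\<exists>G\<in>events. A \<subseteq> G \<and> prob G \<le> (v0 + 1) / lam"
proof -
  \<comment> \<open>The part of \<open>U\<close> off the singularity: \<open>w'\<close> and
    \<open>w''\<close> at |Y|^2, hence \<open>F1\<close> and \<open>F0\<close>, are continuous and
    uniformly bounded there.\<close>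
  define K where "K = {x\<in>U. \<delta> \<le> norm (Y x)}"
  have Kclosed: "closed K"
  proof -
    have "K = U \<inter> (\<lambda>x. norm (Y x)) -` {\<delta>..}" by (auto simp: K_def)
    then show ?thesis using U(1) by (auto intro!: closed_Int closed_vimage continuous_intros continuous_Y)
  qed
  have Kc: "compact K" using Kclosed U(2) bounded_subset[of U K] by (auto simp: compact_eq_bounded_closed K_def)
  have c1K: "norm (Y x) \<le> c1" "\<delta> \<le> norm (Y x)" "Y x \<noteq> 0" "x \<in> U" if "x \<in> K" for x
    using that c1 \<delta> by (auto simp: K_def)
  have R: "(norm (Y x))\<^sup>2 \<in> {\<delta>\<^sup>2..c1\<^sup>2}" if "x \<in> K" for x
    using c1K[OF that] \<delta> by (auto intro!: power_mono)
  have \<delta>2: "0 < \<delta>\<^sup>2" using \<delta> by simp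
  have w'c: "continuous_on {\<delta>\<^sup>2..c1\<^sup>2} w'"
    by (intro DERIV_continuous_on[of _ _ w''] DERIV_subset[OF w']) (use less_le_trans[OF \<delta>2] in auto)
  have w''c: "continuous_on {\<delta>\<^sup>2..c1\<^sup>2} w''"
    by (rule continuous_on_subset[OF w'']) (use less_le_trans[OF \<delta>2] in auto)
  have Rc: "continuous_on K (\<lambda>x. (norm (Y x))\<^sup>2)" by (intro continuous_intros continuous_Y)
  have w'K: "continuous_on K (\<lambda>x. w' ((norm (Y x))\<^sup>2))" and w''K: "continuous_on K (\<lambda>x. w'' ((norm (Y x))\<^sup>2))"
    by (rule continuous_on_compose2[OF w'c Rc] continuous_on_compose2[OF w''c Rc], use R in blast)+
  have F1c: "continuous_on K F1" and F0c: "continuous_on K F0"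
    unfolding F1_def F0_def by (intro continuous_intros w'K w''K continuous_Y)+
  obtain c2a where c2a: "0 \<le> c2a" "\<And>r. r \<in> {\<delta>\<^sup>2..c1\<^sup>2} \<Longrightarrow> norm (w' r) \<le> c2a"
    using norm_bound_on_compact[OF _ w'c] by auto
  obtain c2b where c2b: "0 \<le> c2b" "\<And>r. r \<in> {\<delta>\<^sup>2..c1\<^sup>2} \<Longrightarrow> norm (w'' r) \<le> c2b"
    using norm_bound_on_compact[OF _ w''c] by auto
  define c2 where "c2 = max c2a c2b"
  have c2: "0 \<le> c2" "\<And>r. r \<in> {\<delta>\<^sup>2..c1\<^sup>2} \<Longrightarrow> \<bar>w' r\<bar> \<le> c2 \<and> \<bar>w'' r\<bar> \<le> c2"
    using c2a c2b unfolding c2_def by (force simp: le_max_iff_disj)+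
  define sc where "sc = step_const c1 c2"
  have sc: "0 \<le> sc" unfolding sc_def step_const_def using c1 c2 by simp
  \<comment> \<open>The factor 2 accounts for the coefficient eps + eps of |b|^2, the 1 for the
    error eps * dq of the drift inequality.\<close>
  define C where "C = 2 * sc + 1"
  define cc where "cc = c2 * (2 * c1 + 1 + 2 * c1\<^sup>2 + real (card S))"
  have cc: "0 \<le> cc" unfolding cc_def using c1 c2 by simp
  \<comment> \<open>The coefficient of \<open>eps\<close> in the bound that remains in the limit of
    vanishing mesh; \<open>eps\<close> is then chosen to make this contribution at most 1 /
    2.\<close>
  define cE where "cE = 2 * cc + C * (Q + real CARD('d) * T) + C * Q"
  have C0: "0 \<le> C" using sc by (simp add: C_def)
  have cE: "0 \<le> cE" unfolding cE_def using cc C0 Q T by simp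
  define eps where "eps = min 1 (1 / (2 * (cE + 1)))"
  have eps: "0 < eps" "eps \<le> 1" "cE * eps \<le> 1 / 2"
  proof -
    show "0 < eps" "eps \<le> 1" using cE by (auto simp: eps_def)
    have "cE * eps \<le> cE * (1 / (2 * (cE + 1)))" using cE by (intro mult_left_mono) (auto simp: eps_def)
    also have "\<dots> \<le> 1 / 2" using cE by (simp add: field_simps)
    finally show "cE * eps \<le> 1 / 2" .
  qed
  obtain \<eta>1 where \<eta>1: "0 < \<eta>1" "\<And>x y. x \<in> K \<Longrightarrow> y \<in> K \<Longrightarrow> dist x y \<le> \<eta>1 \<Longrightarrow> norm (F1 x - F1 y) \<le> eps"
    using uniform_modulus[OF Kc F1c eps(1)] by blast
  obtain \<eta>2 where \<eta>2: "0 < \<eta>2" "\<And>x y. x \<in> K \<Longrightarrow> y \<in> K \<Longrightarrow> dist x y \<le> \<eta>2 \<Longrightarrow> norm (F0 x - F0 y) \<le> eps"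
    using uniform_modulus[OF Kc F0c eps(1)] by blast
  obtain \<eta>3 where \<eta>3: "0 < \<eta>3" "\<And>x y. x \<in> {\<delta>\<^sup>2..c1\<^sup>2} \<Longrightarrow> y \<in> {\<delta>\<^sup>2..c1\<^sup>2} \<Longrightarrow> dist x y \<le> \<eta>3 \<Longrightarrow> norm (w'' x - w'' y) \<le> eps"
    using uniform_modulus[OF compact_Icc w''c eps(1)] by blast
  obtain \<eta>4 where \<eta>4: "0 < \<eta>4" "\<And>x y. x \<in> K \<Longrightarrow> y \<in> K \<Longrightarrow> dist x y \<le> \<eta>4 \<Longrightarrow> norm ((norm (Y x))\<^sup>2 - (norm (Y y))\<^sup>2) \<le> \<eta>3"
    using uniform_modulus[OF Kc Rc \<eta>3(1)] by blast
  \<comment> \<open>The largest oscillation tolerated in one step: small enough for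
    \<open>F1\<close>, \<open>F0\<close> and \<open>w''\<close> to vary by at most
    \<open>eps\<close>, and at most \<open>\<delta>\<close> so that a step from a point with |Y| > 2
    \<open>\<delta>\<close> cannot enter |Y| < \<open>\<delta>\<close>.\<close>
  define \<eta> where "\<eta> = Min {\<eta>1, \<eta>2, \<eta>4, eps, \<delta>}"
  have \<eta>: "0 < \<eta>" "\<eta> \<le> \<eta>1" "\<eta> \<le> \<eta>2" "\<eta> \<le> \<eta>4" "\<eta> \<le> eps" "\<eta> \<le> \<delta>" "\<eta> \<le> 1"
    using \<eta>1 \<eta>2 \<eta>4 eps \<delta> by (auto simp: \<eta>_def min_le_iff_disj)
  \<comment> \<open>\<open>w\<close> is antitone, so subtracting its value at c1^2 makes
    \<open>V\<close> nonnegative on \<open>K\<close>.\<close>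
  define V where "V = (\<lambda>x. w ((norm (Y x))\<^sup>2) - w (c1\<^sup>2))"
  define t where "t = (\<lambda>N k. s + real k * (T / real N))"
  \<comment> \<open>Survival up to grid time \<open>k\<close>: the path is in \<open>K\<close> at
    all times so far and not only at grid times, the clock has used at most \<open>Q\<close>, and
    every completed step has small oscillation.\<close>
  define E where "E = (\<lambda>N k. {\<omega>\<in>\<Omega>0. r0 \<le> norm (Y (X s \<omega>)) \<and> (\<forall>u\<in>{s..t N k}. X u \<omega> \<in> K)
      \<and> q (t N k) \<omega> - q s \<omega> \<le> Q \<and> (\<forall>l<k. \<forall>u\<in>{t N l..t N (Suc l)}. norm (X u \<omega> - X (t N l) \<omega>) \<le> \<eta>)})"
  define h where "h = (\<lambda>N. T / real N)"
  define q4 where "q4 = (\<lambda>N. 3 * real CARD('d) ^ 2 * (real N * h N) * h N)"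
  define bnd where "bnd = (\<lambda>N. (v0 + cc * (2 * eps + h N + 2 * q4 N / eps ^ 3) + C * eps * (Q + real CARD('d) * (real N * h N))
       + C * Q * (eps + q4 N / eps ^ 3)) / lam)"
  have tmono: "t N j \<le> t N k" if "j \<le> k" for N j k
    unfolding t_def using that T by (auto intro!: mult_right_mono divide_right_mono)
  have t0: "0 \<le> t N k" "s \<le> t N k" "t N 0 = s" for N k
    using s T by (auto simp: t_def)
  have \<Omega>0t: "\<Omega>0 \<in> F u" if "0 \<le> u" for u using \<Omega>0 filtration_mono[of 0 u] that by auto
  have Xm: "X u \<in> borel_measurable (Ft u')" if "0 \<le> u" "u \<le> u'" for u u'
    using measurable_Ft_mono[OF that X] that by simp
  have qm: "q u \<in> borel_measurable (Ft u')" if "0 \<le> u" "u \<le> u'" for u u'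
    using measurable_Ft_mono[OF that q] that by simp
  have Ym: "(\<lambda>\<omega>. Y (X u \<omega>)) \<in> borel_measurable (Ft u')" if "0 \<le> u" "u \<le> u'" for u u'
    by (rule measurable_compose[OF Xm[OF that]]) (auto intro: borel_measurable_continuous_onI continuous_Y)
  have Em: "E N k \<in> F (t N k)" for N k
  proof -
    let ?F = "Ft (t N k)"
    have sF: "sets ?F = F (t N k)" using t0 by (simp add: sets_Ft)
    have 1: "{\<omega>\<in>\<Omega>0. \<forall>u\<in>{s..t N k}. X u \<omega> \<in> K} \<in> sets ?F" unfolding sF
      by (rule path_set_measurable[OF t0(1) \<Omega>0t[OF t0(1)] Kclosed])
        (use s in \<open>auto intro!: Xm continuous_on_subset[OF X_cont]\<close>)
    have 2: "{\<omega>\<in>\<Omega>0. \<forall>u\<in>{t N l..t N (Suc l)}. norm (X u \<omega> - X (t N l) \<omega>) \<le> \<eta>} \<in> sets ?F" if "l < k" for l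
    proof -
      have le: "t N (Suc l) \<le> t N k" using that by (intro tmono) auto
      have "{\<omega>\<in>\<Omega>0. \<forall>u\<in>{t N l..t N (Suc l)}. X u \<omega> - X (t N l) \<omega> \<in> cball 0 \<eta>} \<in> F (t N (Suc l))"
        by (rule path_set_measurable[OF t0(1) \<Omega>0t[OF t0(1)] closed_cball])
          (use t0(1)[of N l] in \<open>auto intro!: borel_measurable_diff Xm continuous_intros continuous_on_subset[OF X_cont] tmono\<close>)
      then show ?thesis using filtration_mono[OF t0(1) le] unfolding sF
        by (auto simp: dist_norm norm_minus_commute[of "X (t N l) _"])
    qed
    have 3: "{\<omega>\<in>space ?F. r0 \<le> norm (Y (X s \<omega>)) \<and> q (t N k) \<omega> - q s \<omega> \<le> Q} \<in> sets ?F"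
      using Ym[OF s t0(2)[of N k]] qm[OF s t0(2)[of N k]] qm[OF t0(1) order_refl, of N k] by measurable
    have 4: "(\<Inter>l\<in>{..<k}. {\<omega>\<in>\<Omega>0. \<forall>u\<in>{t N l..t N (Suc l)}. norm (X u \<omega> - X (t N l) \<omega>) \<le> \<eta>}) \<inter> \<Omega>0 \<in> sets ?F"
    proof (cases "k = 0")
      case True then show ?thesis using \<Omega>0t[OF t0(1)] sF by simp
    next
      case False
      then show ?thesis using \<Omega>0t[OF t0(1)] sF 2 by (intro sets.Int sets.finite_INT) auto
    qed
    have sp: "\<Omega>0 \<subseteq> space M" using \<Omega>0t[of 0] filtration_sub[of 0] sets.sets_into_space by blast
    have "E N k = {\<omega>\<in>\<Omega>0. \<forall>u\<in>{s..t N k}. X u \<omega> \<in> K} \<inter>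
      ({\<omega>\<in>space ?F. r0 \<le> norm (Y (X s \<omega>)) \<and> q (t N k) \<omega> - q s \<omega> \<le> Q} \<inter>
      ((\<Inter>l\<in>{..<k}. {\<omega>\<in>\<Omega>0. \<forall>u\<in>{t N l..t N (Suc l)}. norm (X u \<omega> - X (t N l) \<omega>) \<le> \<eta>}) \<inter> \<Omega>0))"
      unfolding E_def using sp by auto
    also have "\<dots> \<in> sets ?F" by (rule sets.Int[OF 1 sets.Int[OF 3 4]])
    finally show ?thesis by (simp add: sF)
  qed
  have q_mono: "q u \<omega> \<le> q u' \<omega>" if "\<omega> \<in> \<Omega>0" "0 \<le> u" "u \<le> u'" for \<omega> u u'
    using order_trans[OF norm_ge_zero q_incr[OF that]] by simp
  have Eanti: "E N (Suc k) \<subseteq> E N k" for N k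
  proof
    fix \<omega> assume \<omega>: "\<omega> \<in> E N (Suc k)"
    then have "q (t N k) \<omega> \<le> q (t N (Suc k)) \<omega>"
      by (intro q_mono t0 tmono) (auto simp: E_def)
    then show "\<omega> \<in> E N k" using \<omega> tmono[of k "Suc k" N] by (auto simp: E_def)
  qed
  have EK: "X (t N k) \<omega> \<in> K" "\<omega> \<in> \<Omega>0" "\<And>u. u \<in> {s..t N k} \<Longrightarrow> X u \<omega> \<in> K" if "\<omega> \<in> E N k" for \<omega> N k
    using that t0 by (auto simp: E_def)
  have wanti: "w y \<le> w x" if "0 < x" "x \<le> y" for x y
    using antitone_of_nonpos_deriv[OF w w'_nonpos that] .
  have cover: "\<exists>G\<in>events. {\<omega>\<in>E N 0. \<exists>k\<le>N. \<omega> \<in> E N k \<and> (k < N \<longrightarrow> \<omega> \<notin> E N (Suc k)) \<and> lam \<le> V (X (t N k) \<omega>)} \<subseteq> G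
     \<and> prob G \<le> bnd N" if N: "0 < N" for N
  proof -
    have hN: "0 < h N" "t N k = s + real k * h N" for k using T N by (auto simp: h_def t_def)
    \<comment> \<open>\<open>w'\<close> and \<open>w''\<close> are controlled only on a compact
      interval. Clipping the argument gives Borel functions on the whole line, and on
      \<open>K\<close> the clip changes nothing.\<close>
    let ?clip = "\<lambda>r. max (\<delta>\<^sup>2) (min (c1\<^sup>2) r)"
    have cm: "(\<lambda>r. g (?clip r)) \<in> borel_measurable borel" if "continuous_on {\<delta>\<^sup>2..c1\<^sup>2} g" for g :: "real \<Rightarrow> real"
    proof (cases "\<delta>\<^sup>2 \<le> c1\<^sup>2")
      case True
      then show ?thesis
        by (intro borel_measurable_continuous_onI continuous_on_compose2[OF that] continuous_intros) auto
    next
      case False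
      then have "(\<lambda>r. g (?clip r)) = (\<lambda>_. g (\<delta>\<^sup>2))" by (intro ext arg_cong[of _ _ g]) auto
      then show ?thesis by simp
    qed
    have Rm: "(\<lambda>\<omega>. (norm (Y (X (t N k) \<omega>)))\<^sup>2) \<in> borel_measurable (Ft (t N k))" for k
      using Ym[OF t0(1) order_refl, of N k] by measurable
    have clip: "?clip ((norm (Y x))\<^sup>2) = (norm (Y x))\<^sup>2" if "x \<in> K" for x
      using R[OF that] by auto
    show ?thesis
      unfolding bnd_def q4_def cc_def
    proof (rule discrete_supermartingale[where s=s and h="h N" and eps=eps and S=S and ?c1.0=c1 and ?c2.0=c2 and C=C
          and Q=Q and E="E N" and V="\<lambda>k \<omega>. V (X (t N k) \<omega>)" and Y="\<lambda>k \<omega>. Y (X (t N k) \<omega>)"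
          and u="\<lambda>k \<omega>. w' (?clip ((norm (Y (X (t N k) \<omega>)))\<^sup>2))"
          and v="\<lambda>k \<omega>. w'' (?clip ((norm (Y (X (t N k) \<omega>)))\<^sup>2))"
          and dq="\<lambda>k \<omega>. q (t N (Suc k)) \<omega> - q (t N k) \<omega>", folded hN(2)])
      show "E N k \<in> F (t N k)" for k by (rule Em)
      show "E N (Suc k) \<subseteq> E N k" for k by (rule Eanti)
      show "(\<lambda>\<omega>. Y (X (t N k) \<omega>)) \<in> borel_measurable (Ft (t N k))" for k by (rule Ym) (use t0 in auto)
      show "norm (Y (X (t N k) \<omega>)) \<le> c1" if "\<omega> \<in> E N k" for k \<omega> using c1K EK[OF that] by auto
      show "(\<lambda>\<omega>. w' (?clip ((norm (Y (X (t N k) \<omega>)))\<^sup>2))) \<in> borel_measurable (Ft (t N k))" for k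
        by (rule measurable_compose[OF Rm cm[OF w'c]])
      show "(\<lambda>\<omega>. w'' (?clip ((norm (Y (X (t N k) \<omega>)))\<^sup>2))) \<in> borel_measurable (Ft (t N k))" for k
        by (rule measurable_compose[OF Rm cm[OF w''c]])
      show "\<bar>w' (?clip ((norm (Y (X (t N k) \<omega>)))\<^sup>2))\<bar> \<le> c2" "\<bar>w'' (?clip ((norm (Y (X (t N k) \<omega>)))\<^sup>2))\<bar> \<le> c2"
        if "\<omega> \<in> E N k" for k \<omega> using clip[OF EK(1)[OF that]] c2(2)[OF R[OF EK(1)[OF that]]] by auto
      show "0 \<le> q (t N (Suc k)) \<omega> - q (t N k) \<omega>" if "\<omega> \<in> E N (Suc k)" for k \<omega>
        using q_mono[OF EK(2)[OF that] t0(1) tmono[of k "Suc k"]] by simp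
      show "(\<Sum>k<N. indicator (E N (Suc k)) \<omega> * (q (t N (Suc k)) \<omega> - q (t N k) \<omega>)) \<le> Q" for \<omega>
      proof (cases "\<omega> \<in> E N 0")
        case True
        then obtain k where k: "k \<le> N" "\<omega> \<in> E N k" "k < N \<Longrightarrow> \<omega> \<notin> E N (Suc k)"
          using first_exit[of \<omega> "E N" N] by blast
        show ?thesis using sum_until_exit[OF Eanti k, of "\<lambda>k. q (t N k) \<omega>"] k(2) t0(3) by (simp add: E_def)
      next
        case False
        have "E N (Suc k) \<subseteq> E N 0" for k using lift_Suc_antimono_le[of "E N" 0 "Suc k"] Eanti by blast
        then have "(\<Sum>k<N. indicator (E N (Suc k)) \<omega> * (q (t N (Suc k)) \<omega> - q (t N k) \<omega>)) = 0"
          using False by (intro sum.neutral) (auto simp: indicator_def)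
        then show ?thesis using Q by simp
      qed
      show "0 \<le> V (X (t N k) \<omega>)" if "\<omega> \<in> E N k" for k \<omega>
        using R[OF EK(1)[OF that]] c1K(3)[OF EK(1)[OF that]] wanti[of "(norm (Y (X (t N k) \<omega>)))\<^sup>2" "c1\<^sup>2"] by (auto simp: V_def)
      show "V (X (t N 0) \<omega>) \<le> v0" if "\<omega> \<in> E N 0" for \<omega>
      proof -
        have "r0 \<le> norm (Y (X s \<omega>))" using that by (simp add: E_def)
        then have "r0\<^sup>2 \<le> (norm (Y (X s \<omega>)))\<^sup>2" using \<delta> by (intro power_mono) auto
        then have "w ((norm (Y (X s \<omega>)))\<^sup>2) \<le> w (r0\<^sup>2)" using \<delta> by (intro wanti) auto
        then show ?thesis using v0 by (simp add: V_def t0(3))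
      qed
      fix k \<omega> assume "k < N" and \<omega>: "\<omega> \<in> E N (Suc k)"
      let ?x = "X (t N k) \<omega>" and ?x' = "X (t N (Suc k)) \<omega>" and ?b = "B (t N (Suc k)) \<omega> - B (t N k) \<omega>"
      let ?dq = "q (t N (Suc k)) \<omega> - q (t N k) \<omega>"
      let ?r = "(norm (Y ?x))\<^sup>2" and ?r' = "(norm (Y ?x'))\<^sup>2"
      have \<omega>k: "\<omega> \<in> E N k" using Eanti \<omega> by blast
      note K1 = EK[OF \<omega>k] and K2 = EK[OF \<omega>]
      define \<alpha> where "\<alpha> = ?x' - ?x - ?b"
      have ba: "?b + \<alpha> = ?x' - ?x" by (simp add: \<alpha>_def)
      have tle: "t N k \<le> t N (Suc k)" by (rule tmono) simp
      have osc: "norm (X u \<omega> - ?x) \<le> \<eta>" if "u \<in> {t N k..t N (Suc k)}" for u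
        using \<omega> that by (auto simp: E_def)
      have aq: "norm \<alpha> \<le> ?dq" unfolding \<alpha>_def by (rule q_incr[OF K1(2) t0(1) tle])
      have seg: "z \<in> {\<delta>\<^sup>2..c1\<^sup>2} \<and> \<bar>z - ?r\<bar> \<le> \<eta>3" if z: "z \<in> closed_segment ?r ?r'" for z
      proof
        show "z \<in> {\<delta>\<^sup>2..c1\<^sup>2}"
          using z closed_segment_subset[OF R[OF K1(1)] R[OF K2(1)]] by (auto simp: convex_real_interval)
        have "dist ?x' ?x \<le> \<eta>4" using osc[of "t N (Suc k)"] tle \<eta> by (simp add: dist_norm)
        then have "\<bar>?r' - ?r\<bar> \<le> \<eta>3" using \<eta>4(2)[OF K2(1) K1(1)] by simp
        then show "\<bar>z - ?r\<bar> \<le> \<eta>3" using z by (auto simp: closed_segment_eq_real_ivl split: if_splits)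
      qed
      have st1: "w ?r' - w ?r \<le> 2 * w' ?r * (Y ?x \<bullet> ?b) + 2 * w' ?r * (Y ?x \<bullet> \<alpha>) + w' ?r * (norm (proj S ?b))\<^sup>2
        + 2 * w'' ?r * (Y ?x \<bullet> ?b)\<^sup>2 + step_const c1 c2 * (norm \<alpha> * (\<eta> + norm ?b) + (\<eta> + eps) * (norm ?b)\<^sup>2)"
      proof (rule one_step_le[OF S _ _ _ \<eta>(7), where y="?x - o0"])
        show "Y ?x = proj S (?x - o0)" by (simp add: Y_def)
        show "norm (Y ?x) \<le> c1" using c1K K1 by auto
        show "norm (?b + \<alpha>) \<le> \<eta>" unfolding ba using osc tle by auto
        show "\<bar>w' ?r\<bar> \<le> c2" "\<bar>w'' ?r\<bar> \<le> c2" using c2(2)[OF R[OF K1(1)]] by auto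
        show "?r' = (norm (proj S (?x - o0 + (?b + \<alpha>))))\<^sup>2" unfolding ba by (simp add: Y_def algebra_simps)
        show "(w has_real_derivative w' z) (at z)" "(w' has_real_derivative w'' z) (at z)"
          if "z \<in> closed_segment ?r ?r'" for z using seg[OF that] less_le_trans[OF \<delta>2, of z] by (auto intro!: w w')
        show "\<bar>w'' z - w'' ?r\<bar> \<le> eps" if "z \<in> closed_segment ?r ?r'" for z
          using seg[OF that] \<eta>3(2)[of z ?r] R[OF K1(1)] by (auto simp: dist_norm)
      qed (use eps in auto)
      have st2: "F1 ?x \<bullet> \<alpha> + F0 ?x * (t N (Suc k) - t N k) \<le> eps * ?dq"
        unfolding \<alpha>_def
      proof (rule drift[OF K1(2) t0(1) tle])
        fix u assume u: "u \<in> {t N k..t N (Suc k)}"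
        have uK: "X u \<omega> \<in> K" using u t0(2)[of N k] by (intro K2) auto
        have d: "dist ?x (X u \<omega>) \<le> \<eta>" using osc[OF u] by (simp add: dist_norm norm_minus_commute)
        show "X u \<omega> \<in> U \<and> Y (X u \<omega>) \<noteq> 0 \<and> norm (F1 ?x - F1 (X u \<omega>)) \<le> eps \<and> \<bar>F0 ?x - F0 (X u \<omega>)\<bar> \<le> eps"
          using c1K[OF uK] \<eta>1(2)[OF K1(1) uK] \<eta>2(2)[OF K1(1) uK] d \<eta> by auto
      qed (use eps in auto)
      have hh: "t N (Suc k) - t N k = h N" by (simp add: hN algebra_simps)
      \<comment> \<open>From here on \<open>\<alpha>\<close> is replaced by its bound, the clock
        increment, and \<open>\<eta>\<close> by \<open>eps\<close>.\<close>
      have st3: "step_const c1 c2 * (norm \<alpha> * (\<eta> + norm ?b) + (\<eta> + eps) * (norm ?b)\<^sup>2)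
         \<le> sc * (?dq * (eps + norm ?b) + (eps + eps) * (norm ?b)\<^sup>2)"
        unfolding sc_def[symmetric] using aq \<eta> eps sc order_trans[OF norm_ge_zero aq]
        by (intro mult_left_mono add_mono mult_mono mult_right_mono) auto
      have st4: "sc * (?dq * (eps + norm ?b) + (eps + eps) * (norm ?b)\<^sup>2) + eps * ?dq
         \<le> C * (eps * (?dq + (norm ?b)\<^sup>2) + ?dq * norm ?b)"
      proof -
        have dq0: "0 \<le> ?dq" using order_trans[OF norm_ge_zero aq] .
        then have "0 \<le> sc * eps * ?dq" "0 \<le> sc * (?dq * norm ?b)" "0 \<le> eps * (norm ?b)\<^sup>2" "0 \<le> ?dq * norm ?b"
          using sc eps by auto
        then show ?thesis unfolding C_def by (simp add: algebra_simps)
      qed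
      have F1a: "F1 ?x \<bullet> \<alpha> = 2 * w' ?r * (Y ?x \<bullet> \<alpha>)" by (simp add: F1_def)
      have comp: "compensated S (h N) (w' (?clip ?r)) (w'' (?clip ?r)) (Y ?x) ?b
          = 2 * w' ?r * (Y ?x \<bullet> ?b) + w' ?r * (norm (proj S ?b))\<^sup>2 + 2 * w'' ?r * (Y ?x \<bullet> ?b)\<^sup>2 - F0 ?x * h N"
        unfolding clip[OF K1(1)] compensated_def F0_def by (simp only: algebra_simps)
      have arith: "d \<le> p + pb + y - f + z"
        if "d \<le> p + i + pb + y + z1" "i + f \<le> g" "z1 \<le> z2" "z2 + g \<le> z" for d p i pb y z1 z2 f g z :: real
        using that by linarith
      have "V ?x' - V ?x = w ?r' - w ?r" by (simp add: V_def)
      also have "\<dots> \<le> 2 * w' ?r * (Y ?x \<bullet> ?b) + w' ?r * (norm (proj S ?b))\<^sup>2 + 2 * w'' ?r * (Y ?x \<bullet> ?b)\<^sup>2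
          - F0 ?x * h N + C * (eps * (?dq + (norm ?b)\<^sup>2) + ?dq * norm ?b)"
        by (rule arith[OF st1 st2[unfolded hh F1a] st3 st4])
      finally show "V ?x' - V ?x \<le> compensated S (h N) (w' (?clip ?r)) (w'' (?clip ?r)) (Y ?x) ?b
          + C * (eps * (?dq + (norm ?b)\<^sup>2) + ?dq * norm ?b)"
        unfolding comp .
    qed (use s hN eps S c1 c2 C0 Q v0 lam in auto)
  qed
  define bad where "bad = (\<lambda>N. {\<omega>\<in>E N 0. \<exists>k\<le>N. \<omega> \<in> E N k \<and> (k < N \<longrightarrow> \<omega> \<notin> E N (Suc k)) \<and> lam \<le> V (X (t N k) \<omega>)})"
  have "\<forall>N. \<exists>G. 0 < N \<longrightarrow> G \<in> events \<and> bad N \<subseteq> G \<and> prob G \<le> bnd N"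
    using cover unfolding bad_def by blast
  from choice[OF this] obtain G where G: "\<And>N. 0 < N \<Longrightarrow> G N \<in> events" "\<And>N. 0 < N \<Longrightarrow> prob (G N) \<le> bnd N"
    "\<And>N. 0 < N \<Longrightarrow> bad N \<subseteq> G N"
    by blast
  have h_lim: "h \<longlonglongrightarrow> 0" unfolding h_def by (rule lim_const_over_n)
  \<comment> \<open>Since N * h N = T, the bound is a function \<open>f\<close> of the mesh alone.
    At mesh 0 only v0 + cE * eps remains of its numerator, strictly below v0 + 1, so all fine grids
    satisfy the claimed bound.\<close>
  define d2 where "d2 = 3 * real CARD('d) ^ 2 * T"
  define f where "f = (\<lambda>x. (v0 + cc * (2 * eps + x + 2 * (d2 * x) / eps ^ 3) + C * eps * (Q + real CARD('d) * T)
       + C * Q * (eps + d2 * x / eps ^ 3)) / lam)"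
  have f_lim: "(\<lambda>N. f (h N)) \<longlonglongrightarrow> f 0"
    unfolding f_def using eps lam by (intro tendsto_intros h_lim) auto
  have "f 0 = (v0 + cE * eps) / lam" by (simp add: f_def cE_def algebra_simps)
  with f_lim have lim: "(\<lambda>N. f (h N)) \<longlonglongrightarrow> (v0 + cE * eps) / lam" by simp
  have "bnd \<longlonglongrightarrow> (v0 + cE * eps) / lam"
  proof (rule Lim_transform_eventually[OF lim])
    show "\<forall>\<^sub>F N in sequentially. f (h N) = bnd N"
      using eventually_gt_at_top[of 0] by eventually_elim (simp add: f_def d2_def bnd_def q4_def h_def)
  qed
  moreover have "(v0 + cE * eps) / lam < (v0 + 1) / lam" using eps(3) lam by (intro divide_strict_right_mono) auto
  ultimately have "\<forall>\<^sub>F N in sequentially. bnd N < (v0 + 1) / lam" by (rule order_tendstoD)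
  then obtain N1 where N1: "\<And>N. N1 \<le> N \<Longrightarrow> bnd N < (v0 + 1) / lam" by (auto simp: eventually_sequentially)
  \<comment> \<open>How fine a grid a path needs depends on its modulus of continuity, so no single
    \<open>G N\<close> covers \<open>A\<close>; but each path of \<open>A\<close> lies in all
    \<open>G N\<close> from some \<open>N\<close> on. The sets \<open>L n\<close> increase and each
    has probability within the bound, hence so has their union.\<close>
  define L where "L = (\<lambda>n. \<Inter>N\<in>{n + N1 + 1..}. G N)"
  have Lm: "L n \<in> events" for n unfolding L_def using G(1) by (intro sets.countable_INT') auto
  have Lp: "prob (L n) \<le> (v0 + 1) / lam" for n
  proof -
    have "prob (L n) \<le> prob (G (n + N1 + 1))" unfolding L_def using G(1) by (intro finite_measure_mono) auto
    also have "\<dots> \<le> (v0 + 1) / lam" using G(2)[of "n + N1 + 1"] N1[of "n + N1 + 1"] by auto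
    finally show ?thesis .
  qed
  have "incseq L" unfolding L_def by (intro incseq_SucI INF_superset_mono) auto
  then have "(\<lambda>n. prob (L n)) \<longlonglongrightarrow> prob (\<Union>n. L n)"
    using Lm by (intro finite_Lim_measure_incseq) auto
  then have P: "prob (\<Union>n. L n) \<le> (v0 + 1) / lam" using Lp by (intro LIMSEQ_le_const2) auto
  have "A \<subseteq> (\<Union>n. L n)"
  proof
    fix \<omega> assume "\<omega> \<in> A"
    then obtain \<tau> where \<omega>: "\<omega> \<in> \<Omega>0" "r0 \<le> norm (Y (X s \<omega>))" and \<tau>: "s < \<tau>" "\<tau> \<le> s + T" "\<And>u. u \<in> {s..\<tau>} \<Longrightarrow> X u \<omega> \<in> U"
      "Y (X \<tau> \<omega>) = 0" "q \<tau> \<omega> - q s \<omega> \<le> Q" unfolding A_def by auto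
    have "continuous_on {s..s + T} (\<lambda>u. X u \<omega>)" by (rule continuous_on_subset[OF X_cont[OF \<omega>(1)]]) (use s in auto)
    then obtain \<rho> where \<rho>: "0 < \<rho>" "\<And>u u'. u \<in> {s..s + T} \<Longrightarrow> u' \<in> {s..s + T} \<Longrightarrow> dist u u' \<le> \<rho> \<Longrightarrow> norm (X u \<omega> - X u' \<omega>) \<le> \<eta>"
      using uniform_modulus[OF compact_Icc _ \<eta>(1)] by metis
    have "\<forall>\<^sub>F N in sequentially. h N < \<rho>" by (rule order_tendstoD(2)[OF h_lim \<rho>(1)])
    then obtain N2 where N2: "\<And>N. N2 \<le> N \<Longrightarrow> h N < \<rho>" by (auto simp: eventually_sequentially)
    have "\<omega> \<in> G N" if N: "N2 + 1 \<le> N" for N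
    proof -
      have N0: "0 < N" using N by simp
      have tS: "t N (Suc k) = t N k + h N" for k by (simp add: t_def h_def algebra_simps add_divide_distrib)
      have tN: "t N N = s + T" using N0 by (simp add: t_def)
      have osc: "norm (X u \<omega> - X (t N l) \<omega>) \<le> \<eta>" if "l < N" "u \<in> {t N l..t N (Suc l)}" for l u
      proof (rule \<rho>(2))
        show "u \<in> {s..s + T}" "t N l \<in> {s..s + T}"
          using that t0(2)[of N l] tmono[of "Suc l" N N] tmono[of l N N] tN by auto
        show "dist u (t N l) \<le> \<rho>" using that N2[of N] N unfolding tS by (auto simp: dist_real_def)
      qed
      have E0: "\<omega> \<in> E N 0"
        using \<omega> \<tau>(1) \<tau>(3)[of s] \<delta> Q by (auto simp: E_def t0(3) K_def)
      obtain k where k: "k \<le> N" "\<omega> \<in> E N k" "k < N \<Longrightarrow> \<omega> \<notin> E N (Suc k)"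
        using E0 first_exit[of \<omega> "E N" N] by blast
      have tk\<tau>: "t N k < \<tau>"
      proof (rule ccontr)
        assume "\<not> t N k < \<tau>"
        then have "X \<tau> \<omega> \<in> K" using \<tau>(1) by (intro EK(3)[OF k(2)]) auto
        then show False using c1K(3) \<tau>(4) by blast
      qed
      then have kN: "k < N" using k(1) \<tau>(2) tN by (cases "k = N") auto
      \<comment> \<open>The cause of the exit: before \<tau> the path is in \<open>U\<close>, and
        neither the clock nor the oscillation can be violated, so |Y| must have dropped below
        \<open>\<delta>\<close> during this step, unless \<tau> itself falls into it.\<close>
      have "\<exists>u\<in>{t N k..t N (Suc k)}. norm (Y (X u \<omega>)) < \<delta>"
      proof (cases "\<tau> \<le> t N (Suc k)")
        case True
        then show ?thesis using tk\<tau> \<tau>(4) \<delta> by (intro bexI[of _ \<tau>]) auto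
      next
        case False
        have "q (t N (Suc k)) \<omega> - q s \<omega> \<le> Q"
          using q_mono[OF \<omega>(1) t0(1), of N "Suc k" \<tau>] False \<tau>(5) by auto
        moreover have "\<forall>l<Suc k. \<forall>u\<in>{t N l..t N (Suc l)}. norm (X u \<omega> - X (t N l) \<omega>) \<le> \<eta>"
          using osc kN by auto
        ultimately have "\<not> (\<forall>u\<in>{s..t N (Suc k)}. X u \<omega> \<in> K)"
          using k(3)[OF kN] \<omega> by (auto simp: E_def)
        then obtain u where u: "u \<in> {s..t N (Suc k)}" "X u \<omega> \<notin> K" by blast
        have "t N k \<le> u" using EK(3)[OF k(2), of u] u by force
        moreover have "norm (Y (X u \<omega>)) < \<delta>" using u \<tau>(3)[of u] False by (auto simp: K_def)
        ultimately show ?thesis using u by auto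
      qed
      then obtain u where u: "u \<in> {t N k..t N (Suc k)}" "norm (Y (X u \<omega>)) < \<delta>" by blast
      \<comment> \<open>One step back costs at most \<open>\<eta>\<close> \<le>
        \<open>\<delta>\<close>, so the last surviving grid point has |Y| \<le> 2
        \<open>\<delta>\<close>; this is the origin of the 4 in the assumption on
        \<open>lam\<close>.\<close>
      have "norm (Y (X (t N k) \<omega>)) \<le> norm (Y (X u \<omega>)) + norm (Y (X u \<omega>) - Y (X (t N k) \<omega>))"
        using norm_triangle_sub[of "Y (X (t N k) \<omega>)" "Y (X u \<omega>)"] by (simp add: norm_minus_commute)
      also have "\<dots> \<le> 2 * \<delta>" using u norm_Y_diff[of "X u \<omega>" "X (t N k) \<omega>"] osc[OF kN u(1)] \<eta>(6) by linarith
      finally have "(norm (Y (X (t N k) \<omega>)))\<^sup>2 \<le> (2 * \<delta>)\<^sup>2" by (intro power_mono) auto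
      moreover have "0 < (norm (Y (X (t N k) \<omega>)))\<^sup>2" using c1K(3)[OF EK(1)[OF k(2)]] by simp
      ultimately have "lam \<le> V (X (t N k) \<omega>)"
        unfolding V_def by (intro lam(2)) (auto simp: power_mult_distrib)
      then have "\<omega> \<in> bad N" unfolding bad_def using E0 k by blast
      then show ?thesis using G(3)[OF N0] by blast
    qed
    then have "\<omega> \<in> L N2" unfolding L_def by auto
    then show "\<omega> \<in> (\<Union>n. L n)" by blast
  qed
  then show ?thesis using P Lm by (intro bexI[of _ "\<Union>n. L n"]) auto
qed

text \<open>For fixed starting distance, time horizon and clock budget, the bound (v0 + 1) / lam
  becomes arbitrarily small because \<open>w\<close> explodes at 0 while \<open>v0\<close> does not
  depend on \<open>\<delta>\<close>. A countable union over the three parameters finishes.\<close>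

theorem never_hits:
  assumes s: "0 \<le> s" and start: "AE \<omega> in M. Y (X s \<omega>) \<noteq> 0"
  shows "AE \<omega> in M. \<omega> \<in> \<Omega>0 \<longrightarrow> \<not> (\<exists>t>s. (\<forall>u\<in>{s..t}. X u \<omega> \<in> U) \<and> Y (X t \<omega>) = 0)"
proof -
  obtain c0 where c0: "\<And>x. x \<in> U \<Longrightarrow> norm x \<le> c0" using U(2) unfolding bounded_iff by auto
  define c1 where "c1 = max 1 (c0 + norm o0)"
  have c1: "0 < c1" "norm (Y x) \<le> c1" if "x \<in> U" for x
    unfolding c1_def Y_def using c0[OF that] norm_proj_le[OF S, of "x - o0"] norm_triangle_ineq4[of x o0] by auto
  \<comment> \<open>One index \<open>p\<close> serves three purposes: starting distance at least 1 /
    (p + 1), time and clock budget at most p + 1.\<close>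
  define A where "A = (\<lambda>p::nat. {\<omega>\<in>\<Omega>0. 1 / real (Suc p) \<le> norm (Y (X s \<omega>)) \<and>
      (\<exists>t\<in>{s<..s + real (Suc p)}. (\<forall>u\<in>{s..t}. X u \<omega> \<in> U) \<and> Y (X t \<omega>) = 0 \<and> q t \<omega> - q s \<omega> \<le> real (Suc p))})"
  have "AE \<omega> in M. \<omega> \<notin> A p" for p
  proof (rule AE_not_in_if_small_cover)
    fix e :: real assume e: "0 < e"
    define r0 where "r0 = 1 / real (Suc p)"
    define v0 where "v0 = max 0 (w (r0\<^sup>2) - w (c1\<^sup>2))"
    define lam where "lam = (v0 + 1) / e"
    have v0: "0 \<le> v0" "w (r0\<^sup>2) - w (c1\<^sup>2) \<le> v0" by (auto simp: v0_def)
    have lam: "0 < lam" using v0 e by (simp add: lam_def)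
    have "\<forall>\<^sub>F r in at_right 0. lam + w (c1\<^sup>2) \<le> w r" using w_lim unfolding filterlim_at_top by blast
    then obtain x0 where x0: "0 < x0" "\<And>r. 0 < r \<Longrightarrow> r < x0 \<Longrightarrow> lam + w (c1\<^sup>2) \<le> w r"
      unfolding eventually_at_right_field by auto
    \<comment> \<open>With this choice 4 \<open>\<delta>\<close>^2 \<le> x0 / 4, inside the range
      where \<open>w\<close> exceeds the required level.\<close>
    define \<delta> where "\<delta> = min r0 (sqrt x0 / 4)"
    have \<delta>: "0 < \<delta>" "\<delta> \<le> r0" using x0 by (auto simp: \<delta>_def r0_def)
    have "\<delta>\<^sup>2 \<le> (sqrt x0 / 4)\<^sup>2" using \<delta> by (intro power_mono) (auto simp: \<delta>_def)
    then have \<delta>x: "4 * \<delta>\<^sup>2 < x0" using x0 by (simp add: power_divide)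
    have c1p: "0 < c1" by (simp add: c1_def)
    show "\<exists>G\<in>events. A p \<subseteq> G \<and> prob G \<le> e"
    proof -
      have "\<exists>G\<in>events. A p \<subseteq> G \<and> prob G \<le> (v0 + 1) / lam"
        unfolding A_def r0_def[symmetric]
        by (rule one_scale_cover[OF s _ \<delta> _ c1p c1(2) v0 lam]) (use x0 \<delta>x in force)+
      then show ?thesis using v0 e by (simp add: lam_def)
    qed
  qed
  then have "AE \<omega> in M. \<forall>p. \<omega> \<notin> A p" by (simp add: AE_all_countable)
  then show ?thesis using start
  proof eventually_elim
    case (elim \<omega>)
    show ?case
    proof (intro impI notI, elim exE conjE)
      fix t assume \<omega>: "\<omega> \<in> \<Omega>0" and t: "s < t" "\<forall>u\<in>{s..t}. X u \<omega> \<in> U" "Y (X t \<omega>) = 0"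
      obtain p1 where p1: "t - s < real p1" using reals_Archimedean2 by blast
      obtain p2 where p2: "q t \<omega> - q s \<omega> < real p2" using reals_Archimedean2 by blast
      obtain p3 where p3: "1 / real (Suc p3) < norm (Y (X s \<omega>))"
        using elim(2) reals_Archimedean[of "norm (Y (X s \<omega>))"] by (auto simp: inverse_eq_divide)
      define p where "p = p1 + p2 + p3"
      have "1 / real (Suc p) \<le> 1 / real (Suc p3)" by (simp add: p_def field_simps)
      then have "\<omega> \<in> A p" using \<omega> t p1 p2 p3 by (auto simp: A_def p_def intro!: bexI[of _ t])
      then show False using elim(1) by blast
    qed
  qed
qed

end

section \<open>Lyapunov functions from scale functions\<close>

lemma antiderivative_pos:
  fixes g :: "real \<Rightarrow> real"
  assumes "continuous_on {0<..} g"
  obtains G where "\<And>x. 0 < x \<Longrightarrow> (G has_real_derivative g x) (at x)"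
proof -
  define G where "G = (\<lambda>u. LBINT y=1..u. g y)"
  have "(G has_real_derivative g x) (at x)" if x: "0 < x" for x
  proof -
    define a b where "a = min (1/2) (x/2)" and "b = max 2 (2*x)"
    have ab: "0 < a" "a \<le> 1" "1 \<le> b" "a < x" "x < b" using x by (auto simp: a_def b_def)
    have "continuous_on {a..b} g" by (rule continuous_on_subset[OF assms]) (use ab in auto)
    then have "(G has_vector_derivative g x) (at x within {a..b})"
      using interval_integral_FTC2[of a 1 b g x] ab unfolding G_def one_ereal_def by simp
    moreover have "at x within {a..b} = at x" using ab by (intro at_within_interior) simp
    ultimately show ?thesis by (simp add: has_real_derivative_iff_has_vector_derivative)
  qed
  then show ?thesis by (rule that)
qed

text \<open>Take w(z^2) = -G(z) with G' = exp (2 \<psi> + 2 C z), a scale function for unit noise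
  with drift -(\<psi>' + C). The last identity is G'' = 2 (\<psi>' + C) G' rewritten in the variable
  z^2.\<close>

lemma lyapunov_function:
  fixes \<psi> \<psi>' P :: "real \<Rightarrow> real" and C :: real
  assumes \<psi>: "\<And>x. 0 < x \<Longrightarrow> (\<psi> has_real_derivative \<psi>' x) (at x)" "continuous_on {0<..} \<psi>'"
    and P: "\<And>x. 0 < x \<Longrightarrow> (P has_real_derivative exp (2 * \<psi> x)) (at x)" "filterlim P at_bot (at_right 0)"
    and C: "0 \<le> C"
  obtains w w' w'' :: "real \<Rightarrow> real" where
    "\<And>r. 0 < r \<Longrightarrow> (w has_real_derivative w' r) (at r)"
    "\<And>r. 0 < r \<Longrightarrow> (w' has_real_derivative w'' r) (at r)"
    "continuous_on {0<..} w''" "\<And>r. 0 < r \<Longrightarrow> w' r \<le> 0" "filterlim w at_top (at_right 0)"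
    "\<And>z. 0 < z \<Longrightarrow> w' (z\<^sup>2) * (1 - 2 * z * (\<psi>' z + C)) + 2 * z\<^sup>2 * w'' (z\<^sup>2) = 0"
proof -
  define g where "g = (\<lambda>z. exp (2 * \<psi> z + 2 * C * z))"
  have \<psi>c: "continuous_on {0<..} \<psi>" by (rule DERIV_continuous_on[of _ _ \<psi>']) (auto intro: DERIV_subset[OF \<psi>(1)])
  have gc: "continuous_on {0<..} g" unfolding g_def by (intro continuous_intros \<psi>c)
  have g': "(g has_real_derivative g z * (2 * \<psi>' z + 2 * C)) (at z)" if "0 < z" for z
    unfolding g_def by (auto intro!: derivative_eq_intros \<psi>(1) that)
  obtain G where G: "\<And>x. 0 < x \<Longrightarrow> (G has_real_derivative g x) (at x)" using antiderivative_pos[OF gc] by blast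
  define w where "w = (\<lambda>r. - G (sqrt r))"
  define w' where "w' = (\<lambda>r. - (g (sqrt r) / (2 * sqrt r)))"
  define w'' where "w'' = (\<lambda>r. - (g (sqrt r) * (2 * \<psi>' (sqrt r) + 2 * C) / (4 * r) - g (sqrt r) / (4 * r * sqrt r)))"
  have sq: "(sqrt has_real_derivative 1 / (2 * sqrt r)) (at r)" if "0 < r" for r
  proof -
    have "inverse (sqrt r) / 2 = 1 / (2 * sqrt r)" by (simp add: inverse_eq_divide)
    with DERIV_real_sqrt[OF that] show ?thesis by (simp only:)
  qed
  have 1: "(w has_real_derivative w' r) (at r)" if "0 < r" for r
    unfolding w_def w'_def using DERIV_minus[OF DERIV_chain2[OF G sq, of r]] that by simp
  have 2: "(w' has_real_derivative w'' r) (at r)" if r: "0 < r" for r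
  proof -
    have "((\<lambda>r. g (sqrt r)) has_real_derivative g (sqrt r) * (2 * \<psi>' (sqrt r) + 2 * C) * (1 / (2 * sqrt r))) (at r)"
      by (rule DERIV_chain2[OF g' sq]) (use r in auto)
    then have "(w' has_real_derivative - ((g (sqrt r) * (2 * \<psi>' (sqrt r) + 2 * C) * (1 / (2 * sqrt r)) * (2 * sqrt r)
        - g (sqrt r) * (2 * (1 / (2 * sqrt r)))) / ((2 * sqrt r) * (2 * sqrt r)))) (at r)"
      unfolding w'_def using r by (intro DERIV_minus DERIV_divide DERIV_cmult sq) auto
    moreover have "- ((g (sqrt r) * (2 * \<psi>' (sqrt r) + 2 * C) * (1 / (2 * sqrt r)) * (2 * sqrt r)
        - g (sqrt r) * (2 * (1 / (2 * sqrt r)))) / ((2 * sqrt r) * (2 * sqrt r))) = w'' r"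
    proof -
      define z where "z = sqrt r"
      have "0 < z" "r = z * z" using r by (auto simp: z_def)
      then show ?thesis unfolding w''_def z_def[symmetric] by (simp add: field_simps)
    qed
    ultimately show ?thesis by simp
  qed
  have sc: "continuous_on {0<..} (\<lambda>r. f (sqrt r))" if "continuous_on {0<..} f" for f :: "real \<Rightarrow> real"
    by (rule continuous_on_compose2[OF that]) (auto intro: continuous_intros)
  have 3: "continuous_on {0<..} w''"
    unfolding w''_def by (intro continuous_intros sc[OF gc] sc[OF \<psi>(2)]) auto
  have 4: "w' r \<le> 0" if "0 < r" for r using that by (simp add: w'_def g_def)
  have 5: "filterlim w at_top (at_right 0)"
  proof -
    \<comment> \<open>As C \<ge> 0, \<open>g\<close> dominates exp (2 \<psi>), so G - P is
      nondecreasing and \<open>G\<close> inherits the divergence of \<open>P\<close> at 0.\<close>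
    have mono: "G 1 - P 1 \<ge> G r - P r" if r: "0 < r" "r \<le> 1" for r
    proof (rule DERIV_nonneg_imp_nondecreasing[OF r(2)])
      fix x assume x: "r \<le> x" "x \<le> 1"
      have "exp (2 * \<psi> x) \<le> g x" using C x r by (simp add: g_def)
      moreover have "((\<lambda>r. G r - P r) has_real_derivative g x - exp (2 * \<psi> x)) (at x)"
        using x r by (intro DERIV_diff G P(1)) auto
      ultimately show "\<exists>y. ((\<lambda>r. G r - P r) has_real_derivative y) (at x) \<and> 0 \<le> y"
        by (intro exI[of _ "g x - exp (2 * \<psi> x)"]) auto
    qed
    have "filterlim (\<lambda>r. (P 1 - G 1) + - P r) at_top (at_right 0)"
      using P(2) by (intro filterlim_tendsto_add_at_top[OF tendsto_const])
        (simp add: filterlim_uminus_at_top)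
    then have "filterlim (\<lambda>r. - G r) at_top (at_right 0)"
    proof (rule filterlim_at_top_mono)
      show "\<forall>\<^sub>F r in at_right 0. (P 1 - G 1) + - P r \<le> - G r"
        unfolding eventually_at_right_field using mono by (intro exI[of _ 1]) force
    qed
    moreover have "filterlim sqrt (at_right 0) (at_right (0::real))"
      unfolding filterlim_at
    proof
      show "\<forall>\<^sub>F x in at_right 0. sqrt x \<in> {0<..} \<and> sqrt x \<noteq> 0"
        unfolding eventually_at_right_field by (intro exI[of _ 1]) auto
      show "(sqrt \<longlongrightarrow> 0) (at_right 0)"
        using tendsto_real_sqrt[OF tendsto_ident_at, of 0 "{0<..}"] by simp
    qed
    ultimately show ?thesis unfolding w_def by (rule filterlim_compose)
  qed
  have 6: "w' (z\<^sup>2) * (1 - 2 * z * (\<psi>' z + C)) + 2 * z\<^sup>2 * w'' (z\<^sup>2) = 0" if "0 < z" for z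
    using that unfolding w'_def w''_def by (simp add: power2_eq_square field_simps)
  show ?thesis by (rule that[OF 1 2 3 4 5 6])
qed

text \<open>\<open>P\<close> is nondecreasing, so failing to diverge it would be bounded below; the
  integrals over [1 / (n + 1), 1] would then be bounded, and monotone convergence would make the
  whole integral finite.\<close>

lemma antiderivative_at_bot:
  fixes h P :: "real \<Rightarrow> real"
  assumes h: "continuous_on {0<..} h" "\<And>x. 0 < x \<Longrightarrow> 0 \<le> h x"
    and P: "\<And>x. 0 < x \<Longrightarrow> (P has_real_derivative h x) (at x)"
    and inf: "(\<integral>\<^sup>+ u \<in> {0<..1}. ennreal (h u) \<partial>lborel) = \<infinity>"
  shows "filterlim P at_bot (at_right 0)"
proof (rule ccontr)
  assume "\<not> ?thesis"
  then obtain z where z: "\<not> (\<forall>\<^sub>F x in at_right 0. P x \<le> z)" unfolding filterlim_at_bot by blast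
  have mono: "P x \<le> P y" if "0 < x" "x \<le> y" for x y
    by (rule DERIV_nonneg_imp_nondecreasing[OF that(2)]) (use P h that in \<open>meson less_le_trans\<close>)
  have lb: "z \<le> P x" if "0 < x" for x
  proof (rule ccontr)
    assume zx: "\<not> z \<le> P x"
    have "P y \<le> z" if "0 < y" "y < x" for y using mono[of y x] that zx by linarith
    then have "\<forall>\<^sub>F y in at_right 0. P y \<le> z" unfolding eventually_at_right_field
      using that by (intro exI[of _ x]) auto
    then show False using z by blast
  qed
  define h0 where "h0 = (\<lambda>x. indicator {0<..} x *\<^sub>R h x)"
  have h0m: "h0 \<in> borel_measurable borel" unfolding h0_def
    by (rule borel_measurable_continuous_on_indicator[OF _ h(1)]) auto
  define f where "f = (\<lambda>n u. ennreal (h0 u) * indicator {1 / real (Suc n)..1} u)"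
  have fin: "(\<integral>\<^sup>+ u. f n u \<partial>lborel) \<le> ennreal (P 1 - z)" for n
  proof -
    have "(\<integral>\<^sup>+ u. f n u \<partial>lborel) = ennreal (P 1 - P (1 / real (Suc n)))" unfolding f_def
    proof (rule nn_integral_FTC_Icc)
      fix x assume x: "x \<in> {1 / real (Suc n)..1}"
      then have "0 < x" by (auto intro: less_le_trans[of 0 "1 / real (Suc n)"])
      then show "(P has_real_derivative h0 x) (at x)" "0 \<le> h0 x"
        using P h by (auto simp: h0_def)
    qed (use h0m in auto)
    also have "\<dots> \<le> ennreal (P 1 - z)" using lb[of "1 / real (Suc n)"] by (intro ennreal_leI) auto
    finally show ?thesis .
  qed
  have "(SUP n. f n u) = ennreal (h u) * indicator {0<..1} u" for u
  proof (cases "u \<in> {0<..1}")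
    case True
    obtain n where n: "1 / real (Suc n) < u" using reals_Archimedean[of u] True by (auto simp: inverse_eq_divide)
    have "(SUP n. f n u) = ennreal (h u)"
    proof (rule antisym)
      show "(SUP n. f n u) \<le> ennreal (h u)" using True by (intro SUP_least) (auto simp: f_def h0_def indicator_def)
      show "ennreal (h u) \<le> (SUP n. f n u)"
        by (rule SUP_upper2[of n]) (use n True in \<open>auto simp: f_def h0_def indicator_def\<close>)
    qed
    then show ?thesis using True by simp
  next
    case False
    then have "f n u = 0" for n by (auto simp: f_def h0_def indicator_def)
    then show ?thesis using False by simp
  qed
  then have "(\<integral>\<^sup>+ u \<in> {0<..1}. ennreal (h u) \<partial>lborel) = (\<integral>\<^sup>+ u. (SUP n. f n u) \<partial>lborel)" by simp
  also have "\<dots> = (SUP n. (\<integral>\<^sup>+ u. f n u \<partial>lborel))"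
  proof (rule nn_integral_monotone_convergence_SUP)
    show "incseq f" unfolding f_def
    proof (intro incseq_SucI le_funI mult_left_mono)
      fix n u
      have "1 / real (Suc (Suc n)) \<le> 1 / real (Suc n)" by (simp add: field_simps)
      then show "indicator {1 / real (Suc n)..1} u \<le> (indicator {1 / real (Suc (Suc n))..1} u :: ennreal)"
        by (auto simp: indicator_def)
    qed auto
    show "f n \<in> borel_measurable lborel" for n unfolding f_def using h0m by measurable
  qed
  also have "\<dots> \<le> ennreal (P 1 - z)" by (intro SUP_least fin)
  finally show False using inf by (simp add: top_unique)
qed

section \<open>Geometry of the polyhedron\<close>

text \<open>Convexity of the extended-real function descends to its finite part on the positive half
  line; adding the tangent inequalities at two points gives monotonicity of the derivative.\<close>

lemma admissible_dphi:
  assumes "admissible_phi f"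
  shows "\<And>x. 0 < x \<Longrightarrow> ((\<lambda>u. real_of_ereal (f u)) has_real_derivative dphi f x) (at x)"
    and "continuous_on {0<..} (dphi f)" and "\<And>x y. 0 < x \<Longrightarrow> x \<le> y \<Longrightarrow> dphi f x \<le> dphi f y"
proof -
  obtain g g' where g: "\<And>x. 0 < x \<Longrightarrow> f x = ereal (g x)"
    "\<And>x. 0 < x \<Longrightarrow> (g has_real_derivative g' x) (at x)" "continuous_on {0<..} g'"
    using assms unfolding admissible_phi_def C1_pos_def by blast
  have D: "((\<lambda>u. real_of_ereal (f u)) has_real_derivative g' x) (at x)" if x: "0 < x" for x
    by (rule has_field_derivative_transform_within_open[OF g(2)[OF x] open_greaterThan[of 0]])
      (use g(1) x in auto)
  have eq: "dphi f x = g' x" if "0 < x" for x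
    unfolding dphi_def by (rule DERIV_imp_deriv[OF D[OF that]])
  show "((\<lambda>u. real_of_ereal (f u)) has_real_derivative dphi f x) (at x)" if "0 < x" for x
    using D eq that by simp
  show "continuous_on {0<..} (dphi f)"
  proof -
    have "continuous_on {0<..} (dphi f) = continuous_on {0<..} g'"
      by (rule continuous_on_cong) (auto simp: eq)
    then show ?thesis using g(3) by simp
  qed
  have conv: "convex_on {0<..} g"
  proof (rule convex_onI)
    fix t x y :: real assume t: "0 < t" "t < 1" and xy: "x \<in> {0<..}" "y \<in> {0<..}"
    have p: "0 < t * y + (1 - t) * x" using t xy by (simp add: add_pos_pos)
    have "f (t * y + (1 - t) * x) \<le> ereal t * f y + ereal (1 - t) * f x"
      using assms t unfolding admissible_phi_def convex_ereal_def by auto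
    then show "g ((1 - t) *\<^sub>R x + t *\<^sub>R y) \<le> (1 - t) * g x + t * g y"
      using g(1)[OF p] g(1)[of x] g(1)[of y] xy by (simp add: add.commute)
  qed auto
  have tangent: "g y - g x \<ge> g' x * (y - x)" if "0 < x" "0 < y" for x y
    by (rule convex_on_imp_above_tangent[OF conv]) (use that g(2) in \<open>auto simp: interior_open intro: DERIV_subset\<close>)
  show "dphi f x \<le> dphi f y" if "0 < x" "x \<le> y" for x y
  proof (cases "x = y")
    case False
    have "g' x * (y - x) \<le> g y - g x" "g' y * (x - y) \<le> g x - g y" using tangent that by auto
    then have "(g' x - g' y) * (y - x) \<le> 0" by (simp add: algebra_simps)
    then have "g' x - g' y \<le> 0" using False that by (simp add: mult_le_0_iff)
    then show ?thesis using eq that by simp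
  qed simp
qed

lemma open_domD: "open (domD m n a)"
proof -
  have "domD m n a = (\<Inter>i\<in>{1..m}. {x. a i < x \<bullet> n i})" by (auto simp: domD_def)
  then show ?thesis by (auto intro!: open_INT open_Collect_less continuous_intros)
qed

text \<open>Moving a point of the closed polyhedron a fraction 1 / (k + 1) of the way to a fixed
  point of the open one makes every constraint strict.\<close>

lemma closure_domD:
  assumes "domD m n a \<noteq> {}"
  shows "closure (domD m n a) = {x. \<forall>i\<in>{1..m}. a i \<le> x \<bullet> n i}" (is "_ = ?C")
proof
  have "?C = (\<Inter>i\<in>{1..m}. {x. a i \<le> x \<bullet> n i})" by auto
  then have "closed ?C" by (auto intro!: closed_INT closed_Collect_le continuous_intros)
  then show "closure (domD m n a) \<subseteq> ?C" by (intro closure_minimal) (auto simp: domD_def intro: less_imp_le)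
  obtain y where y: "y \<in> domD m n a" using assms by blast
  show "?C \<subseteq> closure (domD m n a)"
  proof
    fix x assume x: "x \<in> ?C"
    define f where "f = (\<lambda>k::nat. x + (1 / real (Suc k)) *\<^sub>R (y - x))"
    have "f k \<in> domD m n a" for k unfolding domD_def
    proof safe
      fix i assume i: "i \<in> {1..m}"
      have "0 < 1 / real (Suc k) * (y \<bullet> n i - a i)" using y i by (auto simp: domD_def)
      moreover have "0 \<le> (1 - 1 / real (Suc k)) * (x \<bullet> n i - a i)"
        using x i by (intro mult_nonneg_nonneg) auto
      ultimately show "a i < f k \<bullet> n i" by (simp add: f_def inner_add_left inner_diff_left algebra_simps)
    qed
    moreover have "f \<longlonglongrightarrow> x"
    proof -
      have "f \<longlonglongrightarrow> x + 0 *\<^sub>R (y - x)" unfolding f_def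
        using LIMSEQ_inverse_real_of_nat by (intro tendsto_intros) (simp add: inverse_eq_divide)
      then show ?thesis by simp
    qed
    ultimately show "x \<in> closure (domD m n a)" unfolding closure_sequential by blast
  qed
qed

section \<open>Local geometry around a set of active constraints\<close>

locale polyhedron =
  fixes m :: nat and phi :: "nat \<Rightarrow> real \<Rightarrow> ereal" and n :: "nat \<Rightarrow> real^'d" and a :: "nat \<Rightarrow> real"
  assumes phi: "\<And>j. j \<in> {1..m} \<Longrightarrow> admissible_phi (phi j)"
    and norm_n: "\<And>j. j \<in> {1..m} \<Longrightarrow> norm (n j) = 1" and inj_n: "inj_on n {1..m}"
    and nonempty: "domD m n a \<noteq> {}"
begin

lemmas closure_D = closure_domD[OF nonempty]

text \<open>Distinct collinear unit vectors are opposite. Being active together forces a i = - a j,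
  and then the two strict constraints contradict each other at any point of the domain.\<close>

lemma active_pair_independent:
  assumes x0: "x0 \<in> closure (domD m n a)" and ij: "i \<in> {1..m}" "j \<in> {1..m}" "i \<noteq> j"
    and act: "x0 \<bullet> n i = a i" "x0 \<bullet> n j = a j"
  shows "independent {n i, n j}" "n i \<noteq> n j"
proof -
  show ne: "n i \<noteq> n j" using inj_onD[OF inj_n _ ij(1,2)] ij(3) by blast
  obtain y where y: "y \<in> domD m n a" using nonempty by blast
  have "n i \<notin> span {n j}"
  proof
    assume "n i \<in> span {n j}"
    then obtain k where k: "n i = k *\<^sub>R n j" by (auto simp: span_singleton)
    then have "\<bar>k\<bar> = 1" using norm_n[OF ij(1)] norm_n[OF ij(2)] by simp
    then have "k = 1 \<or> k = -1" by (auto simp: abs_if split: if_splits)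
    then have "n i = - n j" using k ne by (elim disjE) simp_all
    then have "y \<bullet> n i = - (y \<bullet> n j)" "x0 \<bullet> n i = - (x0 \<bullet> n j)" by simp_all
    moreover have "a i < y \<bullet> n i" "a j < y \<bullet> n j" using y ij unfolding domD_def by blast+
    ultimately show False using act by linarith
  qed
  moreover have "n j \<noteq> 0" using norm_n[OF ij(2)] norm_zero by force
  ultimately show "independent {n i, n j}" using ne by (simp add: independent_insert)
qed

end

text \<open>\<open>U\<close> keeps the constraints outside \<open>J\<close> at slack
  \<open>eps\<close> but need not lie near \<open>o0\<close>: the base point enters \<open>Y\<close>
  only through its projection to the span of the active normals, which the numbers
  \<open>a j\<close> with j in \<open>J\<close> determine.\<close>

locale face = polyhedron m phi n a for m phi and n :: "nat \<Rightarrow> real^'d" and a +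
  fixes i :: nat and o0 :: "real^'d" and J :: "nat set" and S :: "(real^'d) set" and eps Z :: real
    and Y :: "real^'d \<Rightarrow> real^'d" and U :: "(real^'d) set"
  assumes i: "i \<in> J" and o0: "o0 \<in> closure (domD m n a)" and J: "J = {j\<in>{1..m}. o0 \<bullet> n j = a j}"
    and S: "orthonormal S" "span S = span (n ` J)" and eps: "0 < eps"
    and Y: "Y = (\<lambda>x. proj S (x - o0))"
    and U: "U = {x. (\<forall>j\<in>{1..m}. a j \<le> x \<bullet> n j) \<and> (\<forall>k\<in>{1..m} - J. eps \<le> x \<bullet> n k - a k) \<and> norm x \<le> Z}"
begin

lemma closed_U: "closed U"
proof -
  have "U = (\<Inter>j\<in>{1..m}. {x. a j \<le> x \<bullet> n j}) \<inter> ((\<Inter>k\<in>{1..m} - J. {x. eps \<le> x \<bullet> n k - a k}) \<inter> {x. norm x \<le> Z})"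
    unfolding U by auto
  also have "closed \<dots>"
    by (intro closed_Int closed_INT ballI closed_Collect_le continuous_intros)
  finally show ?thesis .
qed

lemma bounded_U: "bounded U"
  unfolding bounded_iff U by blast

lemma Y_inner:
  assumes "j \<in> J" shows "Y x \<bullet> n j = x \<bullet> n j - a j"
proof -
  have "n j \<in> span S" unfolding S(2) using assms by (intro span_base) auto
  then have "proj S (n j) = n j" by (rule proj_span[OF _ S(1)])
  then have "Y x \<bullet> n j = (x - o0) \<bullet> n j" by (simp add: Y inner_proj_commute)
  then show ?thesis using assms J by (simp add: inner_diff_left)
qed

lemma Y_eq_0:
  assumes "\<And>j. j \<in> J \<Longrightarrow> x \<bullet> n j = a j" shows "Y x = 0"
proof -
  have "(x - o0) \<bullet> e = 0" if "e \<in> S" for e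
  proof -
    have "e \<in> span (n ` J)" unfolding S(2)[symmetric] by (rule span_base[OF that])
    then have "orthogonal (x - o0) e"
      by (rule orthogonal_to_span) (use assms J in \<open>auto simp: orthogonal_def inner_diff_left\<close>)
    then show ?thesis by (simp add: orthogonal_def)
  qed
  then show ?thesis by (simp add: Y proj_def)
qed

lemma Y_nonzero: "x \<in> domD m n a \<Longrightarrow> Y x \<noteq> 0"
proof
  assume x: "x \<in> domD m n a" and 0: "Y x = 0"
  have "i \<in> {1..m}" using i J by auto
  then have "a i < x \<bullet> n i" using x unfolding domD_def by blast
  then show False using Y_inner[OF i, of x] 0 by simp
qed

text \<open>Moving from \<open>x\<close> a little in direction \<open>Y x\<close> stays in the
  closed polyhedron: the slack of each constraint in \<open>J\<close> is multiplied by 1 + t, and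
  the others have slack \<open>eps\<close> to spare. Inserting that point into the defining
  inequality of \<open>v\<close> gives the sign.\<close>

lemma inward_normal_Y:
  assumes x: "x \<in> U" and v: "inward_normal (domD m n a) x v"
  shows "0 \<le> Y x \<bullet> v"
proof -
  \<comment> \<open>The 1 in the denominator covers Y x = 0.\<close>
  define t where "t = eps / (norm (Y x) + 1)"
  have t: "0 < t" "t * norm (Y x) \<le> eps" using eps by (auto simp: t_def field_simps add_pos_nonneg)
  have "x + t *\<^sub>R Y x \<in> closure (domD m n a)"
    unfolding closure_D
  proof safe
    fix j assume j: "j \<in> {1..m}"
    show "a j \<le> (x + t *\<^sub>R Y x) \<bullet> n j"
    proof (cases "j \<in> J")
      case True
      have "0 \<le> x \<bullet> n j - a j" using x j by (auto simp: U)
      then show ?thesis using t Y_inner[OF True, of x] by (simp add: inner_add_left add_increasing2)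
    next
      case False
      then have "eps \<le> x \<bullet> n j - a j" using x j by (auto simp: U)
      moreover have "\<bar>Y x \<bullet> n j\<bar> \<le> norm (Y x)"
        using Cauchy_Schwarz_ineq2[of "Y x" "n j"] norm_n[OF j] by simp
      then have "t * \<bar>Y x \<bullet> n j\<bar> \<le> t * norm (Y x)" using t by (intro mult_left_mono) auto
      moreover have "- (t * \<bar>Y x \<bullet> n j\<bar>) \<le> t * (Y x \<bullet> n j)"
        using t by (metis abs_le_D2 abs_mult abs_of_pos minus_le_iff order_refl)
      ultimately show ?thesis using t(2) unfolding inner_add_left inner_scaleR_left by linarith
    qed
  qed
  then have "v \<bullet> (x - (x + t *\<^sub>R Y x)) \<le> 0" using v unfolding inward_normal_def by blast
  then show ?thesis using t by (simp add: inner_commute zero_le_mult_iff)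
qed

text \<open>On \<open>U\<close> the arguments are bounded above, so monotonicity bounds the
  derivatives from above even where they diverge to minus infinity at the wall. For constraints
  outside \<open>J\<close> the slack \<open>eps\<close> also gives a lower bound.\<close>

lemma dphi_bounds:
  obtains c where "0 \<le> c"
    "\<And>j x. j \<in> {1..m} \<Longrightarrow> x \<in> U \<Longrightarrow> x \<bullet> n j - a j > 0 \<Longrightarrow> dphi (phi j) (x \<bullet> n j - a j) \<le> c"
    "\<And>j x. j \<in> {1..m} - J \<Longrightarrow> x \<in> U \<Longrightarrow> \<bar>dphi (phi j) (x \<bullet> n j - a j)\<bar> \<le> c"
proof -
  define b where "b = (\<lambda>j. max eps (\<bar>Z\<bar> + \<bar>a j\<bar>))"
  define c where "c = (\<Sum>j\<in>{1..m}. \<bar>dphi (phi j) eps\<bar> + \<bar>dphi (phi j) (b j)\<bar>)"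
  have le_c: "\<bar>dphi (phi j) eps\<bar> + \<bar>dphi (phi j) (b j)\<bar> \<le> c" if "j \<in> {1..m}" for j
    unfolding c_def by (rule member_le_sum[OF that]) auto
  have zb: "x \<bullet> n j - a j \<le> b j" if "x \<in> U" "j \<in> {1..m}" for x j
  proof -
    have "\<bar>x \<bullet> n j\<bar> \<le> norm x" using Cauchy_Schwarz_ineq2[of x "n j"] norm_n[OF that(2)] by simp
    moreover have "norm x \<le> Z" using that by (auto simp: U)
    ultimately show ?thesis unfolding b_def by linarith
  qed
  show ?thesis
  proof (rule that[of c])
    show "0 \<le> c" unfolding c_def by (intro sum_nonneg) auto
    fix j x assume j: "j \<in> {1..m}" and x: "x \<in> U"
    note mono = admissible_dphi(3)[OF phi[OF j]]
    show le: "dphi (phi j) (x \<bullet> n j - a j) \<le> c" if "x \<bullet> n j - a j > 0"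
      using mono[OF that zb[OF x j]] le_c[OF j] by linarith
  next
    fix j x assume j: "j \<in> {1..m} - J" and x: "x \<in> U"
    then have j': "j \<in> {1..m}" and e: "eps \<le> x \<bullet> n j - a j" by (auto simp: U)
    note mono = admissible_dphi(3)[OF phi[OF j']]
    show "\<bar>dphi (phi j) (x \<bullet> n j - a j)\<bar> \<le> c"
      using mono[OF eps e] mono[OF _ zb[OF x j']] e eps le_c[OF j'] by force
  qed
qed

text \<open>For active constraints Y \<bullet> n j is the positive slack, so the upper bound on the
  derivative is the favourable one; the others contribute a bounded drift. With a single active
  constraint \<open>Y\<close> is a multiple of \<open>n i\<close> and |Y| is the distance to the
  wall, so the singular term can be kept exactly.\<close>

lemma drift_bound:
  obtains C where "0 \<le> C" "\<And>x. x \<in> U \<Longrightarrow> x \<in> domD m n a \<Longrightarrow> J = {i} \<Longrightarrow>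
      Y x \<bullet> gradPhi m phi n a x \<le> norm (Y x) * (dphi (phi i) (norm (Y x)) + C)"
    "\<And>x. x \<in> U \<Longrightarrow> x \<in> domD m n a \<Longrightarrow> Y x \<bullet> gradPhi m phi n a x \<le> norm (Y x) * C"
proof -
  obtain c where c: "0 \<le> c"
    "\<And>j x. j \<in> {1..m} \<Longrightarrow> x \<in> U \<Longrightarrow> x \<bullet> n j - a j > 0 \<Longrightarrow> dphi (phi j) (x \<bullet> n j - a j) \<le> c"
    "\<And>j x. j \<in> {1..m} - J \<Longrightarrow> x \<in> U \<Longrightarrow> \<bar>dphi (phi j) (x \<bullet> n j - a j)\<bar> \<le> c" using dphi_bounds by blast
  have im: "i \<in> {1..m}" using i J by auto
  have Yn: "\<bar>Y x \<bullet> n j\<bar> \<le> norm (Y x)" if "j \<in> {1..m}" for j x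
    using Cauchy_Schwarz_ineq2[of "Y x" "n j"] norm_n[OF that] by simp
  have tm: "dphi (phi j) (x \<bullet> n j - a j) * (Y x \<bullet> n j) \<le> c * norm (Y x)"
    if "j \<in> {1..m}" "x \<in> U" "x \<in> domD m n a" for j x
  proof (cases "j \<in> J")
    case True
    have z: "0 < Y x \<bullet> n j" "x \<bullet> n j - a j > 0" using Y_inner[OF True] that by (auto simp: domD_def)
    have "dphi (phi j) (x \<bullet> n j - a j) * (Y x \<bullet> n j) \<le> c * (Y x \<bullet> n j)"
      using c(2)[OF that(1,2) z(2)] z by (intro mult_right_mono) auto
    also have "\<dots> \<le> c * norm (Y x)" using Yn[OF that(1), of x] c by (intro mult_left_mono) auto
    finally show ?thesis .
  next
    case False
    have "\<bar>dphi (phi j) (x \<bullet> n j - a j) * (Y x \<bullet> n j)\<bar> \<le> c * norm (Y x)"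
      unfolding abs_mult using c(3)[of j x] that False Yn[OF that(1), of x] c(1) by (intro mult_mono) auto
    then show ?thesis by linarith
  qed
  have G: "Y x \<bullet> gradPhi m phi n a x = (\<Sum>j\<in>{1..m}. dphi (phi j) (x \<bullet> n j - a j) * (Y x \<bullet> n j))" for x
    by (simp add: gradPhi_def inner_sum_right)
  show ?thesis
  proof (rule that[of "real m * c"])
    show "0 \<le> real m * c" using c by simp
    fix x assume x: "x \<in> U" "x \<in> domD m n a"
    have "Y x \<bullet> gradPhi m phi n a x \<le> (\<Sum>j\<in>{1..m}. c * norm (Y x))" unfolding G by (intro sum_mono tm x)
    then show "Y x \<bullet> gradPhi m phi n a x \<le> norm (Y x) * (real m * c)" by (simp add: mult_ac)
  next
    fix x assume x: "x \<in> U" "x \<in> domD m n a" "J = {i}"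
    have "n i \<in> span S" unfolding S(2) by (rule span_base) (use i in auto)
    have "Y x \<in> span S" unfolding Y proj_def by (intro span_sum span_scale span_base)
    then have "Y x \<in> span {n i}" using S(2) x(3) by simp
    then obtain k where k: "Y x = k *\<^sub>R n i" by (auto simp: span_singleton)
    have "Y x \<bullet> n i = k" using k norm_n[OF im] by (simp add: norm_eq_1)
    then have "0 < k" using Y_inner[OF i, of x] x im by (auto simp: domD_def)
    then have nY: "norm (Y x) = Y x \<bullet> n i" "norm (Y x) = x \<bullet> n i - a i"
      using k norm_n[OF im] Y_inner[OF i, of x] \<open>Y x \<bullet> n i = k\<close> by auto
    have "Y x \<bullet> gradPhi m phi n a x = dphi (phi i) (x \<bullet> n i - a i) * (Y x \<bullet> n i)
        + (\<Sum>j\<in>{1..m} - {i}. dphi (phi j) (x \<bullet> n j - a j) * (Y x \<bullet> n j))"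
      unfolding G by (subst sum.remove[OF _ im]) auto
    also have "\<dots> \<le> dphi (phi i) (x \<bullet> n i - a i) * (Y x \<bullet> n i) + (\<Sum>j\<in>{1..m} - {i}. c * norm (Y x))"
      by (intro add_left_mono sum_mono tm) (use x in auto)
    also have "\<dots> \<le> dphi (phi i) (norm (Y x)) * norm (Y x) + real m * (c * norm (Y x))"
      using c im by (auto simp: nY(1)[symmetric] nY(2)[symmetric] intro!: mult_right_mono)
    finally show "Y x \<bullet> gradPhi m phi n a x \<le> norm (Y x) * (dphi (phi i) (norm (Y x)) + real m * c)"
      by (simp add: algebra_simps)
  qed
qed

end

text \<open>Since \<open>w'\<close> is nonpositive, a lower bound on card S - 2 (Y \<bullet> grad
  \<Phi>) by its one-dimensional counterpart suffices. If only constraint \<open>i\<close> is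
  active, \<psi> is \<phi>_i up to a constant, and the divergence of its scale function is the
  hypothesis.\<close>

lemma (in face) face_lyapunov:
  assumes scale: "scale_p (phi i) 0 = - \<infinity>" and card: "J = {i} \<and> card S = 1 \<or> 2 \<le> card S"
  obtains w w' w'' :: "real \<Rightarrow> real" where
    "\<And>r. 0 < r \<Longrightarrow> (w has_real_derivative w' r) (at r)"
    "\<And>r. 0 < r \<Longrightarrow> (w' has_real_derivative w'' r) (at r)"
    "continuous_on {0<..} w''" "\<And>r. 0 < r \<Longrightarrow> w' r \<le> 0" "filterlim w at_top (at_right 0)"
    "\<And>x. x \<in> U \<Longrightarrow> x \<in> domD m n a \<Longrightarrow>
       w' ((norm (Y x))\<^sup>2) * (real (card S) - 2 * (Y x \<bullet> gradPhi m phi n a x))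
       + 2 * (norm (Y x))\<^sup>2 * w'' ((norm (Y x))\<^sup>2) \<le> 0"
proof -
  have im: "i \<in> {1..m}" using i J by auto
  obtain C where C: "0 \<le> C" "\<And>x. x \<in> U \<Longrightarrow> x \<in> domD m n a \<Longrightarrow> J = {i} \<Longrightarrow>
      Y x \<bullet> gradPhi m phi n a x \<le> norm (Y x) * (dphi (phi i) (norm (Y x)) + C)"
    "\<And>x. x \<in> U \<Longrightarrow> x \<in> domD m n a \<Longrightarrow> Y x \<bullet> gradPhi m phi n a x \<le> norm (Y x) * C"
    using drift_bound by blast
  have "\<exists>\<psi> \<psi>' P :: real \<Rightarrow> real. (\<forall>x>0. (\<psi> has_real_derivative \<psi>' x) (at x)) \<and> continuous_on {0<..} \<psi>' \<and>
      (\<forall>x>0. (P has_real_derivative exp (2 * \<psi> x)) (at x)) \<and> filterlim P at_bot (at_right 0) \<and>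
      (\<forall>x\<in>U \<inter> domD m n a. 1 - 2 * norm (Y x) * (\<psi>' (norm (Y x)) + C) \<le> real (card S) - 2 * (Y x \<bullet> gradPhi m phi n a x))"
    using card
  proof
    assume A: "J = {i} \<and> card S = 1"
    define \<psi> where "\<psi> = (\<lambda>u. real_of_ereal (phi i u) - real_of_ereal (phi i 1))"
    note adm = admissible_dphi[OF phi[OF im]]
    have \<psi>: "(\<psi> has_real_derivative dphi (phi i) x) (at x)" if "0 < x" for x
      unfolding \<psi>_def using adm(1)[OF that] by (auto intro!: derivative_eq_intros)
    have \<psi>c: "continuous_on {0<..} \<psi>"
      by (rule DERIV_continuous_on[of _ _ "dphi (phi i)"]) (auto intro: DERIV_subset[OF \<psi>])
    have hc: "continuous_on {0<..} (\<lambda>x. exp (2 * \<psi> x))" by (intro continuous_intros \<psi>c)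
    obtain P where P: "\<And>x. 0 < x \<Longrightarrow> (P has_real_derivative exp (2 * \<psi> x)) (at x)"
      using antiderivative_pos[OF hc] by blast
    have "enn2ereal (\<integral>\<^sup>+ u \<in> {0<..1}. ennreal (exp (2 * \<psi> u)) \<partial>lborel) = \<infinity>"
      using scale unfolding scale_p_def \<psi>_def by (simp add: ereal_uminus_eq_reorder)
    then have "(\<integral>\<^sup>+ u \<in> {0<..1}. ennreal (exp (2 * \<psi> u)) \<partial>lborel) = \<infinity>"
      by (metis enn2ereal_inject enn2ereal_top infinity_ennreal_def)
    then have "filterlim P at_bot (at_right 0)" by (intro antiderivative_at_bot[OF hc _ P]) auto
    moreover have "1 - 2 * norm (Y x) * (dphi (phi i) (norm (Y x)) + C) \<le> real (card S) - 2 * (Y x \<bullet> gradPhi m phi n a x)"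
      if "x \<in> U \<inter> domD m n a" for x
      using C(2)[of x] that A by simp
    ultimately show ?thesis using \<psi> P adm(2) by blast
  next
    assume A: "2 \<le> card S"
    \<comment> \<open>With \<psi> = - ln / 2 the function exp (2 \<psi>) is 1 / x, with primitive
      \<open>ln\<close>, and -2 z \<psi>'(z) = 1 raises the leading constant from 1 to 2, which card
      S reaches.\<close>
    have d1: "((\<lambda>x. - ln x / 2) has_real_derivative - 1 / (2 * x)) (at x)" if "0 < x" for x :: real
      using that by (auto intro!: derivative_eq_intros)
    have d2: "(ln has_real_derivative exp (2 * (- ln x / 2))) (at x)" if "0 < x" for x :: real
      using that DERIV_ln[OF that] by (simp add: exp_minus)
    have b: "1 - 2 * norm (Y x) * (- 1 / (2 * norm (Y x)) + C) \<le> real (card S) - 2 * (Y x \<bullet> gradPhi m phi n a x)"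
      if x: "x \<in> U \<inter> domD m n a" for x
    proof -
      have "0 < norm (Y x)" using Y_nonzero x by simp
      then have "1 - 2 * norm (Y x) * (- 1 / (2 * norm (Y x)) + C) = 2 - 2 * (norm (Y x) * C)"
        by (simp add: field_simps)
      then show ?thesis using C(3)[of x] x A by simp
    qed
    have c: "continuous_on {0<..} (\<lambda>x::real. - 1 / (2 * x))" by (intro continuous_intros) auto
    show ?thesis
      by (intro exI[of _ "\<lambda>x. - ln x / 2"] exI[of _ "\<lambda>x. - 1 / (2 * x)"] exI[of _ ln] conjI)
        (use d1 d2 b c ln_at_0 in auto)
  qed
  then obtain \<psi> \<psi>' P where \<psi>: "\<And>x. 0 < x \<Longrightarrow> (\<psi> has_real_derivative \<psi>' x) (at x)" "continuous_on {0<..} \<psi>'"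
    "\<And>x. 0 < x \<Longrightarrow> (P has_real_derivative exp (2 * \<psi> x)) (at x)" "filterlim P at_bot (at_right 0)"
    and bd: "\<And>x. x \<in> U \<inter> domD m n a \<Longrightarrow>
      1 - 2 * norm (Y x) * (\<psi>' (norm (Y x)) + C) \<le> real (card S) - 2 * (Y x \<bullet> gradPhi m phi n a x)"
    by blast
  obtain w w' w'' where w: "\<And>r. 0 < r \<Longrightarrow> (w has_real_derivative w' r) (at r)"
    "\<And>r. 0 < r \<Longrightarrow> (w' has_real_derivative w'' r) (at r)"
    "continuous_on {0<..} w''" "\<And>r. 0 < r \<Longrightarrow> w' r \<le> 0" "filterlim w at_top (at_right 0)"
    "\<And>z. 0 < z \<Longrightarrow> w' (z\<^sup>2) * (1 - 2 * z * (\<psi>' z + C)) + 2 * z\<^sup>2 * w'' (z\<^sup>2) = 0"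
    using lyapunov_function[OF \<psi> C(1)] by blast
  show ?thesis
  proof (rule that[OF w(1-5)])
    fix x assume x: "x \<in> U" "x \<in> domD m n a"
    have z: "0 < norm (Y x)" using Y_nonzero x by simp
    have "w' ((norm (Y x))\<^sup>2) * (real (card S) - 2 * (Y x \<bullet> gradPhi m phi n a x))
       \<le> w' ((norm (Y x))\<^sup>2) * (1 - 2 * norm (Y x) * (\<psi>' (norm (Y x)) + C))"
      using bd[of x] x w(4)[of "(norm (Y x))\<^sup>2"] z by (intro mult_left_mono_neg) auto
    then show "w' ((norm (Y x))\<^sup>2) * (real (card S) - 2 * (Y x \<bullet> gradPhi m phi n a x))
       + 2 * (norm (Y x))\<^sup>2 * w'' ((norm (Y x))\<^sup>2) \<le> 0" using w(6)[OF z] by linarith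
  qed
qed

section \<open>Pathwise estimates for solutions of the multivalued equation\<close>

definition clock :: "'a set \<Rightarrow> ('a \<Rightarrow> 'b::euclidean_space) \<Rightarrow> (real \<Rightarrow> 'a) \<Rightarrow> (real \<Rightarrow> real) \<Rightarrow> real \<Rightarrow> real" where
  "clock D G x l t = (LINT s:{0..t}|lborel. norm (indicator D (x s) *\<^sub>R G (x s))) + l t + t"

lemma measure_dL:
  assumes "continuous_on {0..} l" "mono_on {0..} l" "0 \<le> t" "t \<le> t'"
  shows "emeasure (dL l) {t<..t'} = ennreal (l t' - l t)" "measure (dL l) {t<..t'} = l t' - l t"
proof -
  let ?f = "\<lambda>s. l (max 0 s)"
  have mono: "?f x \<le> ?f y" if "x \<le> y" for x y
    using assms(2) that by (auto simp: mono_on_def)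
  have "continuous_on UNIV ?f"
    by (rule continuous_on_compose2[OF assms(1)]) (auto intro!: continuous_intros)
  then have cont: "continuous (at_right x) ?f" for x
    by (auto simp: continuous_on_eq_continuous_within intro: continuous_within_subset)
  show "emeasure (dL l) {t<..t'} = ennreal (l t' - l t)"
    unfolding dL_def using emeasure_interval_measure_Ioc[OF assms(4) mono cont] assms by simp
  show "measure (dL l) {t<..t'} = l t' - l t"
    unfolding dL_def using measure_interval_measure_Ioc[OF assms(4) mono cont] assms by simp
qed

lemma sets_dL [simp]: "sets (dL l) = sets borel"
  by (simp add: dL_def)

lemma set_lebesgue_integral_split:
  fixes f :: "real \<Rightarrow> 'b::euclidean_space"
  assumes "set_integrable N {0..t'} f" "sets N = sets borel" "0 \<le> t" "t \<le> t'"
  shows "set_integrable N {t<..t'} f"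
    and "(LINT s:{0..t'}|N. f s) - (LINT s:{0..t}|N. f s) = (LINT s:{t<..t'}|N. f s)"
proof -
  have i: "set_integrable N {0..t} f" and i2: "set_integrable N {t<..t'} f"
    by (rule set_integrable_subset[OF assms(1)]; use assms in auto)+
  have "{0..t'} = {0..t} \<union> {t<..t'}" using assms by auto
  then have "(LINT s:{0..t'}|N. f s) = (LINT s:{0..t}|N. f s) + (LINT s:{t<..t'}|N. f s)"
    using set_integral_Un[OF _ i i2] by (simp add: ivl_disj_int)
  then show "(LINT s:{0..t'}|N. f s) - (LINT s:{0..t}|N. f s) = (LINT s:{t<..t'}|N. f s)" by simp
  show "set_integrable N {t<..t'} f" by (rule i2)
qed

lemma inner_set_lebesgue_integral:
  fixes f :: "real \<Rightarrow> 'b::euclidean_space"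
  assumes "set_integrable N A f"
  shows "set_integrable N A (\<lambda>s. p \<bullet> f s)" "p \<bullet> (LINT s:A|N. f s) = (LINT s:A|N. p \<bullet> f s)"
proof -
  have eq: "(\<lambda>s. indicator A s *\<^sub>R (p \<bullet> f s)) = (\<lambda>s. p \<bullet> (indicator A s *\<^sub>R f s))" by simp
  show "set_integrable N A (\<lambda>s. p \<bullet> f s)"
    using assms unfolding set_integrable_def eq by (rule integrable_inner_right[rotated])
  show "p \<bullet> (LINT s:A|N. f s) = (LINT s:A|N. p \<bullet> f s)"
    using assms unfolding set_integrable_def set_lebesgue_integral_def eq
    by (intro integral_inner_right[symmetric])
qed

locale msde =
  fixes D :: "(real^'d) set" and G :: "real^'d \<Rightarrow> real^'d" and b x :: "real \<Rightarrow> real^'d" and l :: "real \<Rightarrow> real"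
  assumes path: "msde_path D G b x l" and open_D: "open D"
begin

lemma l: "continuous_on {0..} l" "mono_on {0..} l" and x: "continuous_on {0..} x" "\<And>t. 0 \<le> t \<Longrightarrow> x t \<in> closure D"
  using path unfolding msde_path_def by auto

lemma increment:
  assumes t: "0 \<le> t" "t \<le> t'"
  obtains nv where "AE s in dL l. s \<in> {t<..t'} \<longrightarrow> inward_normal D (x s) (nv s)"
    "set_integrable lborel {t<..t'} (\<lambda>s. G (x s))" "set_integrable (dL l) {t<..t'} nv"
    "AE s in lborel. s \<in> {t<..t'} \<longrightarrow> x s \<in> D"
    "x t' - x t - (b t' - b t) = (LINT s:{t<..t'}|dL l. nv s) - (LINT s:{t<..t'}|lborel. G (x s))"
    "set_integrable lborel {t<..t'} (\<lambda>s. norm (indicator D (x s) *\<^sub>R G (x s)))"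
    "clock D G x l t' - clock D G x l t
      = (LINT s:{t<..t'}|lborel. norm (indicator D (x s) *\<^sub>R G (x s))) + (l t' - l t) + (t' - t)"
proof -
  obtain nv where nv: "AE s in dL l. 0 \<le> s \<longrightarrow> inward_normal D (x s) (nv s)"
    and P: "\<And>t. 0 \<le> t \<Longrightarrow> (AE s in lborel. s \<in> {0..t} \<longrightarrow> x s \<in> D) \<and>
           set_integrable lborel {0..t} (\<lambda>s. G (x s)) \<and> set_integrable (dL l) {0..t} nv \<and>
           x t = x 0 + b t - (LINT s:{0..t}|lborel. G (x s)) + (LINT s:{0..t}|dL l. nv s)"
    using path unfolding msde_path_def by blast
  have t': "0 \<le> t'" using t by simp
  have i1: "set_integrable lborel {0..t'} (\<lambda>s. G (x s))" and i2: "set_integrable (dL l) {0..t'} nv"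
    and D: "AE s in lborel. s \<in> {0..t'} \<longrightarrow> x s \<in> D"
    using P[OF t'] by auto
  have n2: "set_integrable lborel {0..t'} (\<lambda>s. norm (indicator D (x s) *\<^sub>R G (x s)))"
  proof (rule set_integrable_bound[OF i1])
    have "continuous_on UNIV (\<lambda>s. x (max 0 s))"
      by (rule continuous_on_compose2[OF x(1)]) (auto intro!: continuous_intros)
    then have xm: "(\<lambda>s. x (max 0 s)) \<in> borel_measurable borel" by (rule borel_measurable_continuous_onI)
    have im: "(\<lambda>s. indicator D (x (max 0 s)) :: real) \<in> borel_measurable borel"
      by (rule measurable_compose[OF xm borel_measurable_indicator]) (use open_D in auto)
    have gm: "(\<lambda>s. indicator {0..t'} s *\<^sub>R G (x s)) \<in> borel_measurable borel"
      using i1 unfolding set_integrable_def by (auto dest: borel_measurable_integrable)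
    have "(\<lambda>s. norm (indicator D (x (max 0 s)) *\<^sub>R (indicator {0..t'} s *\<^sub>R G (x s)))) \<in> borel_measurable borel"
      by (rule measurable_compose[OF borel_measurable_scaleR[OF im gm] borel_measurable_norm])
    also have "(\<lambda>s. norm (indicator D (x (max 0 s)) *\<^sub>R (indicator {0..t'} s *\<^sub>R G (x s))))
       = (\<lambda>s. indicator {0..t'} s *\<^sub>R norm (indicator D (x s) *\<^sub>R G (x s)))"
      by (auto simp: indicator_def)
    finally show "set_borel_measurable lborel {0..t'} (\<lambda>s. norm (indicator D (x s) *\<^sub>R G (x s)))"
      unfolding set_borel_measurable_def by simp
  qed (auto simp: indicator_def)
  note S1 = set_lebesgue_integral_split[OF i1 _ t] and S2 = set_lebesgue_integral_split[OF i2 sets_dL t]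
    and S3 = set_lebesgue_integral_split[OF n2 _ t]
  show ?thesis
  proof (rule that[of nv])
    show "AE s in dL l. s \<in> {t<..t'} \<longrightarrow> inward_normal D (x s) (nv s)"
      using nv by eventually_elim (use t in auto)
    show "AE s in lborel. s \<in> {t<..t'} \<longrightarrow> x s \<in> D" using D by eventually_elim (use t in auto)
    have "x t' - x t - (b t' - b t) = ((LINT s:{0..t'}|dL l. nv s) - (LINT s:{0..t}|dL l. nv s))
        - ((LINT s:{0..t'}|lborel. G (x s)) - (LINT s:{0..t}|lborel. G (x s)))"
      using P[OF t'] P[OF t(1)] by (simp add: algebra_simps)
    then show "x t' - x t - (b t' - b t) = (LINT s:{t<..t'}|dL l. nv s) - (LINT s:{t<..t'}|lborel. G (x s))"
      using S1(2) S2(2) by simp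
    show "clock D G x l t' - clock D G x l t
      = (LINT s:{t<..t'}|lborel. norm (indicator D (x s) *\<^sub>R G (x s))) + (l t' - l t) + (t' - t)"
      unfolding clock_def using S3(2) by simp
  qed (use S1(1) S2(1) S3(1) in auto)
qed

text \<open>A fixed covector \<open>p\<close> is paired with drift and reflection. The pointwise
  conditions inside and on the boundary integrate separately against Lebesgue measure and
  \<open>dL\<close>, and the three summands of the clock collect the errors from drift, reflection
  and \<open>f0\<close>.\<close>

lemma inner_increment_le:
  assumes t: "0 \<le> t" "t \<le> t'" and e: "0 \<le> e"
    and inside: "\<And>s. s \<in> {t..t'} \<Longrightarrow> x s \<in> D \<Longrightarrow> f0 - p \<bullet> G (x s) \<le> e * (norm (G (x s)) + 1)"
    and boundary: "\<And>s v. s \<in> {t..t'} \<Longrightarrow> inward_normal D (x s) v \<Longrightarrow> p \<bullet> v \<le> e"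
  shows "p \<bullet> (x t' - x t - (b t' - b t)) + f0 * (t' - t) \<le> e * (clock D G x l t' - clock D G x l t)"
proof -
  let ?A = "{t<..t'}" and ?g = "\<lambda>s. norm (indicator D (x s) *\<^sub>R G (x s))"
  obtain nv where nv: "AE s in dL l. s \<in> ?A \<longrightarrow> inward_normal D (x s) (nv s)"
    "set_integrable lborel ?A (\<lambda>s. G (x s))" "set_integrable (dL l) ?A nv"
    "AE s in lborel. s \<in> ?A \<longrightarrow> x s \<in> D"
    "x t' - x t - (b t' - b t) = (LINT s:?A|dL l. nv s) - (LINT s:?A|lborel. G (x s))"
    "set_integrable lborel ?A ?g"
    "clock D G x l t' - clock D G x l t = (LINT s:?A|lborel. ?g s) + (l t' - l t) + (t' - t)"
    by (rule increment[OF t])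
  note dl = measure_dL[OF l t]
  have em: "emeasure lborel ?A = ennreal (t' - t)" using t by simp
  have c1: "set_integrable (dL l) ?A (\<lambda>_. e)"
    unfolding set_integrable_def using dl(1) by (intro integrable_scaleR_left integrable_real_indicator) auto
  have c2: "set_integrable lborel ?A (\<lambda>_. c)" for c :: real
    unfolding set_integrable_def using em by (intro integrable_scaleR_left integrable_real_indicator) auto
  have "p \<bullet> (LINT s:?A|dL l. nv s) = (LINT s:?A|dL l. p \<bullet> nv s)"
    by (rule inner_set_lebesgue_integral[OF nv(3)])
  also have "\<dots> \<le> (LINT s:?A|dL l. e)"
  proof (rule set_integral_mono_AE[OF inner_set_lebesgue_integral(1)[OF nv(3)] c1])
    show "AE s\<in>?A in dL l. p \<bullet> nv s \<le> e" using nv(1)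
    proof eventually_elim
      case (elim s)
      then show ?case using boundary[of s "nv s"] by auto
    qed
  qed
  also have "\<dots> = (l t' - l t) * e" using dl by (subst set_integral_const) auto
  finally have 1: "p \<bullet> (LINT s:?A|dL l. nv s) \<le> (l t' - l t) * e" .
  have i: "set_integrable lborel ?A (\<lambda>s. (f0 - e) - e * ?g s)"
    by (intro set_integral_diff(1) c2 set_integrable_mult_right nv(6))
  have "(LINT s:?A|lborel. (f0 - e) - e * ?g s) \<le> (LINT s:?A|lborel. p \<bullet> G (x s))"
  proof (rule set_integral_mono_AE[OF i inner_set_lebesgue_integral(1)[OF nv(2)]])
    show "AE s\<in>?A in lborel. (f0 - e) - e * ?g s \<le> p \<bullet> G (x s)" using nv(4)
    proof eventually_elim
      case (elim s)
      show ?case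
      proof
        assume s: "s \<in> ?A"
        then have "x s \<in> D" using elim by blast
        then show "(f0 - e) - e * ?g s \<le> p \<bullet> G (x s)" using inside[of s] s by (simp add: algebra_simps)
      qed
    qed
  qed
  also have "(LINT s:?A|lborel. (f0 - e) - e * ?g s) = (t' - t) * (f0 - e) - e * (LINT s:?A|lborel. ?g s)"
    using em t by (subst set_integral_diff(2)[OF c2 set_integrable_mult_right[OF nv(6)]])
      (auto simp: set_integral_const)
  also have "(LINT s:?A|lborel. p \<bullet> G (x s)) = p \<bullet> (LINT s:?A|lborel. G (x s))"
    by (rule inner_set_lebesgue_integral(2)[OF nv(2), symmetric])
  finally have 2: "(t' - t) * (f0 - e) - e * (LINT s:?A|lborel. ?g s) \<le> p \<bullet> (LINT s:?A|lborel. G (x s))" .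
  show ?thesis unfolding nv(5) nv(7) inner_diff_right using 1 2 by (simp add: algebra_simps)
qed

text \<open>Apply the preceding estimate with \<open>p\<close> the normalised increment, f0 = 0 and
  e = 1; nonnegativity of the clock increment is the case p = 0.\<close>

lemma norm_increment_le:
  assumes t: "0 \<le> t" "t \<le> t'"
  shows "norm (x t' - x t - (b t' - b t)) \<le> clock D G x l t' - clock D G x l t"
proof (cases "x t' - x t - (b t' - b t) = 0")
  case True
  have "0 \<le> clock D G x l t' - clock D G x l t"
    using inner_increment_le[OF t, of 1 0 0] by simp
  then show ?thesis using True by simp
next
  case False
  define d where "d = x t' - x t - (b t' - b t)"
  define p where "p = d /\<^sub>R norm d"
  have "d \<noteq> 0" using False by (simp add: d_def)
  then have p: "norm p = 1" "p \<bullet> d = norm d"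
    by (auto simp: p_def power2_norm_eq_inner[symmetric] power2_eq_square)
  have le: "\<bar>p \<bullet> v\<bar> \<le> norm v" for v using Cauchy_Schwarz_ineq2[of p v] p by simp
  have "p \<bullet> d + 0 * (t' - t) \<le> 1 * (clock D G x l t' - clock D G x l t)"
    unfolding d_def
  proof (rule inner_increment_le[OF t])
    show "0 - p \<bullet> G (x s) \<le> 1 * (norm (G (x s)) + 1)" for s using le[of "G (x s)"] by auto
    show "p \<bullet> v \<le> 1" if "inward_normal D (x s) v" for s v
      using le[of v] that by (auto simp: inward_normal_def)
  qed auto
  then show ?thesis using p by (simp add: d_def)
qed

end

section \<open>Avoiding the wall\<close>

text \<open>Rounding the time down to a multiple of 1 / (k + 1) gives jointly measurable
  approximations, which converge by continuity of the paths.\<close>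

lemma continuous_process_measurable:
  fixes Z :: "real \<Rightarrow> 'w \<Rightarrow> 'b::{metric_space, second_countable_topology}"
  assumes Z: "\<And>u. Z u \<in> borel_measurable N"
    and cont: "\<And>\<omega>. \<omega> \<in> space N \<Longrightarrow> continuous_on UNIV (\<lambda>u. Z u \<omega>)"
  shows "(\<lambda>p. Z (snd p) (fst p)) \<in> borel_measurable (N \<Otimes>\<^sub>M lborel)"
proof (rule borel_measurable_LIMSEQ_metric)
  define r where "r = (\<lambda>(k::nat) u::real. real_of_int \<lfloor>u * real (Suc k)\<rfloor> / real (Suc k))"
  show "(\<lambda>p. Z (r k (snd p)) (fst p)) \<in> borel_measurable (N \<Otimes>\<^sub>M lborel)" for k
    unfolding r_def
  proof (rule measurable_compose_countable[where f="\<lambda>i p. Z (real_of_int i / real (Suc k)) (fst p)"])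
    show "(\<lambda>p. Z (real_of_int i / real (Suc k)) (fst p)) \<in> borel_measurable (N \<Otimes>\<^sub>M lborel)" for i
      by (rule measurable_compose[OF measurable_fst Z])
    show "(\<lambda>p. \<lfloor>snd p * real (Suc k)\<rfloor>) \<in> N \<Otimes>\<^sub>M lborel \<rightarrow>\<^sub>M count_space UNIV" by measurable
  qed
  fix p :: "'w \<times> real" assume "p \<in> space (N \<Otimes>\<^sub>M lborel)"
  then have p: "fst p \<in> space N" by (auto simp: space_pair_measure)
  have "(\<lambda>k. r k u) \<longlonglongrightarrow> u" for u
  proof (rule tendsto_sandwich)
    show "(\<lambda>k. u - 1 / real (Suc k)) \<longlonglongrightarrow> u"
      using tendsto_diff[OF tendsto_const LIMSEQ_inverse_real_of_nat, of u] by (simp add: inverse_eq_divide)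
    show "\<forall>\<^sub>F k in sequentially. u - 1 / real (Suc k) \<le> r k u"
    proof (intro always_eventually allI)
      fix k
      have "u * real (Suc k) - 1 \<le> real_of_int \<lfloor>u * real (Suc k)\<rfloor>" by linarith
      then have "(u * real (Suc k) - 1) / real (Suc k) \<le> r k u"
        unfolding r_def by (intro divide_right_mono) auto
      then show "u - 1 / real (Suc k) \<le> r k u" by (simp add: diff_divide_distrib)
    qed
    show "\<forall>\<^sub>F k in sequentially. r k u \<le> u"
    proof (intro always_eventually allI)
      fix k
      have "r k u \<le> (u * real (Suc k)) / real (Suc k)"
        unfolding r_def by (intro divide_right_mono) auto
      then show "r k u \<le> u" by simp
    qed
  qed auto
  moreover have "isCont (\<lambda>u. Z u (fst p)) (snd p)"
    using cont[OF p] by (simp add: continuous_on_eq_continuous_at)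
  ultimately show "(\<lambda>k. Z (r k (snd p)) (fst p)) \<longlonglongrightarrow> Z (snd p) (fst p)"
    by (rule isCont_tendsto_compose[rotated])
qed

lemma continuous_on_gradPhi:
  assumes "\<And>j. j \<in> {1..m} \<Longrightarrow> admissible_phi (phi j)"
  shows "continuous_on (domD m n a) (gradPhi m phi n a)"
  unfolding gradPhi_def
proof (intro continuous_on_sum continuous_on_scaleR continuous_on_const)
  fix j assume j: "j \<in> {1..m}"
  show "continuous_on (domD m n a) (\<lambda>x. dphi (phi j) (x \<bullet> n j - a j))"
    by (rule continuous_on_compose2[OF admissible_dphi(2)[OF assms[OF j]]])
      (use j in \<open>auto simp: domD_def intro!: continuous_intros\<close>)
qed

section \<open>Adaptedness of the clock and the choice of restart times\<close>

locale msde_process = filtered_bm M F B + polyhedron m phi n a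
  for M :: "'w measure" and F and B :: "real \<Rightarrow> 'w \<Rightarrow> real^'d" and m phi and n :: "nat \<Rightarrow> real^'d" and a +
  fixes X :: "real \<Rightarrow> 'w \<Rightarrow> real^'d" and L :: "real \<Rightarrow> 'w \<Rightarrow> real" and \<Omega>0 :: "'w set"
  assumes X: "\<And>t. 0 \<le> t \<Longrightarrow> X t \<in> borel_measurable (Ft t)"
    and L: "\<And>t. 0 \<le> t \<Longrightarrow> L t \<in> borel_measurable (Ft t)"
    and \<Omega>0: "\<Omega>0 \<in> F 0"
    and msde: "\<And>\<omega>. \<omega> \<in> \<Omega>0 \<Longrightarrow> msde_path (domD m n a) (gradPhi m phi n a) (\<lambda>t. B t \<omega>) (\<lambda>t. X t \<omega>) (\<lambda>t. L t \<omega>)"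
begin

abbreviation "D \<equiv> domD m n a"
abbreviation "G \<equiv> gradPhi m phi n a"

lemma msde_locale: "\<omega> \<in> \<Omega>0 \<Longrightarrow> msde D G (\<lambda>t. B t \<omega>) (\<lambda>t. X t \<omega>) (\<lambda>t. L t \<omega>)"
  by unfold_locales (auto simp: msde open_domD)

lemma \<Omega>0_in: "0 \<le> t \<Longrightarrow> \<Omega>0 \<in> sets (Ft t)"
  using \<Omega>0 filtration_mono[of 0 t] by (auto simp: sets_Ft)

lemma \<Omega>0_Int_in: "0 \<le> t \<Longrightarrow> \<Omega>0 \<inter> space (Ft t) \<in> sets (Ft t)"
  by (rule sets.Int[OF \<Omega>0_in sets.top])

lemma X_cont: "\<omega> \<in> \<Omega>0 \<Longrightarrow> continuous_on {0..} (\<lambda>t. X t \<omega>)"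
  using msde.x(1)[OF msde_locale] .

definition "d0 = (SOME x. x \<in> D)"

lemma d0: "d0 \<in> D"
  unfolding d0_def using nonempty by (metis ex_in_conv someI_ex)

text \<open>Off the good event the path is replaced by a constant in the domain, so that all paths
  are continuous and joint measurability holds on the whole space.\<close>

definition X' :: "real \<Rightarrow> 'w \<Rightarrow> real^'d" where "X' u \<omega> = (if \<omega> \<in> \<Omega>0 then X u \<omega> else d0)"

lemma X'_measurable: "0 \<le> u \<Longrightarrow> u \<le> t \<Longrightarrow> X' u \<in> borel_measurable (Ft t)"
  unfolding X'_def using \<Omega>0_Int_in[of t] measurable_Ft_mono[OF _ _ X, of u t]
  by (intro measurable_If_set) auto

text \<open>Clamping the time to [0, t] uses no value beyond time \<open>t\<close>; with N = Ft t
  this is progressive measurability.\<close>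

lemma X'_joint:
  assumes N: "\<And>u. 0 \<le> u \<Longrightarrow> u \<le> t \<Longrightarrow> X' u \<in> borel_measurable N" and t: "0 \<le> t"
  shows "(\<lambda>p. X' (max 0 (min t (snd p))) (fst p)) \<in> borel_measurable (N \<Otimes>\<^sub>M lborel)"
proof (rule continuous_process_measurable[where Z="\<lambda>u. X' (max 0 (min t u))"])
  show "X' (max 0 (min t u)) \<in> borel_measurable N" for u using t by (intro N) auto
  fix \<omega>
  show "continuous_on UNIV (\<lambda>u. X' (max 0 (min t u)) \<omega>)"
  proof (cases "\<omega> \<in> \<Omega>0")
    case True
    show ?thesis unfolding X'_def using True
      by (auto intro!: continuous_on_compose2[OF X_cont[OF True]] continuous_intros)
  qed (simp add: X'_def)
qed

text \<open>The drift field is continuous on \<open>D\<close> only, and the indicator turns its norm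
  into a Borel function. Solution paths are in \<open>D\<close> at almost every time, so the
  integral is unaffected.\<close>

definition Hnorm :: "real^'d \<Rightarrow> real" where "Hnorm y = norm (indicator D y *\<^sub>R G y)"

lemma Hnorm_measurable: "Hnorm \<in> borel_measurable borel"
  unfolding Hnorm_def
  by (rule measurable_compose[OF borel_measurable_continuous_on_indicator borel_measurable_norm])
    (auto simp: open_domD intro!: continuous_on_gradPhi phi)

text \<open>A version of the pathwise clock that is adapted by construction: on [0, t] the clamp is
  the identity, and on the good event all replacements are invisible.\<close>

definition q :: "real \<Rightarrow> 'w \<Rightarrow> real" where
  "q t \<omega> = (LINT s|lborel. indicator {0..t} s * Hnorm (X' (max 0 (min t s)) \<omega>)) + (if \<omega> \<in> \<Omega>0 then L t \<omega> else 0) + t"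

lemma q_clock:
  assumes "\<omega> \<in> \<Omega>0" "0 \<le> t" shows "q t \<omega> = clock D G (\<lambda>t. X t \<omega>) (\<lambda>t. L t \<omega>) t"
proof -
  have "(LINT s|lborel. indicator {0..t} s * Hnorm (X' (max 0 (min t s)) \<omega>))
      = (LINT s:{0..t}|lborel. norm (indicator D (X s \<omega>) *\<^sub>R G (X s \<omega>)))"
    unfolding set_lebesgue_integral_def using assms
    by (intro Bochner_Integration.integral_cong refl) (auto simp: indicator_def Hnorm_def X'_def)
  then show ?thesis using assms by (simp add: q_def clock_def)
qed

lemma q_measurable: "0 \<le> t \<Longrightarrow> q t \<in> borel_measurable (Ft t)"
proof -
  assume t: "0 \<le> t"
  have "(\<lambda>p. indicator {0..t} (snd p) * Hnorm (X' (max 0 (min t (snd p))) (fst p)))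
     \<in> borel_measurable (Ft t \<Otimes>\<^sub>M lborel)"
    using measurable_compose[OF X'_joint[OF X'_measurable t] Hnorm_measurable]
    by (intro borel_measurable_times) auto
  then have "(\<lambda>\<omega>. LINT s|lborel. indicator {0..t} s * Hnorm (X' (max 0 (min t s)) \<omega>)) \<in> borel_measurable (Ft t)"
    by (intro lborel.borel_measurable_lebesgue_integral) (simp add: case_prod_beta)
  moreover have "(\<lambda>\<omega>. if \<omega> \<in> \<Omega>0 then L t \<omega> else 0) \<in> borel_measurable (Ft t)"
    using \<Omega>0_Int_in[OF t] L[OF t] by (intro measurable_If_set) auto
  ultimately show ?thesis unfolding q_def by measurable
qed

text \<open>Almost surely the path is in \<open>D\<close> at almost every time; Fubini exchanges the
  quantifiers, so at almost every fixed time it is in \<open>D\<close> almost surely, and an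
  interval of positive length contains such a time.\<close>

lemma good_times:
  assumes full: "AE \<omega> in M. \<omega> \<in> \<Omega>0" and \<alpha>: "0 \<le> \<alpha>" "\<alpha> < \<beta>"
  shows "\<exists>s. \<alpha> < s \<and> s < \<beta> \<and> (AE \<omega> in M. X s \<omega> \<in> D)"
proof -
  interpret P: pair_sigma_finite M lborel ..
  let ?Z = "\<lambda>\<omega> s. X' (max 0 (min \<beta> s)) \<omega>"
  have \<beta>: "0 \<le> \<beta>" using \<alpha> by simp
  have "(\<lambda>p. ?Z (fst p) (snd p)) \<in> borel_measurable (M \<Otimes>\<^sub>M lborel)"
    by (rule X'_joint[OF _ \<beta>]) (rule measurable_Ft_M[OF \<beta> X'_measurable])
  from measurable_sets[OF this borel_open[OF open_domD]]
  have D1: "{p \<in> space (M \<Otimes>\<^sub>M lborel). ?Z (fst p) (snd p) \<in> D} \<in> sets (M \<Otimes>\<^sub>M lborel)"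
    by (simp add: vimage_def Int_def conj_commute)
  have D2: "{p \<in> space (M \<Otimes>\<^sub>M lborel). snd p \<notin> {\<alpha><..<\<beta>}} \<in> sets (M \<Otimes>\<^sub>M lborel)"
    by measurable
  have meas: "{p \<in> space (M \<Otimes>\<^sub>M lborel). snd p \<notin> {\<alpha><..<\<beta>} \<or> ?Z (fst p) (snd p) \<in> D} \<in> sets (M \<Otimes>\<^sub>M lborel)"
  proof -
    have "{p \<in> space (M \<Otimes>\<^sub>M lborel). snd p \<notin> {\<alpha><..<\<beta>} \<or> ?Z (fst p) (snd p) \<in> D}
      = {p \<in> space (M \<Otimes>\<^sub>M lborel). snd p \<notin> {\<alpha><..<\<beta>}} \<union> {p \<in> space (M \<Otimes>\<^sub>M lborel). ?Z (fst p) (snd p) \<in> D}"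
      by auto
    then show ?thesis using sets.Un[OF D2 D1] by simp
  qed
  have "AE \<omega> in M. AE s in lborel. s \<notin> {\<alpha><..<\<beta>} \<or> ?Z \<omega> s \<in> D"
    using full
  proof eventually_elim
    case (elim \<omega>)
    have "AE s in lborel. s \<in> {0..\<beta>} \<longrightarrow> X s \<omega> \<in> D"
      using msde[OF elim] \<beta> unfolding msde_path_def by blast
    then show ?case by eventually_elim (use \<alpha> elim in \<open>auto simp: X'_def\<close>)
  qed
  then have "AE s in lborel. AE \<omega> in M. s \<notin> {\<alpha><..<\<beta>} \<or> ?Z \<omega> s \<in> D"
    by (subst (asm) P.AE_commute[OF meas])
  moreover have "\<not> (AE s in lborel. s \<notin> {\<alpha><..<\<beta>})"
  proof -
    have "{s \<in> space lborel. \<not> s \<notin> {\<alpha><..<\<beta>}} = {\<alpha><..<\<beta>}" by auto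
    then show ?thesis using \<alpha> by (subst AE_iff_measurable[where N="{\<alpha><..<\<beta>}"]) auto
  qed
  ultimately obtain s where s: "s \<in> {\<alpha><..<\<beta>}" "AE \<omega> in M. s \<notin> {\<alpha><..<\<beta>} \<or> ?Z \<omega> s \<in> D"
    by (metis (mono_tags, lifting) AE_mp AE_I2)
  have "AE \<omega> in M. X s \<omega> \<in> D"
    using s(2) full by eventually_elim (use s(1) \<alpha> in \<open>auto simp: X'_def\<close>)
  then show ?thesis using s(1) by auto
qed

text \<open>The abstract non-attainability result for one active set \<open>J\<close>, with
  \<open>p\<close> controlling both the slack of the other constraints and the size of the path. The
  conclusion depends on \<open>x0\<close> only through \<open>J\<close>, so one base point per
  active set is enough.\<close>

lemma face_avoided:
  fixes p :: nat
  assumes i: "i \<in> J" and x0: "x0 \<in> closure D" and J: "J = {j\<in>{1..m}. x0 \<bullet> n j = a j}"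
    and scale: "scale_p (phi i) 0 = - \<infinity>"
    and s: "0 \<le> s" and start: "AE \<omega> in M. X s \<omega> \<in> D"
  shows "AE \<omega> in M. \<omega> \<in> \<Omega>0 \<longrightarrow> \<not> (\<exists>t>s. (\<forall>u\<in>{s..t}. (\<forall>k\<in>{1..m} - J. 1 / real (Suc p) \<le> X u \<omega> \<bullet> n k - a k) \<and> norm (X u \<omega>) \<le> real p)
      \<and> (\<forall>j\<in>J. X t \<omega> \<bullet> n j = a j))"
proof -
  have im: "i \<in> {1..m}" using i J by auto
  have "\<exists>S. orthonormal S \<and> span S = span (n ` J) \<and> (J = {i} \<and> card S = 1 \<or> 2 \<le> card S)"
  proof (cases "J = {i}")
    case True
    then show ?thesis using norm_n[OF im] by (intro exI[of _ "{n i}"]) (auto simp: orthonormal_def pairwise_def)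
  next
    case False
    then obtain j where j: "j \<in> J" "j \<noteq> i" using i by blast
    obtain S where S: "pairwise orthogonal S" "\<And>x. x \<in> S \<Longrightarrow> norm x = 1" "independent S"
      "card S = dim (span (n ` J))" "span S = span (n ` J)"
      using orthonormal_basis_subspace[OF subspace_span[of "n ` J"]] by metis
    \<comment> \<open>A second active constraint supplies two independent normals, so the span has
      dimension at least two.\<close>
    have ind: "independent {n i, n j}" "n i \<noteq> n j"
      using active_pair_independent[OF x0, of i j] j i J by auto
    have "card {n i, n j} \<le> dim (span (n ` J))"
      by (rule independent_card_le_dim[OF _ ind(1)]) (use i j in \<open>auto intro: span_base\<close>)
    then have "2 \<le> card S" using ind(2) S(4) by simp
    moreover have "orthonormal S" using S independent_imp_finite by (auto simp: orthonormal_def)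
    ultimately show ?thesis using S(5) by blast
  qed
  then obtain S where span_S: "orthonormal S" "span S = span (n ` J)" "J = {i} \<and> card S = 1 \<or> 2 \<le> card S" by blast
  define Y where "Y = (\<lambda>x. proj S (x - x0))"
  define U where "U = {x. (\<forall>j\<in>{1..m}. a j \<le> x \<bullet> n j) \<and> (\<forall>k\<in>{1..m} - J. 1 / real (Suc p) \<le> x \<bullet> n k - a k) \<and> norm x \<le> real p}"
  interpret face m phi n a i x0 J S "1 / real (Suc p)" "real p" Y U
    by unfold_locales (rule i x0 J span_S(1) span_S(2) Y_def U_def | simp)+
  obtain w w' w'' where w: "\<And>r. 0 < r \<Longrightarrow> (w has_real_derivative w' r) (at r)"
    "\<And>r. 0 < r \<Longrightarrow> (w' has_real_derivative w'' r) (at r)"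
    "continuous_on {0<..} w''" "\<And>r. 0 < r \<Longrightarrow> w' r \<le> 0" "filterlim w at_top (at_right 0)"
    and lyap: "\<And>x. x \<in> U \<Longrightarrow> x \<in> D \<Longrightarrow> w' ((norm (Y x))\<^sup>2) * (real (card S) - 2 * (Y x \<bullet> G x))
       + 2 * (norm (Y x))\<^sup>2 * w'' ((norm (Y x))\<^sup>2) \<le> 0"
    using face_lyapunov[OF scale span_S(3)] by blast
  define F1 where "F1 = (\<lambda>x. (2 * w' ((norm (Y x))\<^sup>2)) *\<^sub>R Y x)"
  define F0 where "F0 = (\<lambda>x. real (card S) * w' ((norm (Y x))\<^sup>2) + 2 * (norm (Y x))\<^sup>2 * w'' ((norm (Y x))\<^sup>2))"
  interpret LS: lyapunov_setup M F B X q \<Omega>0 U S x0 w w' w'' Y F1 F0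
  proof unfold_locales
    fix \<omega> t t' e assume \<omega>: "\<omega> \<in> \<Omega>0" and t: "0 \<le> t" "t \<le> (t'::real)" and e: "0 \<le> (e::real)"
      and u: "\<And>u. u \<in> {t..t'} \<Longrightarrow> X u \<omega> \<in> U \<and> Y (X u \<omega>) \<noteq> 0 \<and> norm (F1 (X t \<omega>) - F1 (X u \<omega>)) \<le> e
           \<and> \<bar>F0 (X t \<omega>) - F0 (X u \<omega>)\<bar> \<le> e"
    interpret ms: msde D G "\<lambda>t. B t \<omega>" "\<lambda>t. X t \<omega>" "\<lambda>t. L t \<omega>" by (rule msde_locale[OF \<omega>])
    have t': "0 \<le> t'" using t by simp
    show "F1 (X t \<omega>) \<bullet> (X t' \<omega> - X t \<omega> - (B t' \<omega> - B t \<omega>)) + F0 (X t \<omega>) * (t' - t) \<le> e * (q t' \<omega> - q t \<omega>)"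
      unfolding q_clock[OF \<omega> t'] q_clock[OF \<omega> t(1)]
    proof (rule ms.inner_increment_le[OF t e])
      fix s assume s: "s \<in> {t..t'}" and sD: "X s \<omega> \<in> D"
      note us = u[OF s]
      \<comment> \<open>The Lyapunov inequality holds at the current point, whereas
        \<open>F1\<close> and \<open>F0\<close> are frozen at time \<open>t\<close>; the exchange
        costs e * norm (G (X s \<omega>)) and \<open>e\<close>.\<close>
      have "F0 (X s \<omega>) - F1 (X s \<omega>) \<bullet> G (X s \<omega>) \<le> 0"
        using lyap[of "X s \<omega>"] us sD by (simp add: F0_def F1_def algebra_simps)
      moreover have "F0 (X t \<omega>) \<le> F0 (X s \<omega>) + e" using us by linarith
      moreover have "(F1 (X s \<omega>) - F1 (X t \<omega>)) \<bullet> G (X s \<omega>) \<le> e * norm (G (X s \<omega>))"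
        using us by (intro order_trans[OF norm_cauchy_schwarz] mult_right_mono) (auto simp: norm_minus_commute)
      ultimately show "F0 (X t \<omega>) - F1 (X t \<omega>) \<bullet> G (X s \<omega>) \<le> e * (norm (G (X s \<omega>)) + 1)"
        by (simp add: inner_diff_left algebra_simps)
    next
      fix s v assume s: "s \<in> {t..t'}" and v: "inward_normal D (X s \<omega>) v"
      note us = u[OF s]
      \<comment> \<open>Reflection pushes |Y| up and \<open>w\<close> is antitone, so at the current
        point the reflection term has the right sign.\<close>
      have "0 \<le> Y (X s \<omega>) \<bullet> v" using us v by (intro inward_normal_Y) auto
      moreover have "w' ((norm (Y (X s \<omega>)))\<^sup>2) \<le> 0" using us by (intro w(4)) auto
      ultimately have "F1 (X s \<omega>) \<bullet> v \<le> 0" by (simp add: F1_def mult_nonpos_nonneg)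
      moreover have "(F1 (X t \<omega>) - F1 (X s \<omega>)) \<bullet> v \<le> e * 1"
        using us v by (intro order_trans[OF norm_cauchy_schwarz] mult_mono) (auto simp: inward_normal_def)
      ultimately show "F1 (X t \<omega>) \<bullet> v \<le> e" by (simp add: inner_diff_left)
    qed
  next
    fix \<omega> t t' assume \<omega>: "\<omega> \<in> \<Omega>0" and t: "0 \<le> t" "t \<le> (t'::real)"
    interpret ms: msde D G "\<lambda>t. B t \<omega>" "\<lambda>t. X t \<omega>" "\<lambda>t. L t \<omega>" by (rule msde_locale[OF \<omega>])
    have t': "0 \<le> t'" using t by simp
    show "norm (X t' \<omega> - X t \<omega> - (B t' \<omega> - B t \<omega>)) \<le> q t' \<omega> - q t \<omega>"
      unfolding q_clock[OF \<omega> t'] q_clock[OF \<omega> t(1)] by (rule ms.norm_increment_le[OF t])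
  qed (use \<Omega>0 X q_measurable X_cont closed_U bounded_U span_S(1) w in \<open>auto simp: Y_def F1_def F0_def\<close>)
  have "AE \<omega> in M. Y (X s \<omega>) \<noteq> 0" using start by eventually_elim (rule Y_nonzero)
  from LS.never_hits[OF s this] show ?thesis
  proof eventually_elim
    case (elim \<omega>)
    show ?case
    proof (intro impI notI, elim exE conjE)
      fix t assume \<omega>: "\<omega> \<in> \<Omega>0" and t: "s < t"
        and u: "\<forall>u\<in>{s..t}. (\<forall>k\<in>{1..m} - J. 1 / real (Suc p) \<le> X u \<omega> \<bullet> n k - a k) \<and> norm (X u \<omega>) \<le> real p"
        and hit: "\<forall>j\<in>J. X t \<omega> \<bullet> n j = a j"
      have "X u \<omega> \<in> U" if "u \<in> {s..t}" for u
      proof -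
        have "X u \<omega> \<in> closure D" using msde.x(2)[OF msde_locale[OF \<omega>]] that s by auto
        then show ?thesis using u that unfolding U_def closure_D by blast
      qed
      moreover have "Y (X t \<omega>) = 0" using hit by (intro Y_eq_0) auto
      ultimately show False using elim \<omega> t by blast
    qed
  qed
qed

text \<open>At a hit of the wall let \<open>J\<close> be the set of constraints active there. The
  others keep positive slack on a short time interval before the hit, which contains a restart time;
  only countably many triples of active set, slack level and rational interval occur, so one null
  set covers them all.\<close>

theorem wall_avoided:
  assumes full: "AE \<omega> in M. \<omega> \<in> \<Omega>0" and i: "i \<in> {1..m}" and scale: "scale_p (phi i) 0 = - \<infinity>"
  shows "AE \<omega> in M. \<forall>t>0. X t \<omega> \<bullet> n i \<noteq> a i"
proof -
  have "\<forall>r::rat \<times> rat. \<exists>s. 0 \<le> real_of_rat (fst r) \<and> real_of_rat (fst r) < real_of_rat (snd r) \<longrightarrow>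
      real_of_rat (fst r) < s \<and> s < real_of_rat (snd r) \<and> (AE \<omega> in M. X s \<omega> \<in> D)"
    using good_times[OF full] by blast
  from choice[OF this] obtain \<sigma> where \<sigma>: "\<And>r1 r2. 0 \<le> real_of_rat r1 \<Longrightarrow> real_of_rat r1 < real_of_rat r2 \<Longrightarrow>
      real_of_rat r1 < \<sigma> (r1, r2) \<and> \<sigma> (r1, r2) < real_of_rat r2 \<and> (AE \<omega> in M. X (\<sigma> (r1, r2)) \<omega> \<in> D)"
    by auto
  define faces where "faces = {J. i \<in> J \<and> (\<exists>x0\<in>closure D. J = {j\<in>{1..m}. x0 \<bullet> n j = a j})}"
  define good where "good = {r::rat \<times> rat. 0 \<le> real_of_rat (fst r) \<and> real_of_rat (fst r) < real_of_rat (snd r)}"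
  have fin: "countable faces"
    by (rule countable_finite, rule finite_subset[of _ "Pow {1..m}"]) (auto simp: faces_def)
  define hits where "hits = (\<lambda>J (p::nat) r \<omega>. \<exists>t>\<sigma> r.
      (\<forall>u\<in>{\<sigma> r..t}. (\<forall>k\<in>{1..m} - J. 1 / real (Suc p) \<le> X u \<omega> \<bullet> n k - a k) \<and> norm (X u \<omega>) \<le> real p)
      \<and> (\<forall>j\<in>J. X t \<omega> \<bullet> n j = a j))"
  have "AE \<omega> in M. \<omega> \<in> \<Omega>0 \<longrightarrow> \<not> hits J p r \<omega>" if J: "J \<in> faces" and r: "r \<in> good" for J p r
  proof -
    obtain x0 where x0: "i \<in> J" "x0 \<in> closure D" "J = {j\<in>{1..m}. x0 \<bullet> n j = a j}" using J by (auto simp: faces_def)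
    have "0 \<le> real_of_rat (fst r)" "real_of_rat (fst r) < real_of_rat (snd r)"
      using r unfolding good_def by blast+
    note \<sigma>r = this(1) \<sigma>[OF this, unfolded prod.collapse]
    have "0 \<le> \<sigma> r" using \<sigma>r by linarith
    moreover have "AE \<omega> in M. X (\<sigma> r) \<omega> \<in> D" using \<sigma>r(2) by blast
    ultimately show ?thesis unfolding hits_def by (rule face_avoided[OF x0 scale])
  qed
  then have "AE \<omega> in M. \<forall>J\<in>faces. \<forall>p. \<forall>r\<in>good. \<omega> \<in> \<Omega>0 \<longrightarrow> \<not> hits J p r \<omega>"
    by (intro AE_ball_countable[OF fin, THEN iffD2] ballI AE_all_countable[THEN iffD2] allI
        AE_ball_countable[OF countableI_type, THEN iffD2])
  then show ?thesis using full
  proof eventually_elim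
    case (elim \<omega>)
    show ?case
    proof (intro allI impI notI)
      fix t :: real assume t: "0 < t" and hit: "X t \<omega> \<bullet> n i = a i"
      define J where "J = {j\<in>{1..m}. X t \<omega> \<bullet> n j = a j}"
      have Xt: "X t \<omega> \<in> closure D" using msde.x(2)[OF msde_locale[OF elim(2)]] t by simp
      have J: "J \<in> faces" using Xt hit i by (auto simp: faces_def J_def)
      have pos: "0 < X t \<omega> \<bullet> n k - a k" if "k \<in> {1..m} - J" for k
        using Xt that unfolding closure_D J_def by force
      \<comment> \<open>The least slack among the inactive constraints; inserting 1 keeps the
        minimum meaningful when all constraints are active.\<close>
      define z where "z = Min (insert 1 ((\<lambda>k. X t \<omega> \<bullet> n k - a k) ` ({1..m} - J)))"
      have z: "0 < z" "\<And>k. k \<in> {1..m} - J \<Longrightarrow> z \<le> X t \<omega> \<bullet> n k - a k"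
        using pos by (auto simp: z_def)
      obtain p1 where p1: "1 / real (Suc p1) < z" using reals_Archimedean[OF z(1)] by (auto simp: inverse_eq_divide)
      obtain p2 where p2: "norm (X t \<omega>) < real p2" using reals_Archimedean2 by blast
      define p where "p = p1 + p2"
      have p: "1 / real (Suc p) < z" "norm (X t \<omega>) < real p"
      proof -
        have "1 / real (Suc p) \<le> 1 / real (Suc p1)" by (simp add: p_def field_simps)
        then show "1 / real (Suc p) < z" using p1 by linarith
      qed (use p2 in \<open>simp add: p_def\<close>)
      define V where "V = (\<Inter>k\<in>{1..m} - J. {x. 1 / real (Suc p) < x \<bullet> n k - a k}) \<inter> {x. norm x < real p}"
      have oV: "open V" unfolding V_def
        by (intro open_Int open_INT ballI open_Collect_less continuous_intros) auto
      have XV: "X t \<omega> \<in> V" using p z(2) by (force simp: V_def)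
      have "((\<lambda>u. X u \<omega>) \<longlongrightarrow> X t \<omega>) (at t within {0..})"
        using X_cont[OF elim(2)] t by (simp add: continuous_on_def)
      then have "\<forall>\<^sub>F u in at t within {0..}. X u \<omega> \<in> V" using oV XV by (rule topological_tendstoD)
      then obtain d where d: "0 < d" "\<And>u. 0 \<le> u \<Longrightarrow> u \<noteq> t \<Longrightarrow> dist u t < d \<Longrightarrow> X u \<omega> \<in> V"
        unfolding eventually_at by auto
      \<comment> \<open>Two rationals in (max 0 (t - d), t): the restart time attached to them lies
        in between, hence the path is in \<open>V\<close> from that time up to
        \<open>t\<close>.\<close>
      obtain r2 where r2: "max 0 (t - d) < real_of_rat r2" "real_of_rat r2 < t"
        using of_rat_dense[of "max 0 (t - d)" t] t d by auto
      obtain r1 where r1: "max 0 (t - d) < real_of_rat r1" "real_of_rat r1 < real_of_rat r2"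
        using of_rat_dense[OF r2(1)] by auto
      have r: "(r1, r2) \<in> good" using r1 by (auto simp: good_def)
      have \<sigma>r: "max 0 (t - d) < \<sigma> (r1, r2)" "\<sigma> (r1, r2) < t"
      proof -
        have "0 \<le> real_of_rat r1" using r1(1) by linarith
        from \<sigma>[OF this r1(2)] show "max 0 (t - d) < \<sigma> (r1, r2)" "\<sigma> (r1, r2) < t" using r1(1) r2(2) by linarith+
      qed
      have "X u \<omega> \<in> V" if "u \<in> {\<sigma> (r1, r2)..t}" for u
        using d(2)[of u] that \<sigma>r \<open>X t \<omega> \<in> V\<close> by (cases "u = t") (auto simp: dist_real_def)
      then have "hits J p (r1, r2) \<omega>"
        unfolding hits_def V_def using \<sigma>r(2) by (intro exI[of _ t]) (force simp: J_def)
      then show False using elim J r by blast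
    qed
  qed
qed

end

section \<open>From avoidance of the wall to the hitting times\<close>

theorem theorem6:
  fixes M :: "'w measure" and F :: "real \<Rightarrow> 'w set set"
    and B X :: "real \<Rightarrow> 'w \<Rightarrow> real ^ 'd" and L :: "real \<Rightarrow> 'w \<Rightarrow> real"
    and m :: nat and phi :: "nat \<Rightarrow> real \<Rightarrow> ereal"
    and n :: "nat \<Rightarrow> real ^ 'd" and a :: "nat \<Rightarrow> real" and i :: nat
  assumes "prob_space M"
    and "usual_filtration M F"
    and "brownian_motion M F B"
    and "\<forall>j\<in>{1..m}. admissible_phi (phi j)"
    and "\<forall>j\<in>{1..m}. norm (n j) = 1"
    and "inj_on n {1..m}"
    and "domD m n a \<noteq> {}"
    and "msde_solution M F B (domD m n a) (gradPhi m phi n a) X L"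
    and "i \<in> {1..m}"
    and "scale_p (phi i) 0 = - \<infinity>"
  shows "measure M {\<omega>\<in>space M. hit_time X {x. x \<bullet> n i = a i} \<omega> = \<infinity>} = 1
       \<and> measure M {\<omega>\<in>space M. hit_time X {x. x \<bullet> n i = a i \<and> (\<forall>j\<in>{1..m}-{i}. x \<bullet> n j > a j)} \<omega> = \<infinity>} = 1"
proof -
  interpret prob_space M by fact
  interpret filtered_bm M F B by unfold_locales fact+
  interpret polyhedron m phi n a
    by unfold_locales (use assms(4-7) in blast)+
  have sol: "adapted M F X" "adapted M F L"
    "AE \<omega> in M. msde_path (domD m n a) (gradPhi m phi n a) (\<lambda>t. B t \<omega>) (\<lambda>t. X t \<omega>) (\<lambda>t. L t \<omega>)"
    using assms(8) unfolding msde_solution_def by blast+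
  \<comment> \<open>The exceptional set is enlarged to a null set, which lies in \<open>F 0\<close>
    by the usual conditions; the good event is therefore known at time 0.\<close>
  obtain N where N: "N \<in> null_sets M"
    "{\<omega>\<in>space M. \<not> msde_path (domD m n a) (gradPhi m phi n a) (\<lambda>t. B t \<omega>) (\<lambda>t. X t \<omega>) (\<lambda>t. L t \<omega>)} \<subseteq> N"
    using sol(3) unfolding eventually_ae_filter by blast
  interpret F0: sigma_algebra "space M" "F 0" by (rule filtration_algebra) simp
  interpret msde_process M F B m phi n a X L "space M - N"
  proof unfold_locales
    show "X t \<in> borel_measurable (Ft t)" "L t \<in> borel_measurable (Ft t)" if "0 \<le> t" for t
      using sol(1,2) that unfolding adapted_iff_measurable by blast+
    show "space M - N \<in> F 0" using N(1) filtration_null by (intro F0.compl_sets) blast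
  qed (use N(2) in blast)
  have "AE \<omega> in M. \<omega> \<in> space M - N" using AE_not_in[OF N(1)] AE_space by eventually_elim simp
  from wall_avoided[OF this assms(9,10)] have avoid: "AE \<omega> in M. \<forall>t>0. X t \<omega> \<bullet> n i \<noteq> a i" .
  \<comment> \<open>Both target sets lie in the hyperplane, so one argument serves them. The infimum
    over an empty set of times is infinite, and completeness of the measure makes the event
    measurable.\<close>
  have never: "measure M {\<omega>\<in>space M. hit_time X A \<omega> = \<infinity>} = 1" if A: "A \<subseteq> {x. x \<bullet> n i = a i}" for A
  proof -
    have AE: "AE \<omega> in M. hit_time X A \<omega> = \<infinity>"
      using avoid
    proof eventually_elim
      case (elim \<omega>)
      then have "{ereal t | t. t > 0 \<and> X t \<omega> \<in> A} = {}" using A by blast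
      then show ?case unfolding hit_time_def by (simp only: Inf_empty top_ereal_def)
    qed
    then obtain N' where N': "N' \<in> null_sets M" "{\<omega>\<in>space M. hit_time X A \<omega> \<noteq> \<infinity>} \<subseteq> N'"
      unfolding eventually_ae_filter by blast
    have "{\<omega>\<in>space M. hit_time X A \<omega> \<noteq> \<infinity>} \<in> sets M"
      by (rule complete_measure.complete[OF complete N'(2,1)])
    then have "space M - {\<omega>\<in>space M. hit_time X A \<omega> \<noteq> \<infinity>} \<in> sets M" by (rule sets.compl_sets)
    also have "space M - {\<omega>\<in>space M. hit_time X A \<omega> \<noteq> \<infinity>} = {\<omega>\<in>space M. hit_time X A \<omega> = \<infinity>}" by blast
    finally show ?thesis using AE by (simp add: prob_Collect_eq_1)
  qed
  show ?thesis by (intro conjI never) auto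
qed

end
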